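(* Let $(a_k)_{k\ge 1}$ and $(b_k)_{k\ge 1}$ be two independent stationary centered Gaussian sequences with unit variance and the same correlation function $\rho:\mathbb N\to\mathbb R$, i.e. $\mathbb E[a_k a_\ell]=\mathbb E[b_k b_\ell]=\rho(|k-\ell|)$ and $\mathbb E[a_k b_\ell]=0$ for all $k,\ell\ge 1$. Assume that the spectral function $\psi_\rho$ of $\rho$ exists, that $\psi_\rho\in L^1([0,2\pi],dx)$, that $\psi_\rho$ is continuous on the open interval $(0,2\pi)$, and that $\gamma_\rho:=\inf_{t\in(0,2\pi)}\psi_\rho(t)>0$. For $n\ge1$ let $f_n(t)=\sum_{k=1}^n \big(a_k\cos(kt)+b_k\sin(kt)\big)$, and let $N_n([0,2\pi])$ be the number of real zeros of $f_n$ in $[0,2\pi]$. Then, as $n\to+\infty$, $$\mathbb E\left[N_n([0,2\pi])\right]=\frac{2n}{\sqrt 3}\,(1+o(1)).$$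
   Context: The two sequences are jointly Gaussian (each is a Gaussian process and they are independent of each other), and $\rho(0)=1$. The spectral function of $\rho$ is the function given by $\psi_\rho(x):=\sum_{k\in\mathbb Z}\rho(|k|)e^{ikx}$ for $x\in(0,2\pi)$, extended $2\pi$-periodically; the numbers $\rho(|k|)$ are its Fourier coefficients, $\rho(|k|)=\frac{1}{2\pi}\int_0^{2\pi}\psi_\rho(x)e^{-ikx}\,dx$ for all $k\in\mathbb Z$. The function $\psi_\rho$ may be unbounded near $0$ and $2\pi$. *)

theory Defs
  imports "HOL-Probability.Probability"
begin

text \<open>Normal laws on the line, point masses (zero variance) included.\<close>

definition gaussian_rv :: "'a measure \<Rightarrow> ('a \<Rightarrow> real) \<Rightarrow> bool" where
  "gaussian_rv M X \<longleftrightarrow>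
     (\<exists>\<mu> \<sigma>. \<sigma> > 0 \<and> distributed M lborel X (normal_density \<mu> \<sigma>)) \<or>
     (\<exists>\<mu>. X \<in> borel_measurable M \<and> (AE \<omega> in M. X \<omega> = \<mu>))"

definition gaussian_process :: "'a measure \<Rightarrow> 'i set \<Rightarrow> ('i \<Rightarrow> 'a \<Rightarrow> real) \<Rightarrow> bool" where
  "gaussian_process M I X \<longleftrightarrow>
     (\<forall>J c. finite J \<longrightarrow> J \<subseteq> I \<longrightarrow> gaussian_rv M (\<lambda>\<omega>. \<Sum>i\<in>J. c i * X i \<omega>))"

text \<open>Sequences are indexed by the positive integers; the value at \<open>0\<close> is irrelevant.
  For a centered Gaussian process, stationarity means exactly that the covariance depends only
  on the distance of the indices.\<close>

definition stationary_gaussian_seq ::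
    "'a measure \<Rightarrow> (nat \<Rightarrow> real) \<Rightarrow> (nat \<Rightarrow> 'a \<Rightarrow> real) \<Rightarrow> bool" where
  "stationary_gaussian_seq M \<rho> a \<longleftrightarrow>
     gaussian_process M {1..} a \<and>
     (\<forall>k\<ge>1. (LINT \<omega>|M. a k \<omega>) = 0) \<and>
     (\<forall>k\<ge>1. \<forall>l\<ge>1. (LINT \<omega>|M. a k \<omega> * a l \<omega>) = \<rho> (nat \<bar>int k - int l\<bar>))"

text \<open>The bilateral series is summed symmetrically. Convergence is only required on
  \<open>(0, 2\<pi>)\<close>, so the values of \<open>\<psi>\<close> on \<open>2\<pi>\<int>\<close> are arbitrary.\<close>

definition is_spectral_function :: "(nat \<Rightarrow> real) \<Rightarrow> (real \<Rightarrow> real) \<Rightarrow> bool" where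
  "is_spectral_function \<rho> \<psi> \<longleftrightarrow>
     (\<forall>x\<in>{0<..<2*pi}.
        (\<lambda>N. \<Sum>k = - int N..int N.
           complex_of_real (\<rho> (nat \<bar>k\<bar>)) * exp (\<i> * of_int k * complex_of_real x))
        \<longlonglongrightarrow> complex_of_real (\<psi> x)) \<and>
     (\<forall>x. \<psi> (x + 2*pi) = \<psi> x) \<and>
     (\<forall>k::int. complex_of_real (\<rho> (nat \<bar>k\<bar>)) =
        1 / (2 * complex_of_real pi) *
        (LINT x:{0..2*pi}|lborel.
           complex_of_real (\<psi> x) * exp (- \<i> * of_int k * complex_of_real x)))"

definition trig_poly ::
    "(nat \<Rightarrow> 'a \<Rightarrow> real) \<Rightarrow> (nat \<Rightarrow> 'a \<Rightarrow> real) \<Rightarrow> nat \<Rightarrow> 'a \<Rightarrow> real \<Rightarrow> real" where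
  "trig_poly a b n \<omega> t = (\<Sum>k=1..n. a k \<omega> * cos (real k * t) + b k \<omega> * sin (real k * t))"

text \<open>Distinct zeros are counted, without multiplicity; the count is \<open>\<infinity>\<close> if there are
  infinitely many.\<close>

definition num_zeros :: "real set \<Rightarrow> (real \<Rightarrow> real) \<Rightarrow> ennreal" where
  "num_zeros A f = emeasure (count_space UNIV) {t\<in>A. f t = 0}"

end

theory Submission
  imports Defs "HOL-Real_Asymp.Real_Asymp"
begin

text \<open>
  Write \<open>f\<close> for the random trigonometric polynomial of degree \<open>n\<close> and let \<open>V\<close>, \<open>B\<close>, \<open>C\<close> be the
  variance of \<open>f t\<close>, the covariance of \<open>f t\<close> and \<open>f' t\<close>, and the variance of \<open>f' t\<close>. The Kac-Rice
  formula (\<open>expectation_num_zeros\<close>) says that the expected number of zeros is the integral over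
  \<open>(0, 2\<pi>)\<close> of \<open>sqrt (V C - B\<^sup>2) / (\<pi> V)\<close>.

  For fixed \<open>t\<close> this density, divided by \<open>n\<close>, has a limit in which \<open>\<psi>\<close> cancels. Since the numbers
  \<open>\<rho> \<bar>k\<bar>\<close> are the Fourier coefficients of \<open>\<psi>\<close>, the variance of \<open>\<alpha> f t + (\<beta> / n) f' t\<close> is the
  integral of \<open>\<psi> / (2\<pi>)\<close> against the squared modulus of
  \<open>\<Sum>k=1..n. (\<alpha> + \<i> \<beta> k / n) e\<^sup>i\<^sup>k\<^sup>y\<close>, where \<open>y = t - x\<close>.
  Divided by \<open>n\<close>, this is a nonnegative kernel that concentrates at \<open>x = t\<close> as the Fejer kernel does,
  and its total mass tends to \<open>2\<pi> (\<alpha>\<^sup>2 + \<beta>\<^sup>2 / 3)\<close>. Letting \<open>(\<alpha>, \<beta>)\<close> be \<open>(1, 0)\<close>, \<open>(0, 1)\<close> and \<open>(1, 1)\<close>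
  gives \<open>V / n \<rightarrow> \<psi> t\<close>, \<open>C / n\<^sup>3 \<rightarrow> \<psi> t / 3\<close> and \<open>B / n\<^sup>2 \<rightarrow> 0\<close>, so the density is asymptotic to
  \<open>n / (\<pi> sqrt 3)\<close> (\<open>tendsto_kac_rice_density\<close>).

  The limit may be taken under the integral although \<open>\<psi>\<close> can be unbounded at the ends of the interval:
  \<open>\<psi> \<ge> \<gamma>\<close> forces \<open>V \<ge> \<gamma> n\<close>, hence the squared density is at most \<open>C / (\<gamma> n)\<close>, and the integral of
  \<open>C\<close> is \<open>2\<pi> (1\<^sup>2 + \<dots> + n\<^sup>2)\<close> because \<open>\<rho> 0 = 1\<close>. So the densities divided by \<open>n\<close> are bounded in
  \<open>L\<^sup>2\<close>, hence uniformly integrable (\<open>tendsto_integral_of_square_bound\<close>).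

  The Kac-Rice formula is proved through sign changes. The set of \<open>t\<close> with \<open>f t * f (t + h) < 0\<close> has
  length at most \<open>h\<close> times the number of zeros, and length at least that for small \<open>h\<close> if all zeros are
  simple and interior, which holds almost surely (\<open>AE_simple_zeros\<close>). Taking expectations reduces the formula to
  the probability that a centered Gaussian pair has opposite signs, and this is an explicit angle
  divided by \<open>\<pi>\<close> (\<open>prob_mult_neg_gaussian_pair\<close>).
\<close>

section \<open>Independence from characteristic functions\<close>

lemma integral_indicator_comp:
  fixes W :: "'a \<Rightarrow> 'b" and N :: "'a measure"
  shows "(LINT \<omega>|N. indicator A (W \<omega>) :: real) = measure N {\<omega>\<in>space N. W \<omega> \<in> A}"
proof -
  have "(LINT \<omega>|N. indicator A (W \<omega>) :: real) = (LINT \<omega>|N. indicator {\<omega>\<in>space N. W \<omega> \<in> A} \<omega>)"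
    by (rule Bochner_Integration.integral_cong) (auto simp: indicator_def)
  thus ?thesis by (simp add: Int_def conj_commute cong: conj_cong)
qed

text \<open>The equations say that the measure with density \<open>Y\<close> pushes forward under \<open>W\<close> to a multiple of the law
  of \<open>W\<close>, as far as Fourier transforms can see. Levy's uniqueness theorem is about probability measures,
  so the signed density \<open>Y\<close> is first replaced by a positive normalized one.\<close>

lemma (in prob_space) expectation_indicator_of_char_factor:
  fixes Y W :: "'a \<Rightarrow> real"
  assumes [measurable]: "Y \<in> borel_measurable M" "W \<in> borel_measurable M"
    and bound: "\<And>\<omega>. \<bar>Y \<omega>\<bar> \<le> 1"
    and factor: "\<And>t. (CLINT \<omega>|M. of_real (Y \<omega>) * iexp (t * W \<omega>))
                   = of_real (expectation Y) * (CLINT \<omega>|M. iexp (t * W \<omega>))"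
    and [measurable]: "A \<in> sets borel"
  shows "expectation (\<lambda>\<omega>. Y \<omega> * indicator A (W \<omega>)) = expectation Y * prob {\<omega>\<in>space M. W \<omega> \<in> A}"
proof -
  define m where "m = expectation Y"
  have intY: "integrable M Y"
    by (rule integrable_const_bound[where B=1]) (use bound in auto)
  have "\<bar>m\<bar> \<le> 1"
  proof -
    have "\<bar>m\<bar> \<le> expectation (\<lambda>\<omega>. \<bar>Y \<omega>\<bar>)" unfolding m_def by (rule integral_abs_bound)
    also have "\<dots> \<le> expectation (\<lambda>\<omega>. 1)"
      by (intro integral_mono) (use bound intY in auto)
    finally show ?thesis by (simp add: prob_space)
  qed
  hence m2: "2 + m > 0" by auto
  \<comment> \<open>As \<open>\<bar>Y\<bar> \<le> 1\<close>, the constant \<open>2\<close> keeps density and normalization positive.\<close>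
  define g where "g \<omega> = (2 + Y \<omega>) / (2 + m)" for \<omega>
  have [measurable]: "g \<in> borel_measurable M" unfolding g_def by measurable
  have gpos: "g \<omega> \<ge> 0" for \<omega> using bound[of \<omega>] m2 by (auto simp: g_def)
  have Eg: "expectation g = 1"
  proof -
    have "expectation g = expectation (\<lambda>\<omega>. 2 + Y \<omega>) / (2 + m)" unfolding g_def by simp
    also have "expectation (\<lambda>\<omega>. 2 + Y \<omega>) = 2 + m"
      using intY by (simp add: m_def prob_space)
    finally show ?thesis using m2 by simp
  qed
  have intg: "integrable M g" unfolding g_def using intY by auto
  define N where "N = density M (\<lambda>\<omega>. ennreal (g \<omega>))"
  have pN: "prob_space N"
  proof
    have "emeasure N (space N) = (\<integral>\<^sup>+\<omega>. ennreal (g \<omega>) \<partial>M)"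
      by (simp add: N_def emeasure_density)
    also have "\<dots> = ennreal (expectation g)"
      by (rule nn_integral_eq_integral) (use intg gpos in auto)
    finally show "emeasure N (space N) = 1" by (simp add: Eg)
  qed
  have [measurable]: "W \<in> borel_measurable N" by (simp add: N_def)
  have "real_distribution (distr N borel W)"
    by (intro real_distribution.intro real_distribution_axioms.intro prob_space.prob_space_distr pN) auto
  moreover have "real_distribution (distr M borel W)"
    by (intro real_distribution.intro real_distribution_axioms.intro prob_space_distr) auto
  moreover have "char (distr N borel W) = char (distr M borel W)"
  proof
    fix t
    have int1: "integrable M (\<lambda>\<omega>. iexp (t * W \<omega>))"
      by (rule integrable_const_bound[where B=1]) auto
    have int2: "integrable M (\<lambda>\<omega>. of_real (Y \<omega>) * iexp (t * W \<omega>))"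
      by (rule integrable_const_bound[where B=1]) (use bound in \<open>auto simp: norm_mult\<close>)
    have "char (distr N borel W) t = (CLINT \<omega>|N. iexp (t * W \<omega>))"
      unfolding char_def by (subst integral_distr) auto
    also have "\<dots> = (CLINT \<omega>|M. g \<omega> *\<^sub>R iexp (t * W \<omega>))"
      unfolding N_def by (subst integral_density) (auto simp: gpos)
    also have "\<dots> = (CLINT \<omega>|M. (2 * iexp (t * W \<omega>) + of_real (Y \<omega>) * iexp (t * W \<omega>)) / of_real (2 + m))"
      by (rule Bochner_Integration.integral_cong) (auto simp: g_def scaleR_conv_of_real ring_distribs)
    also have "\<dots> = (2 * (CLINT \<omega>|M. iexp (t * W \<omega>)) + (CLINT \<omega>|M. of_real (Y \<omega>) * iexp (t * W \<omega>))) / of_real (2 + m)"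
      using int1 int2 by simp
    also have "\<dots> = (CLINT \<omega>|M. iexp (t * W \<omega>))"
    proof -
      have "complex_of_real (2 + m) \<noteq> 0" using m2 by (metis less_irrefl of_real_eq_0_iff)
      thus ?thesis unfolding factor m_def[symmetric] by (simp add: field_simps)
    qed
    also have "\<dots> = char (distr M borel W) t"
      unfolding char_def by (subst integral_distr) auto
    finally show "char (distr N borel W) t = char (distr M borel W) t" .
  qed
  ultimately have eq: "distr N borel W = distr M borel W" by (rule Levy_uniqueness)
  have "prob {\<omega>\<in>space M. W \<omega> \<in> A} = measure (distr M borel W) A"
    by (subst measure_distr) (auto intro!: arg_cong[where f=prob])
  also have "\<dots> = measure (distr N borel W) A" by (simp add: eq)
  also have "\<dots> = measure N {\<omega>\<in>space N. W \<omega> \<in> A}"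
    by (subst measure_distr) (auto intro!: arg_cong[where f="measure _"])
  also have "\<dots> = (LINT \<omega>|N. indicator A (W \<omega>))"
    by (rule integral_indicator_comp[symmetric])
  also have "\<dots> = (LINT \<omega>|M. g \<omega> * indicator A (W \<omega>))"
    unfolding N_def by (subst integral_density) (auto simp: gpos)
  also have "\<dots> = (LINT \<omega>|M. (2 * indicator A (W \<omega>) + Y \<omega> * indicator A (W \<omega>)) / (2 + m))"
    by (rule Bochner_Integration.integral_cong) (auto simp: g_def ring_distribs)
  also have "\<dots> = (2 * (LINT \<omega>|M. indicator A (W \<omega>)) + (LINT \<omega>|M. Y \<omega> * indicator A (W \<omega>))) / (2 + m)"
  proof -
    have "integrable M (\<lambda>\<omega>. indicator A (W \<omega>) :: real)"
      by (rule integrable_const_bound[where B=1]) auto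
    moreover have "integrable M (\<lambda>\<omega>. Y \<omega> * indicator A (W \<omega>) :: real)"
      by (rule integrable_const_bound[where B=1]) (use bound in \<open>auto simp: indicator_def\<close>)
    ultimately show ?thesis by simp
  qed
  also have "(LINT \<omega>|M. indicator A (W \<omega>)) = prob {\<omega>\<in>space M. W \<omega> \<in> A}"
    by (rule integral_indicator_comp)
  finally show ?thesis using m2 by (simp add: field_simps m_def)
qed

text \<open>Kac's theorem. Fourier uniqueness on the line is enough: it is applied first to \<open>W\<close>, weighted by
  \<open>cos (s U)\<close> and \<open>sin (s U)\<close>, and then to \<open>U\<close>, weighted by the indicator of an event of \<open>W\<close>.\<close>

lemma (in prob_space) indep_var_of_char_factor:
  fixes U W :: "'a \<Rightarrow> real"
  assumes [measurable]: "U \<in> borel_measurable M" "W \<in> borel_measurable M"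
    and factor: "\<And>s t. (CLINT \<omega>|M. iexp (s * U \<omega> + t * W \<omega>))
                   = (CLINT \<omega>|M. iexp (s * U \<omega>)) * (CLINT \<omega>|M. iexp (t * W \<omega>))"
  shows "indep_var borel U borel W"
proof -
  have i1: "integrable M (\<lambda>\<omega>. iexp (f \<omega>))" if [measurable]: "f \<in> borel_measurable M" for f
    by (rule integrable_const_bound[where B=1]) auto
  have i2: "integrable M (\<lambda>\<omega>. of_real (f \<omega>) :: complex)" if [measurable]: "f \<in> borel_measurable M" and "\<And>\<omega>. \<bar>f \<omega>\<bar> \<le> 1" for f
    by (rule integrable_const_bound[where B=1]) (use that in auto)
  have i3: "integrable M (\<lambda>\<omega>. of_real (f \<omega>) * iexp (g \<omega>) :: complex)" if [measurable]: "f \<in> borel_measurable M" "g \<in> borel_measurable M" and "\<And>\<omega>. \<bar>f \<omega>\<bar> \<le> 1" for f g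
    by (rule integrable_const_bound[where B=1]) (use that in \<open>auto simp: norm_mult\<close>)
  have cos_eq: "complex_of_real (cos x) = (iexp x + iexp (-x)) / 2" for x
    by (simp add: cos_exp_eq flip: cos_of_real)
  have sin_eq: "complex_of_real (sin x) = (iexp x - iexp (-x)) / (2 * \<i>)" for x
    by (simp add: sin_exp_eq flip: sin_of_real)
  have c: "expectation (\<lambda>\<omega>. cos (s * U \<omega>) * indicator A (W \<omega>)) = expectation (\<lambda>\<omega>. cos (s * U \<omega>)) * prob {\<omega>\<in>space M. W \<omega> \<in> A}"
    if [measurable]: "A \<in> sets borel" for s A
  proof (rule expectation_indicator_of_char_factor)
    fix t
    have e: "complex_of_real (expectation (\<lambda>\<omega>. cos (s * U \<omega>))) = ((CLINT \<omega>|M. iexp (s * U \<omega>)) + (CLINT \<omega>|M. iexp ((-s) * U \<omega>))) / 2"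
      unfolding integral_complex_of_real[symmetric] cos_eq
      by (subst Bochner_Integration.integral_divide_zero, subst Bochner_Integration.integral_add) ((rule refl | (rule i1, measurable))+)
    have "(CLINT \<omega>|M. of_real (cos (s * U \<omega>)) * iexp (t * W \<omega>)) = (CLINT \<omega>|M. (iexp (s * U \<omega> + t * W \<omega>) + iexp ((-s) * U \<omega> + t * W \<omega>)) / 2)"
      by (rule Bochner_Integration.integral_cong) (auto simp: cos_eq field_simps exp_add[symmetric])
    also have "\<dots> = ((CLINT \<omega>|M. iexp (s * U \<omega> + t * W \<omega>)) + (CLINT \<omega>|M. iexp ((-s) * U \<omega> + t * W \<omega>))) / 2"
      by (subst Bochner_Integration.integral_divide_zero, subst Bochner_Integration.integral_add) ((rule refl | (rule i1, measurable))+)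
    finally show "(CLINT \<omega>|M. of_real (cos (s * U \<omega>)) * iexp (t * W \<omega>)) = complex_of_real (expectation (\<lambda>\<omega>. cos (s * U \<omega>))) * (CLINT \<omega>|M. iexp (t * W \<omega>))"
      unfolding factor e by (simp add: field_simps)
  qed auto
  have s: "expectation (\<lambda>\<omega>. sin (s * U \<omega>) * indicator A (W \<omega>)) = expectation (\<lambda>\<omega>. sin (s * U \<omega>)) * prob {\<omega>\<in>space M. W \<omega> \<in> A}"
    if [measurable]: "A \<in> sets borel" for s A
  proof (rule expectation_indicator_of_char_factor)
    fix t
    have e: "complex_of_real (expectation (\<lambda>\<omega>. sin (s * U \<omega>))) = ((CLINT \<omega>|M. iexp (s * U \<omega>)) - (CLINT \<omega>|M. iexp ((-s) * U \<omega>))) / (2 * \<i>)"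
      unfolding integral_complex_of_real[symmetric] sin_eq
      by (subst Bochner_Integration.integral_divide_zero, subst Bochner_Integration.integral_diff) ((rule refl | (rule i1, measurable))+)
    have "(CLINT \<omega>|M. of_real (sin (s * U \<omega>)) * iexp (t * W \<omega>)) = (CLINT \<omega>|M. (iexp (s * U \<omega> + t * W \<omega>) - iexp ((-s) * U \<omega> + t * W \<omega>)) / (2 * \<i>))"
      by (rule Bochner_Integration.integral_cong) (auto simp: sin_eq field_simps exp_add[symmetric])
    also have "\<dots> = ((CLINT \<omega>|M. iexp (s * U \<omega> + t * W \<omega>)) - (CLINT \<omega>|M. iexp ((-s) * U \<omega> + t * W \<omega>))) / (2 * \<i>)"
      by (subst Bochner_Integration.integral_divide_zero, subst Bochner_Integration.integral_diff) ((rule refl | (rule i1, measurable))+)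
    finally show "(CLINT \<omega>|M. of_real (sin (s * U \<omega>)) * iexp (t * W \<omega>)) = complex_of_real (expectation (\<lambda>\<omega>. sin (s * U \<omega>))) * (CLINT \<omega>|M. iexp (t * W \<omega>))"
      unfolding factor e by (simp add: field_simps)
  qed auto
  have *: "expectation (\<lambda>\<omega>. indicator A (W \<omega>) * indicator B (U \<omega>)) = expectation (\<lambda>\<omega>. indicator A (W \<omega>)) * prob {\<omega>\<in>space M. U \<omega> \<in> B}"
    if [measurable]: "A \<in> sets borel" "B \<in> sets borel" for A B
  proof (rule expectation_indicator_of_char_factor)
    fix t
    have pA: "expectation (\<lambda>\<omega>. indicator A (W \<omega>)) = prob {\<omega>\<in>space M. W \<omega> \<in> A}"
      by (rule integral_indicator_comp)
    have ie: "iexp x = of_real (cos x) + \<i> * of_real (sin x)" for x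
      by (simp add: cis_conv_exp[symmetric] complex_eq_iff)
    have "(CLINT \<omega>|M. of_real (indicator A (W \<omega>)) * iexp (t * U \<omega>))
       = (CLINT \<omega>|M. of_real (cos (t * U \<omega>) * indicator A (W \<omega>)) + \<i> * of_real (sin (t * U \<omega>) * indicator A (W \<omega>)))"
      by (rule Bochner_Integration.integral_cong) (simp_all only: ie, simp_all add: indicator_def)
    also have "\<dots> = of_real (expectation (\<lambda>\<omega>. cos (t * U \<omega>) * indicator A (W \<omega>))) + \<i> * of_real (expectation (\<lambda>\<omega>. sin (t * U \<omega>) * indicator A (W \<omega>)))"
      by (subst Bochner_Integration.integral_add) (auto intro!: i2 integrable_mult_right simp: abs_mult indicator_def simp del: of_real_mult)
    also have "\<dots> = of_real (prob {\<omega>\<in>space M. W \<omega> \<in> A}) * (of_real (expectation (\<lambda>\<omega>. cos (t * U \<omega>))) + \<i> * of_real (expectation (\<lambda>\<omega>. sin (t * U \<omega>))))"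
      unfolding c[OF that(1)] s[OF that(1)] by (simp add: algebra_simps)
    also have "of_real (expectation (\<lambda>\<omega>. cos (t * U \<omega>))) + \<i> * of_real (expectation (\<lambda>\<omega>. sin (t * U \<omega>))) = (CLINT \<omega>|M. iexp (t * U \<omega>))"
      unfolding ie by (subst Bochner_Integration.integral_add) (auto intro!: i2 integrable_mult_right)
    finally show "(CLINT \<omega>|M. of_real (indicator A (W \<omega>)) * iexp (t * U \<omega>)) = complex_of_real (expectation (\<lambda>\<omega>. indicator A (W \<omega>))) * (CLINT \<omega>|M. iexp (t * U \<omega>))"
      unfolding pA .
  qed (auto simp: indicator_def)
  show ?thesis
    unfolding indep_var_distribution_eq
  proof (intro conjI)
    interpret U: prob_space "distr M borel U" by (rule prob_space_distr) simp
    interpret W: prob_space "distr M borel W" by (rule prob_space_distr) simp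
    show "distr M borel U \<Otimes>\<^sub>M distr M borel W = distr M (borel \<Otimes>\<^sub>M borel) (\<lambda>x. (U x, W x))"
    proof (rule pair_measure_eqI)
      fix B A assume "B \<in> sets (distr M borel U)" "A \<in> sets (distr M borel W)"
      hence [measurable]: "B \<in> sets borel" "A \<in> sets borel" by auto
      have "emeasure (distr M (borel \<Otimes>\<^sub>M borel) (\<lambda>x. (U x, W x))) (B \<times> A) = emeasure M {\<omega>\<in>space M. U \<omega> \<in> B \<and> W \<omega> \<in> A}"
        by (subst emeasure_distr) (auto intro!: arg_cong[where f="emeasure M"])
      also have "\<dots> = ennreal (prob {\<omega>\<in>space M. U \<omega> \<in> B \<and> W \<omega> \<in> A})" by (simp add: emeasure_eq_measure)
      also have "prob {\<omega>\<in>space M. U \<omega> \<in> B \<and> W \<omega> \<in> A} = expectation (\<lambda>\<omega>. indicator A (W \<omega>) * indicator B (U \<omega>))"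
      proof -
        have "prob {\<omega>\<in>space M. U \<omega> \<in> B \<and> W \<omega> \<in> A} = expectation (\<lambda>\<omega>. indicator (B \<times> A) (U \<omega>, W \<omega>))"
          by (subst integral_indicator_comp) simp
        thus ?thesis by (simp add: indicator_times mult.commute)
      qed
      also have "\<dots> = expectation (\<lambda>\<omega>. indicator A (W \<omega>)) * prob {\<omega>\<in>space M. U \<omega> \<in> B}" by (rule *) auto
      also have "expectation (\<lambda>\<omega>. indicator A (W \<omega>)) = prob {\<omega>\<in>space M. W \<omega> \<in> A}"
        by (rule integral_indicator_comp)
      also have "ennreal (prob {\<omega>\<in>space M. W \<omega> \<in> A} * prob {\<omega>\<in>space M. U \<omega> \<in> B}) = emeasure (distr M borel U) B * emeasure (distr M borel W) A"
        by (auto simp: emeasure_distr emeasure_eq_measure ennreal_mult mult.commute vimage_def Int_def conj_commute)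
      finally show "emeasure (distr M borel U) B * emeasure (distr M borel W) A = emeasure (distr M (borel \<Otimes>\<^sub>M borel) (\<lambda>x. (U x, W x))) (B \<times> A)" ..
    qed (auto simp: U.sigma_finite_measure_axioms W.sigma_finite_measure_axioms intro!: sets_pair_measure_cong)
  qed auto
qed


section \<open>Sign changes of a Gaussian pair\<close>

lemma nn_integral_abs_gaussian:
  fixes q :: real
  assumes "q > 0"
  shows "(\<integral>\<^sup>+u. ennreal (\<bar>u\<bar> * exp (- (q * u\<^sup>2 / 2))) \<partial>lborel) = ennreal (2 / q)"
proof -
  have pos: "(\<integral>\<^sup>+u. ennreal (u * exp (- (q * u\<^sup>2 / 2))) * indicator {0..} u \<partial>lborel) = ennreal (0 - (- (1 / q) * exp (- (q * 0\<^sup>2 / 2))))"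
  proof (rule nn_integral_FTC_atLeast)
    fix u :: real assume "0 \<le> u"
    show "((\<lambda>u. - (1 / q) * exp (- (q * u\<^sup>2 / 2))) has_real_derivative u * exp (- (q * u\<^sup>2 / 2))) (at u)"
      using assms by (auto intro!: derivative_eq_intros simp: field_simps power2_eq_square)
    show "0 \<le> u * exp (- (q * u\<^sup>2 / 2))" using \<open>0 \<le> u\<close> by simp
  next
    show "((\<lambda>u. - (1 / q) * exp (- (q * u\<^sup>2 / 2))) \<longlongrightarrow> 0) at_top"
      using assms by real_asymp
  qed auto
  have "(\<integral>\<^sup>+u. ennreal (\<bar>u\<bar> * exp (- (q * u\<^sup>2 / 2))) \<partial>lborel)
     = (\<integral>\<^sup>+u. ennreal (u * exp (- (q * u\<^sup>2 / 2))) * indicator {0..} u + ennreal ((-u) * exp (- (q * u\<^sup>2 / 2))) * indicator {..0} u \<partial>lborel)"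
    by (rule nn_integral_cong) (auto simp: indicator_def)
  also have "\<dots> = (\<integral>\<^sup>+u. ennreal (u * exp (- (q * u\<^sup>2 / 2))) * indicator {0..} u \<partial>lborel) + (\<integral>\<^sup>+u. ennreal ((-u) * exp (- (q * u\<^sup>2 / 2))) * indicator {..0} u \<partial>lborel)"
    by (rule nn_integral_add) auto
  also have "(\<integral>\<^sup>+u. ennreal ((-u) * exp (- (q * u\<^sup>2 / 2))) * indicator {..0} u \<partial>lborel)
     = (\<integral>\<^sup>+u. ennreal (u * exp (- (q * u\<^sup>2 / 2))) * indicator {0..} u \<partial>lborel)"
    by (subst nn_integral_real_affine[where c="-1" and t=0]) (auto simp: indicator_def intro!: nn_integral_cong)
  finally show ?thesis unfolding pos using assms by (simp add: ennreal_plus[symmetric] del: ennreal_plus)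
qed

lemma std_normal_mult:
  "std_normal_density u * std_normal_density (s * u) = exp (- ((1 + s\<^sup>2) * u\<^sup>2 / 2)) / (2 * pi)"
  by (simp add: std_normal_density_def exp_add[symmetric] power_mult_distrib field_simps)

text \<open>The event only depends on the ratio of the two variables, which has a Cauchy distribution. This is
  why an arctangent appears.\<close>

lemma (in prob_space) prob_std_normal_wedge:
  assumes ind: "indep_var borel U borel W"
    and U: "distributed M lborel U std_normal_density" and W: "distributed M lborel W std_normal_density"
  shows "prob {\<omega>\<in>space M. U \<omega> * (c * U \<omega> + W \<omega>) < 0} = (pi / 2 - arctan c) / pi"
proof -
  have [measurable]: "U \<in> borel_measurable M" "W \<in> borel_measurable M"
    using U W by (auto simp: distributed_def)
  have j: "distributed M (lborel \<Otimes>\<^sub>M lborel) (\<lambda>\<omega>. (U \<omega>, W \<omega>)) (\<lambda>(x, y). ennreal (std_normal_density x) * ennreal (std_normal_density y))"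
  proof (rule distributed_joint_indep)
    show "indep_var lborel U lborel W" using ind unfolding indep_var_eq by simp
  qed (use U W in \<open>auto simp: lborel.sigma_finite_measure_axioms\<close>)
  define A where "A = {p :: real \<times> real. fst p * (c * fst p + snd p) < 0}"
  have [measurable]: "A \<in> sets (borel \<Otimes>\<^sub>M borel)"
  proof -
    have "{p\<in>space (borel \<Otimes>\<^sub>M borel). fst p * (c * fst p + snd p) < 0} \<in> sets (borel \<Otimes>\<^sub>M (borel :: real measure))"
      by measurable
    thus ?thesis by (simp add: A_def space_pair_measure cong: sets_pair_measure_cong)
  qed
  have "emeasure M {\<omega>\<in>space M. U \<omega> * (c * U \<omega> + W \<omega>) < 0} = emeasure M ((\<lambda>\<omega>. (U \<omega>, W \<omega>)) -` A \<inter> space M)"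
    by (rule arg_cong[where f="emeasure M"]) (auto simp: A_def)
  also have "\<dots> = (\<integral>\<^sup>+p. (case p of (x,y) \<Rightarrow> ennreal (std_normal_density x) * ennreal (std_normal_density y)) * indicator A p \<partial>(lborel \<Otimes>\<^sub>M lborel))"
    by (rule distributed_emeasure[OF j]) auto
  also have "\<dots> = (\<integral>\<^sup>+x. \<integral>\<^sup>+y. ennreal (std_normal_density x) * ennreal (std_normal_density y) * indicator A (x, y) \<partial>lborel \<partial>lborel)"
    by (subst lborel.nn_integral_fst[symmetric]) auto
  also have "\<dots> = (\<integral>\<^sup>+x. \<integral>\<^sup>+s. ennreal (\<bar>x\<bar> * exp (- ((1 + s\<^sup>2) * x\<^sup>2 / 2)) / (2 * pi)) * indicator {c<..} s \<partial>lborel \<partial>lborel)"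
  proof (rule nn_integral_cong_AE, use AE_lborel_singleton[of 0] in eventually_elim)
    fix x :: real assume x: "x \<noteq> 0"
    \<comment> \<open>Substituting \<open>y = - x s\<close> turns the wedge into the half-line \<open>s > c\<close>.\<close>
    have "(\<integral>\<^sup>+y. ennreal (std_normal_density x) * ennreal (std_normal_density y) * indicator A (x, y) \<partial>lborel)
       = \<bar>-x\<bar> * (\<integral>\<^sup>+s. ennreal (std_normal_density x) * ennreal (std_normal_density (0 + (-x) * s)) * indicator A (x, 0 + (-x) * s) \<partial>lborel)"
      by (rule nn_integral_real_affine) (use x in auto)
    also have "\<dots> = (\<integral>\<^sup>+s. \<bar>-x\<bar> * (ennreal (std_normal_density x) * ennreal (std_normal_density (0 + (-x) * s)) * indicator A (x, 0 + (-x) * s)) \<partial>lborel)"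
      by (rule nn_integral_cmult[symmetric]) measurable
    also have "\<dots> = (\<integral>\<^sup>+s. ennreal (\<bar>x\<bar> * exp (- ((1 + s\<^sup>2) * x\<^sup>2 / 2)) / (2 * pi)) * indicator {c<..} s \<partial>lborel)"
    proof (rule nn_integral_cong)
      fix s :: real
      have "x * (c * x + (0 + (-x) * s)) = x\<^sup>2 * (c - s)" by (simp add: algebra_simps power2_eq_square)
      hence "x * (c * x + (0 + (-x) * s)) < 0 \<longleftrightarrow> x\<^sup>2 * (c - s) < 0" by (simp only:)
      also have "\<dots> \<longleftrightarrow> c < s" using x zero_less_power2[of x] by (auto simp: mult_less_0_iff)
      finally have "x * (c * x + (0 + (-x) * s)) < 0 \<longleftrightarrow> c < s" .
      hence I: "indicator A (x, 0 + (-x) * s) = (indicator {c<..} s :: ennreal)"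
        unfolding A_def indicator_def mem_Collect_eq fst_conv snd_conv greaterThan_iff by (simp only:)
      have d: "std_normal_density x * std_normal_density (0 + (-x) * s) = exp (- ((1 + s\<^sup>2) * x\<^sup>2 / 2)) / (2 * pi)"
        unfolding std_normal_mult[symmetric] by (simp add: std_normal_density_def power_mult_distrib mult.commute)
      have "ennreal \<bar>-x\<bar> * (ennreal (std_normal_density x) * ennreal (std_normal_density (0 + (-x) * s)))
          = ennreal \<bar>-x\<bar> * ennreal (std_normal_density x * std_normal_density (0 + (-x) * s))"
        by (subst ennreal_mult) auto
      also have "\<dots> = ennreal (\<bar>-x\<bar> * (std_normal_density x * std_normal_density (0 + (-x) * s)))"
        by (rule ennreal_mult[symmetric]) auto
      also have "\<dots> = ennreal (\<bar>x\<bar> * exp (- ((1 + s\<^sup>2) * x\<^sup>2 / 2)) / (2 * pi))"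
        unfolding d by simp
      finally show "ennreal \<bar>-x\<bar> * (ennreal (std_normal_density x) * ennreal (std_normal_density (0 + (-x) * s)) * indicator A (x, 0 + (-x) * s)) = ennreal (\<bar>x\<bar> * exp (- ((1 + s\<^sup>2) * x\<^sup>2 / 2)) / (2 * pi)) * indicator {c<..} s"
        unfolding I by (simp only: mult.assoc[symmetric])
    qed
    finally show "(\<integral>\<^sup>+y. ennreal (std_normal_density x) * ennreal (std_normal_density y) * indicator A (x, y) \<partial>lborel) = \<dots>" .
  qed
  also have "\<dots> = (\<integral>\<^sup>+s. \<integral>\<^sup>+x. ennreal (\<bar>x\<bar> * exp (- ((1 + s\<^sup>2) * x\<^sup>2 / 2)) / (2 * pi)) * indicator {c<..} s \<partial>lborel \<partial>lborel)"
    by (rule lborel_pair.Fubini') measurable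
  also have "\<dots> = (\<integral>\<^sup>+s. ennreal (1 / (pi * (1 + s\<^sup>2))) * indicator {c..} s \<partial>lborel)"
  proof (rule nn_integral_cong_AE, use AE_lborel_singleton[of c] in eventually_elim)
    fix s :: real assume s: "s \<noteq> c"
    have q: "1 + s\<^sup>2 > 0" by (simp add: add_pos_nonneg)
    have "(\<integral>\<^sup>+x. ennreal (\<bar>x\<bar> * exp (- ((1 + s\<^sup>2) * x\<^sup>2 / 2)) / (2 * pi)) * indicator {c<..} s \<partial>lborel)
       = (\<integral>\<^sup>+x. (ennreal (1 / (2 * pi)) * indicator {c<..} s) * ennreal (\<bar>x\<bar> * exp (- ((1 + s\<^sup>2) * x\<^sup>2 / 2))) \<partial>lborel)"
      by (rule nn_integral_cong) (auto simp: indicator_def ennreal_mult[symmetric])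
    also have "\<dots> = (ennreal (1 / (2 * pi)) * indicator {c<..} s) * ennreal (2 / (1 + s\<^sup>2))"
      by (subst nn_integral_cmult, simp, subst nn_integral_abs_gaussian[OF q]) auto
    also have "\<dots> = ennreal (1 / (pi * (1 + s\<^sup>2))) * indicator {c..} s"
      using q s by (auto simp: indicator_def ennreal_mult[symmetric])
    finally show "(\<integral>\<^sup>+x. ennreal (\<bar>x\<bar> * exp (- ((1 + s\<^sup>2) * x\<^sup>2 / 2)) / (2 * pi)) * indicator {c<..} s \<partial>lborel) = \<dots>" .
  qed
  also have "\<dots> = ennreal (1 / 2 - arctan c / pi)"
  proof (rule nn_integral_FTC_atLeast)
    fix s :: real
    have q: "1 + s\<^sup>2 > 0" by (simp add: add_pos_nonneg)
    show "((\<lambda>s. arctan s / pi) has_real_derivative 1 / (pi * (1 + s\<^sup>2))) (at s)"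
      using DERIV_cdivide[OF DERIV_arctan, of pi s] by (simp add: divide_inverse mult.commute)
    show "0 \<le> 1 / (pi * (1 + s\<^sup>2))" using q by simp
  next
    show "((\<lambda>s. arctan s / pi) \<longlongrightarrow> 1 / 2) at_top"
      using tendsto_divide[OF tendsto_arctan_at_top tendsto_const[of pi]] by simp
  qed auto
  finally have "ennreal (prob {\<omega>\<in>space M. U \<omega> * (c * U \<omega> + W \<omega>) < 0}) = ennreal (1 / 2 - arctan c / pi)"
    by (simp add: emeasure_eq_measure)
  moreover have "1 / 2 - arctan c / pi \<ge> 0" using arctan_ubound[of c] by (simp add: field_simps)
  ultimately show ?thesis by (simp add: field_simps)
qed

lemma (in prob_space) std_normal_of_char:
  assumes [measurable]: "X \<in> borel_measurable M"
    and ch: "\<And>t. (CLINT \<omega>|M. iexp (t * X \<omega>)) = of_real (exp (- t\<^sup>2 / 2))"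
  shows "distributed M lborel X std_normal_density"
proof -
  have "real_distribution (distr M borel X)"
    by (intro real_distribution.intro real_distribution_axioms.intro prob_space_distr) auto
  moreover have "real_distribution std_normal_distribution"
    by (rule real_dist_normal_dist)
  moreover have "char (distr M borel X) = char std_normal_distribution"
    unfolding char_std_normal_distribution
    by (rule ext, unfold char_def, subst integral_distr) (simp_all add: ch[simplified])
  ultimately have "distr M borel X = std_normal_distribution" by (rule Levy_uniqueness)
  moreover have "distr M lborel X = distr M borel X" by (rule distr_cong) auto
  ultimately show ?thesis by (simp add: distributed_def)
qed

text \<open>The joint law of a Gaussian pair is given by its characteristic function, since that is what the
  definition of a Gaussian process by linear combinations provides. Orthonormalizing the pair
  turns the event into a wedge for two independent standard normal variables.\<close>

lemma (in prob_space) prob_mult_neg_gaussian_pair: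
  assumes [measurable]: "X \<in> borel_measurable M" "Y \<in> borel_measurable M"
    and V1: "V1 > 0" and D: "V1 * V2 - K\<^sup>2 > 0"
    and ch: "\<And>\<alpha> \<beta>. (CLINT \<omega>|M. iexp (\<alpha> * X \<omega> + \<beta> * Y \<omega>))
                = of_real (exp (- (\<alpha>\<^sup>2 * V1 + 2 * \<alpha> * \<beta> * K + \<beta>\<^sup>2 * V2) / 2))"
  shows "prob {\<omega>\<in>space M. X \<omega> * Y \<omega> < 0} = (pi / 2 - arctan (K / sqrt (V1 * V2 - K\<^sup>2))) / pi"
proof -
  define v d where "v = sqrt V1" and "d = sqrt (V1 * V2 - K\<^sup>2)"
  have v: "v > 0" "v\<^sup>2 = V1" and d: "d > 0" "d\<^sup>2 = V1 * V2 - K\<^sup>2"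
    using V1 D by (auto simp: v_def d_def)
  define U where "U \<omega> = X \<omega> / v" for \<omega>
  \<comment> \<open>Gram-Schmidt: \<open>W\<close> is the normalized part of \<open>Y\<close> that is uncorrelated with \<open>X\<close>.\<close>
  define W where "W \<omega> = (V1 * Y \<omega> - K * X \<omega>) / (v * d)" for \<omega>
  have [measurable]: "U \<in> borel_measurable M" "W \<in> borel_measurable M"
    unfolding U_def W_def by measurable
  have chUW: "(CLINT \<omega>|M. iexp (s * U \<omega> + t * W \<omega>)) = of_real (exp (- (s\<^sup>2 + t\<^sup>2) / 2))" for s t
  proof -
    define \<alpha> \<beta> where "\<alpha> = (s - t * K / d) / v" and "\<beta> = t * v / d"
    have "s * U \<omega> + t * W \<omega> = \<alpha> * X \<omega> + \<beta> * Y \<omega>" for \<omega>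
      using v(1) d(1) unfolding U_def W_def \<alpha>_def \<beta>_def v(2)[symmetric]
      by (simp add: field_simps power2_eq_square)
    moreover have "\<alpha>\<^sup>2 * V1 + 2 * \<alpha> * \<beta> * K + \<beta>\<^sup>2 * V2 = s\<^sup>2 + t\<^sup>2"
    proof -
      have "\<alpha>\<^sup>2 * V1 + 2 * \<alpha> * \<beta> * K + \<beta>\<^sup>2 * V2 = (s - t * K / d)\<^sup>2 + 2 * (s - t * K / d) * (t * K / d) + t\<^sup>2 * (V1 * V2) / d\<^sup>2"
        using v(1) d(1) unfolding \<alpha>_def \<beta>_def v(2)[symmetric]
        by (simp add: field_simps power2_eq_square)
      also have "V1 * V2 = d\<^sup>2 + K\<^sup>2" using d(2) by simp
      also have "(s - t * K / d)\<^sup>2 + 2 * (s - t * K / d) * (t * K / d) + t\<^sup>2 * (d\<^sup>2 + K\<^sup>2) / d\<^sup>2 = s\<^sup>2 + t\<^sup>2"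
        using d(1) by (simp add: field_simps power2_eq_square)
      finally show ?thesis .
    qed
    ultimately show ?thesis using ch[of \<alpha> \<beta>] by simp
  qed
  have chU: "(CLINT \<omega>|M. iexp (s * U \<omega>)) = of_real (exp (- s\<^sup>2 / 2))" for s
    using chUW[of s 0] by simp
  have chW: "(CLINT \<omega>|M. iexp (t * W \<omega>)) = of_real (exp (- t\<^sup>2 / 2))" for t
    using chUW[of 0 t] by simp
  have ind: "indep_var borel U borel W"
  proof (rule indep_var_of_char_factor)
    fix s t :: real
    have e: "- (s\<^sup>2 + t\<^sup>2) / 2 = - s\<^sup>2 / 2 + - t\<^sup>2 / 2" by (simp add: field_simps)
    show "(CLINT \<omega>|M. iexp (s * U \<omega> + t * W \<omega>)) = (CLINT \<omega>|M. iexp (s * U \<omega>)) * (CLINT \<omega>|M. iexp (t * W \<omega>))"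
      unfolding chUW chU chW unfolding e exp_add by simp
  qed auto
  have "X \<omega> * Y \<omega> < 0 \<longleftrightarrow> U \<omega> * (K / d * U \<omega> + W \<omega>) < 0" for \<omega>
  proof -
    have "U \<omega> * (K / d * U \<omega> + W \<omega>) = X \<omega> * Y \<omega> / d"
      using v(1) d(1) unfolding U_def W_def v(2)[symmetric] by (simp add: field_simps power2_eq_square)
    thus ?thesis using d(1) by (simp add: divide_less_0_iff)
  qed
  thus ?thesis
    using prob_std_normal_wedge[OF ind std_normal_of_char[OF _ chU] std_normal_of_char[OF _ chW], of "K / d"]
    by (simp add: d_def)
qed

text \<open>The standard normal density is at most \<open>1/2\<close>.\<close>

lemma (in prob_space) gaussian_small_ball:
  assumes [measurable]: "X \<in> borel_measurable M" and V: "V > 0" and \<eta>: "\<eta> \<ge> 0"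
    and ch: "\<And>t. (CLINT \<omega>|M. iexp (t * X \<omega>)) = of_real (exp (- (t\<^sup>2 * V) / 2))"
  shows "prob {\<omega>\<in>space M. \<bar>X \<omega>\<bar> \<le> \<eta>} \<le> \<eta> / sqrt V"
proof -
  define U where "U \<omega> = X \<omega> / sqrt V" for \<omega>
  define r where "r = \<eta> / sqrt V"
  have r: "r \<ge> 0" using V \<eta> by (simp add: r_def)
  have [measurable]: "U \<in> borel_measurable M" unfolding U_def by measurable
  have "distributed M lborel U std_normal_density"
  proof (rule std_normal_of_char)
    fix t show "(CLINT \<omega>|M. iexp (t * U \<omega>)) = of_real (exp (- t\<^sup>2 / 2))"
      using ch[of "t / sqrt V"] V by (simp add: U_def power_divide)
  qed auto
  hence "emeasure M (U -` {-r..r} \<inter> space M) = (\<integral>\<^sup>+x. ennreal (std_normal_density x) * indicator {-r..r} x \<partial>lborel)"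
    by (rule distributed_emeasure) auto
  also have "\<dots> \<le> (\<integral>\<^sup>+x. ennreal (1/2) * indicator {-r..r} x \<partial>lborel)"
  proof (intro nn_integral_mono mult_right_mono ennreal_leI)
    fix x :: real
    have "sqrt (2 * pi) \<ge> 2" using pi_ge_two by (intro real_le_rsqrt) auto
    hence "1 / sqrt (2 * pi) \<le> 1 / 2" by (intro divide_left_mono) auto
    moreover have "exp (- x\<^sup>2 / 2) \<le> 1" by simp
    ultimately have "1 / sqrt (2 * pi) * exp (- x\<^sup>2 / 2) \<le> (1 / 2) * 1" by (intro mult_mono) auto
    thus "std_normal_density x \<le> 1 / 2" by (simp add: std_normal_density_def)
  qed auto
  also have "\<dots> = ennreal r"
  proof -
    have "(\<integral>\<^sup>+x. ennreal (1/2) * indicator {-r..r} x \<partial>lborel) = ennreal (1/2) * ennreal (2 * r)"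
      using r by (subst nn_integral_cmult_indicator) auto
    also have "\<dots> = ennreal (1/2 * (2 * r))" by (rule ennreal_mult[symmetric]) (use r in auto)
    finally show ?thesis by simp
  qed
  also have "U -` {-r..r} \<inter> space M = {\<omega>\<in>space M. \<bar>X \<omega>\<bar> \<le> \<eta>}"
    using V by (auto simp: U_def r_def abs_le_iff field_simps)
  finally show ?thesis using r by (simp add: emeasure_eq_measure r_def)
qed

lemma (in prob_space) char_gaussian_rv:
  assumes X: "gaussian_rv M X" and mean: "expectation X = 0"
  shows "(CLINT \<omega>|M. iexp (X \<omega>)) = of_real (exp (- (LINT \<omega>|M. (X \<omega>)\<^sup>2) / 2))"
  using X unfolding gaussian_rv_def
proof (elim disjE exE conjE)
  fix \<mu> \<sigma> :: real assume \<sigma>: "\<sigma> > 0" and D: "distributed M lborel X (normal_density \<mu> \<sigma>)"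
  have [measurable]: "X \<in> borel_measurable M" using D by (auto simp: distributed_def)
  have \<mu>: "\<mu> = 0" using normal_distributed_expectation[OF \<sigma> D] mean by simp
  have var: "(LINT \<omega>|M. (X \<omega>)\<^sup>2) = \<sigma>\<^sup>2" using normal_distributed_variance[OF \<sigma> D] mean by simp
  have Z: "distributed M lborel (\<lambda>\<omega>. X \<omega> / \<sigma>) std_normal_density"
    using normal_standard_normal_convert[OF \<sigma>, of X \<mu>] D \<mu> by simp
  have "distr M borel (\<lambda>\<omega>. X \<omega> / \<sigma>) = distr M lborel (\<lambda>\<omega>. X \<omega> / \<sigma>)" by (rule distr_cong) auto
  also have "\<dots> = std_normal_distribution" using Z by (simp add: distributed_def)
  finally have "char (distr M borel (\<lambda>\<omega>. X \<omega> / \<sigma>)) \<sigma> = of_real (exp (- \<sigma>\<^sup>2 / 2))"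
    by (simp add: char_std_normal_distribution)
  moreover have "char (distr M borel (\<lambda>\<omega>. X \<omega> / \<sigma>)) \<sigma> = (CLINT \<omega>|M. iexp (X \<omega>))"
    unfolding char_def using \<sigma> by (subst integral_distr) auto
  ultimately show ?thesis by (simp add: var)
next
  fix \<mu> assume [measurable]: "X \<in> borel_measurable M" and ae: "AE \<omega> in M. X \<omega> = \<mu>"
  have "expectation X = expectation (\<lambda>_. \<mu>)" by (rule integral_cong_AE) (use ae in auto)
  hence \<mu>: "\<mu> = 0" using mean by (simp add: prob_space)
  have "(LINT \<omega>|M. (X \<omega>)\<^sup>2) = (LINT \<omega>|M. 0)" by (rule integral_cong_AE) (use ae \<mu> in auto)
  moreover have "(CLINT \<omega>|M. iexp (X \<omega>)) = (CLINT \<omega>|M. 1)" by (rule integral_cong_AE) (use ae \<mu> in auto)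
  ultimately show ?thesis by (simp add: prob_space)
qed


section \<open>Linear combinations of two stationary Gaussian sequences\<close>

text \<open>A coefficient vector for the \<open>a k\<close> and \<open>b k\<close> is stored as a complex sequence, the cosine part in the real
  and the sine part in the imaginary part; then evaluation at \<open>t\<close> becomes \<open>cis (k t)\<close>, and
  differentiation becomes multiplication by \<open>\<i> k\<close>. The form below is the covariance of the two linear
  combinations with coefficients \<open>z\<close> and \<open>w\<close>.\<close>

definition coeff_form :: "(nat \<Rightarrow> real) \<Rightarrow> nat \<Rightarrow> (nat \<Rightarrow> complex) \<Rightarrow> (nat \<Rightarrow> complex) \<Rightarrow> real" where
  "coeff_form \<rho> n z w = (\<Sum>k=1..n. \<Sum>l=1..n. \<rho> (nat \<bar>int k - int l\<bar>) * Re (z k * cnj (w l)))"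

definition lin_comb :: "(nat \<Rightarrow> 'a \<Rightarrow> real) \<Rightarrow> (nat \<Rightarrow> 'a \<Rightarrow> real) \<Rightarrow> nat \<Rightarrow> (nat \<Rightarrow> complex) \<Rightarrow> 'a \<Rightarrow> real" where
  "lin_comb a b n z \<omega> = (\<Sum>k=1..n. Re (z k) * a k \<omega> + Im (z k) * b k \<omega>)"

lemma trig_poly_eq_lin_comb: "trig_poly a b n \<omega> t = lin_comb a b n (\<lambda>k. cis (real k * t)) \<omega>"
  by (simp add: trig_poly_def lin_comb_def mult.commute)

lemma lin_comb_linear:
  "lin_comb a b n (\<lambda>k. of_real \<alpha> * z k + of_real \<beta> * w k) \<omega> = \<alpha> * lin_comb a b n z \<omega> + \<beta> * lin_comb a b n w \<omega>"
  by (simp add: lin_comb_def sum_distrib_left sum.distrib[symmetric] algebra_simps)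

lemma coeff_form_commute: "coeff_form \<rho> n z w = coeff_form \<rho> n w z"
  unfolding coeff_form_def
  by (subst sum.swap) (auto intro!: sum.cong simp: abs_minus_commute mult.commute)

lemma coeff_form_linear_left:
  "coeff_form \<rho> n (\<lambda>k. of_real \<alpha> * z k + of_real \<beta> * w k) u = \<alpha> * coeff_form \<rho> n z u + \<beta> * coeff_form \<rho> n w u"
  by (simp add: coeff_form_def sum_distrib_left sum.distrib[symmetric] algebra_simps)

lemma coeff_form_linear_right:
  "coeff_form \<rho> n u (\<lambda>k. of_real \<alpha> * z k + of_real \<beta> * w k) = \<alpha> * coeff_form \<rho> n u z + \<beta> * coeff_form \<rho> n u w"
  by (simp add: coeff_form_commute[of \<rho> n u] coeff_form_linear_left)

lemma coeff_form_square:
  "coeff_form \<rho> n (\<lambda>k. of_real \<alpha> * z k + of_real \<beta> * w k) (\<lambda>k. of_real \<alpha> * z k + of_real \<beta> * w k)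
     = \<alpha>\<^sup>2 * coeff_form \<rho> n z z + 2 * \<alpha> * \<beta> * coeff_form \<rho> n z w + \<beta>\<^sup>2 * coeff_form \<rho> n w w"
  by (simp add: coeff_form_linear_left coeff_form_linear_right coeff_form_commute[of \<rho> n w z] power2_eq_square algebra_simps)

lemma (in prob_space) gaussian_process_measurable:
  assumes "gaussian_process M I X" "i \<in> I"
  shows "X i \<in> borel_measurable M"
proof -
  have "gaussian_rv M (\<lambda>\<omega>. \<Sum>j\<in>{i}. 1 * X j \<omega>)"
    using assms unfolding gaussian_process_def by (elim allE[of _ "{i}"] allE[of _ "\<lambda>_. 1"]) auto
  thus ?thesis by (auto simp: gaussian_rv_def distributed_def)
qed

text \<open>Unit variance makes the \<open>a k\<close> square integrable, because a Bochner integral with a nonzero value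
  has an integrable integrand; mean and variance of the sum can then be computed termwise.\<close>

lemma (in prob_space) char_stationary_sum:
  assumes a: "stationary_gaussian_seq M \<rho> a" and \<rho>: "\<rho> 0 = 1"
  shows "(CLINT \<omega>|M. iexp (\<Sum>k=1..n. c k * a k \<omega>))
      = of_real (exp (- (\<Sum>k=1..n. \<Sum>l=1..n. \<rho> (nat \<bar>int k - int l\<bar>) * (c k * c l)) / 2))"
proof -
  have gp: "gaussian_process M {1..} a" and m: "\<And>k. k \<ge> 1 \<Longrightarrow> expectation (a k) = 0"
    and cv: "\<And>k l. k \<ge> 1 \<Longrightarrow> l \<ge> 1 \<Longrightarrow> (LINT \<omega>|M. a k \<omega> * a l \<omega>) = \<rho> (nat \<bar>int k - int l\<bar>)"
    using a by (auto simp: stationary_gaussian_seq_def)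
  have meas: "a k \<in> borel_measurable M" if "k \<ge> 1" for k
    by (rule gaussian_process_measurable[OF gp]) (use that in auto)
  have sq: "integrable M (\<lambda>\<omega>. a k \<omega> * a k \<omega>)" if "k \<ge> 1" for k
    using cv[OF that that] \<rho> not_integrable_integral_eq[of M "\<lambda>\<omega>. a k \<omega> * a k \<omega>"] by auto
  have int2: "integrable M (\<lambda>\<omega>. a k \<omega> * a l \<omega>)" if "k \<ge> 1" "l \<ge> 1" for k l
  proof (rule Bochner_Integration.integrable_bound)
    show "integrable M (\<lambda>\<omega>. a k \<omega> * a k \<omega> + a l \<omega> * a l \<omega>)" using sq that by auto
    have "\<bar>x * y\<bar> \<le> x * x + y * y" for x y :: real
    proof -
      have "2 * \<bar>x * y\<bar> \<le> x * x + y * y"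
        using sum_squares_bound[of "\<bar>x\<bar>" "\<bar>y\<bar>"] by (simp add: power2_eq_square abs_mult)
      thus ?thesis using abs_ge_zero[of "x * y"] by linarith
    qed
    thus "AE \<omega> in M. norm (a k \<omega> * a l \<omega>) \<le> norm (a k \<omega> * a k \<omega> + a l \<omega> * a l \<omega>)"
      unfolding real_norm_def by (intro AE_I2 order_trans[OF _ abs_ge_self])
  qed (use meas that in auto)
  have int1: "integrable M (a k)" if "k \<ge> 1" for k
  proof (rule Bochner_Integration.integrable_bound)
    show "integrable M (\<lambda>\<omega>. 1 + a k \<omega> * a k \<omega>)" using sq that by auto
    have "\<bar>x\<bar> \<le> 1 + x * x" for x :: real
      using sum_squares_bound[of "\<bar>x\<bar>" "1"] by (simp add: power2_eq_square)
    thus "AE \<omega> in M. norm (a k \<omega>) \<le> norm (1 + a k \<omega> * a k \<omega>)"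
      unfolding real_norm_def by (intro AE_I2 order_trans[OF _ abs_ge_self])
  qed (use meas that in auto)
  have G: "gaussian_rv M (\<lambda>\<omega>. \<Sum>k=1..n. c k * a k \<omega>)"
    using gp unfolding gaussian_process_def by (elim allE[of _ "{1..n}"] allE[of _ c]) auto
  have "expectation (\<lambda>\<omega>. \<Sum>k=1..n. c k * a k \<omega>) = (\<Sum>k=1..n. expectation (\<lambda>\<omega>. c k * a k \<omega>))"
    by (rule Bochner_Integration.integral_sum) (use int1 in auto)
  also have "\<dots> = 0" using m by simp
  finally have mean: "expectation (\<lambda>\<omega>. \<Sum>k=1..n. c k * a k \<omega>) = 0" .
  have "(LINT \<omega>|M. (\<Sum>k=1..n. c k * a k \<omega>)\<^sup>2) = (LINT \<omega>|M. (\<Sum>k=1..n. \<Sum>l=1..n. (c k * c l) * (a k \<omega> * a l \<omega>)))"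
    by (rule Bochner_Integration.integral_cong) (auto simp: power2_eq_square sum_product mult_ac)
  also have "\<dots> = (\<Sum>k=1..n. LINT \<omega>|M. (\<Sum>l=1..n. (c k * c l) * (a k \<omega> * a l \<omega>)))"
    by (rule Bochner_Integration.integral_sum) (use int2 in auto)
  also have "\<dots> = (\<Sum>k=1..n. \<Sum>l=1..n. LINT \<omega>|M. (c k * c l) * (a k \<omega> * a l \<omega>))"
    by (intro sum.cong refl Bochner_Integration.integral_sum) (use int2 in auto)
  also have "\<dots> = (\<Sum>k=1..n. \<Sum>l=1..n. \<rho> (nat \<bar>int k - int l\<bar>) * (c k * c l))"
    by (intro sum.cong refl) (use cv in \<open>auto simp: mult_ac\<close>)
  finally show ?thesis using char_gaussian_rv[OF G mean] by simp
qed

locale gaussian_seq_pair = prob_space M for M :: "'a measure" +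
  fixes a b :: "nat \<Rightarrow> 'a \<Rightarrow> real" and \<rho> :: "nat \<Rightarrow> real"
  assumes a: "stationary_gaussian_seq M \<rho> a" and b: "stationary_gaussian_seq M \<rho> b"
    and rho_0: "\<rho> 0 = 1"
    and indep: "indep_var (Pi\<^sub>M {1..} (\<lambda>_. borel)) (\<lambda>\<omega>. \<lambda>k\<in>{1..}. a k \<omega>)
                          (Pi\<^sub>M {1..} (\<lambda>_. borel)) (\<lambda>\<omega>. \<lambda>k\<in>{1..}. b k \<omega>)"
begin

lemma measurable_a: "k \<ge> 1 \<Longrightarrow> a k \<in> borel_measurable M"
  using a gaussian_process_measurable[of "{1..}" a k] by (auto simp: stationary_gaussian_seq_def)

lemma measurable_b: "k \<ge> 1 \<Longrightarrow> b k \<in> borel_measurable M"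
  using b gaussian_process_measurable[of "{1..}" b k] by (auto simp: stationary_gaussian_seq_def)

lemma measurable_lin_comb [measurable]: "lin_comb a b n z \<in> borel_measurable M"
  unfolding lin_comb_def[abs_def] using measurable_a measurable_b by auto

text \<open>The \<open>a\<close>-part and the \<open>b\<close>-part are independent and Gaussian, so their characteristic functions multiply.\<close>

lemma char_lin_comb:
  "(CLINT \<omega>|M. iexp (lin_comb a b n z \<omega>)) = of_real (exp (- coeff_form \<rho> n z z / 2))"
proof -
  define A where "A \<omega> = (\<Sum>k=1..n. Re (z k) * a k \<omega>)" for \<omega>
  define B where "B \<omega> = (\<Sum>k=1..n. Im (z k) * b k \<omega>)" for \<omega>
  have [measurable]: "A \<in> borel_measurable M" "B \<in> borel_measurable M"
    unfolding A_def B_def using measurable_a measurable_b by auto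
  have comb: "(\<lambda>x. \<Sum>k=1..n. c k * x k) \<in> borel_measurable (Pi\<^sub>M {1..} (\<lambda>_. borel))" for c :: "nat \<Rightarrow> real"
    by (intro borel_measurable_sum borel_measurable_times borel_measurable_const measurable_component_singleton) auto
  have "indep_var borel ((\<lambda>x. \<Sum>k=1..n. Re (z k) * x k) \<circ> (\<lambda>\<omega>. \<lambda>k\<in>{1..}. a k \<omega>)) borel ((\<lambda>x. \<Sum>k=1..n. Im (z k) * x k) \<circ> (\<lambda>\<omega>. \<lambda>k\<in>{1..}. b k \<omega>))"
    by (rule indep_var_compose[OF indep comb comb])
  also have "((\<lambda>x. \<Sum>k=1..n. Re (z k) * x k) \<circ> (\<lambda>\<omega>. \<lambda>k\<in>{1..}. a k \<omega>)) = A"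
    by (auto simp: A_def fun_eq_iff)
  also have "((\<lambda>x. \<Sum>k=1..n. Im (z k) * x k) \<circ> (\<lambda>\<omega>. \<lambda>k\<in>{1..}. b k \<omega>)) = B"
    by (auto simp: B_def fun_eq_iff)
  finally have "char (distr M borel (\<lambda>\<omega>. A \<omega> + B \<omega>)) 1 = char (distr M borel A) 1 * char (distr M borel B) 1"
    by (rule char_distr_add)
  moreover have "char (distr M borel X) 1 = (CLINT \<omega>|M. iexp (X \<omega>))" if [measurable]: "X \<in> borel_measurable M" for X
    unfolding char_def by (subst integral_distr) auto
  ultimately have "(CLINT \<omega>|M. iexp (A \<omega> + B \<omega>)) = (CLINT \<omega>|M. iexp (A \<omega>)) * (CLINT \<omega>|M. iexp (B \<omega>))"
    by simp
  also have "(\<lambda>\<omega>. A \<omega> + B \<omega>) = lin_comb a b n z"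
    by (auto simp: A_def B_def lin_comb_def sum.distrib fun_eq_iff)
  also have "(CLINT \<omega>|M. iexp (A \<omega>)) = of_real (exp (- (\<Sum>k=1..n. \<Sum>l=1..n. \<rho> (nat \<bar>int k - int l\<bar>) * (Re (z k) * Re (z l))) / 2))"
    unfolding A_def by (rule char_stationary_sum[OF a rho_0])
  also have "(CLINT \<omega>|M. iexp (B \<omega>)) = of_real (exp (- (\<Sum>k=1..n. \<Sum>l=1..n. \<rho> (nat \<bar>int k - int l\<bar>) * (Im (z k) * Im (z l))) / 2))"
    unfolding B_def by (rule char_stationary_sum[OF b rho_0])
  also have "complex_of_real (exp (- (\<Sum>k=1..n. \<Sum>l=1..n. \<rho> (nat \<bar>int k - int l\<bar>) * (Re (z k) * Re (z l))) / 2))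
     * of_real (exp (- (\<Sum>k=1..n. \<Sum>l=1..n. \<rho> (nat \<bar>int k - int l\<bar>) * (Im (z k) * Im (z l))) / 2))
     = of_real (exp (- coeff_form \<rho> n z z / 2))"
  proof -
    have "coeff_form \<rho> n z z = (\<Sum>k=1..n. \<Sum>l=1..n. \<rho> (nat \<bar>int k - int l\<bar>) * (Re (z k) * Re (z l)))
        + (\<Sum>k=1..n. \<Sum>l=1..n. \<rho> (nat \<bar>int k - int l\<bar>) * (Im (z k) * Im (z l)))"
      by (simp add: coeff_form_def sum.distrib[symmetric] ring_distribs)
    thus ?thesis
      unfolding of_real_mult[symmetric] exp_add[symmetric] by (simp add: field_simps)
  qed
  finally show ?thesis by (simp add: A_def B_def lin_comb_def)
qed

lemma char_lin_comb_pair: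
  "(CLINT \<omega>|M. iexp (\<alpha> * lin_comb a b n z \<omega> + \<beta> * lin_comb a b n w \<omega>))
     = of_real (exp (- (\<alpha>\<^sup>2 * coeff_form \<rho> n z z + 2 * \<alpha> * \<beta> * coeff_form \<rho> n z w + \<beta>\<^sup>2 * coeff_form \<rho> n w w) / 2))"
  unfolding lin_comb_linear[symmetric] char_lin_comb coeff_form_square ..

lemma prob_lin_comb_small:
  assumes "coeff_form \<rho> n z z > 0" "\<eta> \<ge> 0"
  shows "prob {\<omega>\<in>space M. \<bar>lin_comb a b n z \<omega>\<bar> \<le> \<eta>} \<le> \<eta> / sqrt (coeff_form \<rho> n z z)"
  by (rule gaussian_small_ball[OF _ assms]) (use char_lin_comb_pair[of _ n z 0 z] in auto)

lemma prob_lin_comb_sign_change: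
  assumes "coeff_form \<rho> n z z > 0"
    and "coeff_form \<rho> n z z * coeff_form \<rho> n w w - (coeff_form \<rho> n z w)\<^sup>2 > 0"
  shows "prob {\<omega>\<in>space M. lin_comb a b n z \<omega> * lin_comb a b n w \<omega> < 0}
    = (pi / 2 - arctan (coeff_form \<rho> n z w / sqrt (coeff_form \<rho> n z z * coeff_form \<rho> n w w - (coeff_form \<rho> n z w)\<^sup>2))) / pi"
  by (rule prob_mult_neg_gaussian_pair[OF _ _ assms char_lin_comb_pair]) auto

end


section \<open>Zeros and sign changes of functions on the line\<close>

lemma sign_change_imp_zero:
  fixes f :: "real \<Rightarrow> real"
  assumes "continuous_on UNIV f" "s \<le> t" "f s * f t < 0"
  shows "\<exists>z\<in>{s..t}. f z = 0"
proof (cases "f s < 0")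
  case True
  with assms have "f t > 0" by (simp add: mult_less_0_iff)
  thus ?thesis using IVT'[of f s 0 t] True assms continuous_on_subset[OF assms(1)] by fastforce
next
  case False
  with assms have "f s > 0" "f t < 0" by (auto simp: mult_less_0_iff)
  thus ?thesis using IVT2'[of f t 0 s] assms continuous_on_subset[OF assms(1)] by fastforce
qed

text \<open>If \<open>f\<close> changes sign between \<open>t\<close> and \<open>t + h\<close>, then \<open>t\<close> lies within distance \<open>h\<close> to the left of a zero.\<close>

lemma emeasure_sign_change_le:
  fixes f :: "real \<Rightarrow> real"
  assumes f: "continuous_on UNIV f" and h: "h > 0"
  shows "emeasure lborel {t\<in>{a..b-h}. f t * f (t + h) < 0} \<le> ennreal h * num_zeros {a..b} f"
proof (cases "finite {t\<in>{a..b}. f t = 0}")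
  case True
  let ?Z = "{t\<in>{a..b}. f t = 0}"
  have "{t\<in>{a..b-h}. f t * f (t + h) < 0} \<subseteq> (\<Union>z\<in>?Z. {z-h..z})"
  proof safe
    fix t assume t: "t \<in> {a..b-h}" "f t * f (t + h) < 0"
    with sign_change_imp_zero[OF f, of t "t + h"] h obtain z where "z \<in> {t..t+h}" "f z = 0" by auto
    with t show "t \<in> (\<Union>z\<in>?Z. {z-h..z})" by (intro UN_I[of z]) auto
  qed
  hence "emeasure lborel {t\<in>{a..b-h}. f t * f (t + h) < 0} \<le> emeasure lborel (\<Union>z\<in>?Z. {z-h..z})"
    by (rule emeasure_mono) (use True in auto)
  also have "\<dots> \<le> (\<Sum>z\<in>?Z. emeasure lborel {z-h..z})"
    by (rule emeasure_subadditive_finite) (use True in auto)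
  also have "\<dots> = ennreal h * num_zeros {a..b} f"
    using h True by (simp add: num_zeros_def emeasure_count_space mult.commute)
  finally show ?thesis .
next
  case False
  hence "num_zeros {a..b} f = \<infinity>" by (simp add: num_zeros_def emeasure_count_space)
  thus ?thesis using h by (simp add: ennreal_mult_top)
qed

lemma simple_zero_sign_change:
  fixes f :: "real \<Rightarrow> real"
  assumes "(f has_real_derivative D) (at z)" "D \<noteq> 0" "f z = 0"
  shows "\<exists>\<delta>>0. \<forall>s t. z - \<delta> < s \<longrightarrow> s < z \<longrightarrow> z < t \<longrightarrow> t < z + \<delta> \<longrightarrow> f s * f t < 0"
proof -
  have *: "\<exists>\<delta>>0. \<forall>s t. z - \<delta> < s \<longrightarrow> s < z \<longrightarrow> z < t \<longrightarrow> t < z + \<delta> \<longrightarrow> g s * g t < 0"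
    if g: "(g has_real_derivative E) (at z)" "E > 0" "g z = 0" for g :: "real \<Rightarrow> real" and E
  proof -
    obtain d1 where d1: "d1 > 0" "\<And>h. h > 0 \<Longrightarrow> h < d1 \<Longrightarrow> g z < g (z + h)"
      using DERIV_pos_inc_right[OF g(1,2)] by blast
    obtain d2 where d2: "d2 > 0" "\<And>h. h > 0 \<Longrightarrow> h < d2 \<Longrightarrow> g (z - h) < g z"
      using DERIV_pos_inc_left[OF g(1,2)] by blast
    show ?thesis
    proof (intro exI[of _ "min d1 d2"] conjI allI impI)
      fix s t assume st: "z - min d1 d2 < s" "s < z" "z < t" "t < z + min d1 d2"
      have "g s < 0" using d2(2)[of "z - s"] st g(3) by simp
      moreover have "g t > 0" using d1(2)[of "t - z"] st g(3) by simp
      ultimately show "g s * g t < 0" by (rule mult_neg_pos)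
    qed (use d1 d2 in auto)
  qed
  show ?thesis
  proof (cases "D > 0")
    case True thus ?thesis using *[OF assms(1)] assms(3) by blast
  next
    case False
    have "((\<lambda>x. - f x) has_real_derivative - D) (at z)" using assms(1) by (rule DERIV_minus)
    from *[OF this] show ?thesis using False assms(2,3) by simp
  qed
qed

text \<open>Once \<open>h\<close> is smaller than the gaps between the zeros in \<open>F\<close>, the intervals of length \<open>h\<close> to the left of
  these zeros are disjoint, and they consist of sign changes because the zeros are simple.\<close>

lemma eventually_card_le_sign_change:
  fixes f :: "real \<Rightarrow> real"
  assumes f: "continuous_on UNIV f"
    and F: "finite F" "\<And>z. z \<in> F \<Longrightarrow> a < z \<and> z < b \<and> f z = 0 \<and> (\<exists>D. D \<noteq> 0 \<and> (f has_real_derivative D) (at z))"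
  shows "\<forall>\<^sub>F h in at_right 0. ennreal h * of_nat (card F) \<le> emeasure lborel {t\<in>{a..b-h}. f t * f (t + h) < 0}"
proof -
  have [measurable]: "f \<in> borel_measurable borel" using f by (rule borel_measurable_continuous_onI)
  have ev: "\<forall>\<^sub>F h in at_right 0. {z-h<..<z} \<subseteq> {t\<in>{a..b-h}. f t * f (t + h) < 0}" if z: "z \<in> F" for z
  proof -
    obtain \<delta> where \<delta>: "\<delta> > 0" "\<And>s t. z - \<delta> < s \<Longrightarrow> s < z \<Longrightarrow> z < t \<Longrightarrow> t < z + \<delta> \<Longrightarrow> f s * f t < 0"
      using F(2)[OF z] simple_zero_sign_change[of f _ z] by metis
    define e where "e = min \<delta> (min (z - a) (b - z))"
    have "e > 0" using \<delta> F(2)[OF z] by (auto simp: e_def)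
    hence "\<forall>\<^sub>F h in at_right 0. h < e" by (auto simp: eventually_at_right_field)
    thus ?thesis
    proof eventually_elim
      case (elim h)
      thus ?case using \<delta>(2) by (auto simp: e_def)
    qed
  qed
  have dis: "\<forall>\<^sub>F h in at_right 0. h \<le> \<bar>x - y\<bar>" if "x \<noteq> y" for x y :: real
    using that by (auto simp: eventually_at_right_field intro!: exI[of _ "\<bar>x - y\<bar>"])
  have "\<forall>\<^sub>F h in at_right 0. (\<forall>z\<in>F. {z-h<..<z} \<subseteq> {t\<in>{a..b-h}. f t * f (t + h) < 0}) \<and> (\<forall>x\<in>F. \<forall>y\<in>F. x \<noteq> y \<longrightarrow> h \<le> \<bar>x - y\<bar>) \<and> h > 0"
    using ev dis F(1) by (intro eventually_conj eventually_ball_finite eventually_at_right_less ballI) (auto simp: eventually_at_right_less)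
  thus ?thesis
  proof eventually_elim
    case (elim h)
    have "disjoint_family_on (\<lambda>z. {z-h<..<z}) F"
      unfolding disjoint_family_on_def
    proof (intro ballI impI)
      fix x y assume "x \<in> F" "y \<in> F" "x \<noteq> y"
      hence "h \<le> \<bar>x - y\<bar>" using elim by auto
      thus "{x-h<..<x} \<inter> {y-h<..<y} = {}" by auto
    qed
    hence "(\<Sum>z\<in>F. emeasure lborel {z-h<..<z}) = emeasure lborel (\<Union>z\<in>F. {z-h<..<z})"
      by (intro sum_emeasure) (use F in auto)
    also have "\<dots> \<le> emeasure lborel {t\<in>{a..b-h}. f t * f (t + h) < 0}"
      by (rule emeasure_mono) (use elim in auto)
    finally show ?case using elim by (simp add: mult.commute)
  qed
qed

text \<open>Comparison with the finite subsets of the zero set, which also covers an infinite number of zeros.\<close>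

lemma num_zeros_le_liminf_sign_change:
  fixes f :: "real \<Rightarrow> real" and h :: "nat \<Rightarrow> real"
  assumes f: "continuous_on UNIV f"
    and simple: "\<And>z. z \<in> {a..b} \<Longrightarrow> f z = 0 \<Longrightarrow> a < z \<and> z < b \<and> (\<exists>D. D \<noteq> 0 \<and> (f has_real_derivative D) (at z))"
    and h: "filterlim h (at_right 0) sequentially"
  shows "num_zeros {a..b} f \<le> liminf (\<lambda>m. ennreal (1 / h m) * emeasure lborel {t\<in>{a..b-h m}. f t * f (t + h m) < 0})"
    (is "_ \<le> ?L")
proof -
  have fin: "of_nat (card F) \<le> ?L" if F: "finite F" "F \<subseteq> {t\<in>{a..b}. f t = 0}" for F
  proof (rule Liminf_bounded)
    have "\<forall>\<^sub>F h in at_right 0. ennreal h * of_nat (card F) \<le> emeasure lborel {t\<in>{a..b-h}. f t * f (t + h) < 0}"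
      by (rule eventually_card_le_sign_change[OF f F(1)]) (use simple F in blast)
    hence "\<forall>\<^sub>F h in at_right 0. of_nat (card F) \<le> ennreal (1 / h) * emeasure lborel {t\<in>{a..b-h}. f t * f (t + h) < 0}"
      using eventually_at_right_less[of 0]
    proof eventually_elim
      case (elim h)
      have "of_nat (card F) = ennreal (1 / h) * (ennreal h * of_nat (card F))"
        using elim(2) by (simp add: mult.assoc[symmetric] ennreal_mult[symmetric])
      also have "\<dots> \<le> ennreal (1 / h) * emeasure lborel {t\<in>{a..b-h}. f t * f (t + h) < 0}"
        by (rule mult_left_mono[OF elim(1)]) simp
      finally show ?case .
    qed
    thus "\<forall>\<^sub>F m in sequentially. of_nat (card F) \<le> ennreal (1 / h m) * emeasure lborel {t\<in>{a..b-h m}. f t * f (t + h m) < 0}"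
      using h by (rule eventually_compose_filterlim)
  qed
  show ?thesis
  proof (cases "finite {t\<in>{a..b}. f t = 0}")
    case True
    thus ?thesis using fin[OF True] by (simp add: num_zeros_def emeasure_count_space)
  next
    case False
    have "of_nat n \<le> ?L" for n
    proof -
      obtain F where "F \<subseteq> {t\<in>{a..b}. f t = 0}" "finite F" "card F = n"
        using infinite_arbitrarily_large[OF False] by blast
      thus ?thesis using fin by blast
    qed
    hence "(SUP n. of_nat n) \<le> ?L" by (rule SUP_least)
    thus ?thesis by (simp add: ennreal_SUP_of_nat_eq_top top_unique)
  qed
qed


section \<open>Almost sure absence of double zeros\<close>

text \<open>Bulinskaya's argument. Near a double zero the function is quadratically small, so on a grid of
  \<open>m + 1\<close> points some value is \<open>O(m\<^sup>-\<^sup>2)\<close>. Each of these events has probability \<open>O(m\<^sup>-\<^sup>2)\<close>, and there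
  are \<open>m + 1\<close> of them.\<close>

lemma (in prob_space) AE_no_double_zero:
  fixes X X' :: "real \<Rightarrow> 'a \<Rightarrow> real"
  assumes meas [measurable]: "\<And>t. X t \<in> borel_measurable M" "K \<in> borel_measurable M"
    and taylor: "\<And>s t \<omega>. \<bar>X s \<omega> - X t \<omega> - (s - t) * X' t \<omega>\<bar> \<le> K \<omega> * (s - t)\<^sup>2"
    and small: "\<And>t \<eta>. \<eta> \<ge> 0 \<Longrightarrow> prob {\<omega>\<in>space M. \<bar>X t \<omega>\<bar> \<le> \<eta>} \<le> C * \<eta>"
    and ab: "a < b"
  shows "AE \<omega> in M. \<forall>t\<in>{a..b}. X t \<omega> = 0 \<longrightarrow> X' t \<omega> \<noteq> 0"
proof -
  define B where "B = {\<omega>\<in>space M. \<exists>t\<in>{a..b}. X t \<omega> = 0 \<and> X' t \<omega> = 0}"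
  define L where "L = b - a"
  have L: "L > 0" using ab by (simp add: L_def)
  have C: "C \<ge> 0" using small[of 1 0] measure_nonneg[of M "{\<omega>\<in>space M. \<bar>X 0 \<omega>\<bar> \<le> 1}"] by linarith
  define E where "E R m = {\<omega>\<in>space M. K \<omega> > real R} \<union> (\<Union>j\<le>m. {\<omega>\<in>space M. \<bar>X (a + real j * L / real m) \<omega>\<bar> \<le> real R * (L / real m)\<^sup>2})" for R m :: nat
  have [measurable]: "E R m \<in> sets M" for R m unfolding E_def by measurable
  have sub: "B \<subseteq> E R m" if m: "m \<ge> 1" for R m
  proof
    fix \<omega> assume "\<omega> \<in> B"
    then obtain t where t: "\<omega> \<in> space M" "a \<le> t" "t \<le> b" "X t \<omega> = 0" "X' t \<omega> = 0" by (auto simp: B_def)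
    \<comment> \<open>\<open>s\<close> is the last grid point not after the double zero \<open>t\<close>.\<close>
    define j where "j = nat \<lfloor>(t - a) * real m / L\<rfloor>"
    define s where "s = a + real j * L / real m"
    have nn: "(t - a) * real m / L \<ge> 0" using t L by simp
    have j1: "real j \<le> (t - a) * real m / L" "(t - a) * real m / L < real j + 1"
      using nn unfolding j_def by linarith+
    have "(t - a) * real m / L \<le> real m" using t L by (simp add: L_def field_simps mult_right_mono)
    hence jm: "j \<le> m" using j1(1) by linarith
    have "\<bar>s - t\<bar> \<le> L / real m"
    proof -
      have "s - t = (real j - (t - a) * real m / L) * (L / real m)"
        using L m unfolding s_def by (simp add: field_simps)
      hence "\<bar>s - t\<bar> = \<bar>real j - (t - a) * real m / L\<bar> * (L / real m)" using L by (simp add: abs_mult)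
      also have "\<dots> \<le> 1 * (L / real m)" using j1 L by (intro mult_right_mono) auto
      finally show ?thesis by simp
    qed
    hence sq: "(s - t)\<^sup>2 \<le> (L / real m)\<^sup>2" by (metis abs_ge_zero power2_abs power_mono)
    have K: "\<bar>X s \<omega>\<bar> \<le> K \<omega> * (s - t)\<^sup>2" using taylor[of s \<omega> t] t by simp
    show "\<omega> \<in> E R m"
    proof (cases "K \<omega> > real R")
      case True thus ?thesis using t by (auto simp: E_def)
    next
      case False
      hence "K \<omega> * (s - t)\<^sup>2 \<le> real R * (L / real m)\<^sup>2" using sq by (intro mult_mono) auto
      thus ?thesis using K jm t(1) unfolding E_def s_def by fastforce
    qed
  qed
  have Ebound: "prob (E R m) \<le> prob {\<omega>\<in>space M. K \<omega> > real R} + real (m + 1) * (C * (real R * (L / real m)\<^sup>2))" for R m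
  proof -
    have "prob (E R m) \<le> prob {\<omega>\<in>space M. K \<omega> > real R} + prob (\<Union>j\<le>m. {\<omega>\<in>space M. \<bar>X (a + real j * L / real m) \<omega>\<bar> \<le> real R * (L / real m)\<^sup>2})"
      unfolding E_def by (rule measure_Un_le) measurable
    also have "prob (\<Union>j\<le>m. {\<omega>\<in>space M. \<bar>X (a + real j * L / real m) \<omega>\<bar> \<le> real R * (L / real m)\<^sup>2})
       \<le> (\<Sum>j\<le>m. prob {\<omega>\<in>space M. \<bar>X (a + real j * L / real m) \<omega>\<bar> \<le> real R * (L / real m)\<^sup>2})"
      by (rule finite_measure_subadditive_finite) auto
    also have "\<dots> \<le> (\<Sum>j\<le>m. C * (real R * (L / real m)\<^sup>2))"
      by (intro sum_mono small) simp
    finally show ?thesis by simp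
  qed
  have limK: "(\<lambda>R. prob {\<omega>\<in>space M. K \<omega> > real R}) \<longlonglongrightarrow> 0"
  proof -
    have "(\<lambda>R. prob {\<omega>\<in>space M. K \<omega> > real R}) \<longlonglongrightarrow> prob (\<Inter>R. {\<omega>\<in>space M. K \<omega> > real R})"
      by (rule finite_Lim_measure_decseq) (auto simp: decseq_def)
    also have "(\<Inter>R. {\<omega>\<in>space M. K \<omega> > real R}) = {}"
    proof -
      have "\<exists>R. \<not> K \<omega> > real R" for \<omega>
        using reals_Archimedean2[of "K \<omega>"] by (meson less_asym)
      thus ?thesis by blast
    qed
    finally show ?thesis by simp
  qed
  have ex: "\<exists>R m. m \<ge> 1 \<and> prob (E R m) \<le> \<epsilon>" if \<epsilon>: "\<epsilon> > 0" for \<epsilon>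
  proof -
    obtain R where R: "prob {\<omega>\<in>space M. K \<omega> > real R} < \<epsilon> / 2"
      using order_tendstoD(2)[OF limK, of "\<epsilon> / 2"] \<epsilon> by (auto simp: eventually_sequentially)
    have "(\<lambda>m. real (m + 1) * (C * (real R * (L / real m)\<^sup>2))) \<longlonglongrightarrow> 0"
    proof -
      have "(\<lambda>m. (C * real R * L\<^sup>2) * (real (m + 1) / (real m)\<^sup>2)) \<longlonglongrightarrow> (C * real R * L\<^sup>2) * 0"
        by (intro tendsto_mult tendsto_const) real_asymp
      thus ?thesis by (simp add: power_divide mult_ac)
    qed
    hence "\<forall>\<^sub>F m in sequentially. real (m + 1) * (C * (real R * (L / real m)\<^sup>2)) < \<epsilon> / 2"
      using \<epsilon> by (intro order_tendstoD(2)) auto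
    then obtain N where N: "\<And>m. m \<ge> N \<Longrightarrow> real (m + 1) * (C * (real R * (L / real m)\<^sup>2)) < \<epsilon> / 2"
      by (auto simp: eventually_sequentially)
    have "prob (E R (max 1 N)) \<le> \<epsilon>" using Ebound[of R "max 1 N"] N[of "max 1 N"] R by linarith
    thus ?thesis by (intro exI[of _ R] exI[of _ "max 1 N"]) auto
  qed
  have "\<forall>i. \<exists>G. G \<in> sets M \<and> B \<subseteq> G \<and> prob G \<le> 1 / real (Suc i)"
  proof
    fix i
    obtain R m where "m \<ge> 1" "prob (E R m) \<le> 1 / real (Suc i)" using ex[of "1 / real (Suc i)"] by auto
    thus "\<exists>G. G \<in> sets M \<and> B \<subseteq> G \<and> prob G \<le> 1 / real (Suc i)"
      by (intro exI[of _ "E R m"]) (auto intro: sub[THEN subsetD])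
  qed
  then obtain G where G: "\<And>i. G i \<in> sets M" "\<And>i. B \<subseteq> G i" "\<And>i. prob (G i) \<le> 1 / real (Suc i)" by metis
  have [measurable]: "(\<Inter>i. G i) \<in> sets M" using G(1) by (intro sets.countable_INT) auto
  have "prob (\<Inter>i. G i) \<le> 1 / real (Suc i)" for i
    by (rule order_trans[OF finite_measure_mono G(3)[of i]]) (use G(1) in auto)
  hence "prob (\<Inter>i. G i) \<le> 0"
    using LIMSEQ_inverse_real_of_nat by (intro LIMSEQ_le_const[of "\<lambda>i. 1 / real (Suc i)"]) (auto simp: inverse_eq_divide)
  hence "emeasure M (\<Inter>i. G i) = 0" by (simp add: emeasure_eq_measure measure_le_0_iff)
  moreover have "{\<omega>\<in>space M. \<not> (\<forall>t\<in>{a..b}. X t \<omega> = 0 \<longrightarrow> X' t \<omega> \<noteq> 0)} \<subseteq> (\<Inter>i. G i)"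
    using G(2) by (auto simp: B_def)
  ultimately show ?thesis by (intro AE_I) auto
qed

lemma (in prob_space) AE_nonzero_of_small_ball:
  assumes [measurable]: "X \<in> borel_measurable M"
    and small: "\<And>\<eta>. \<eta> \<ge> 0 \<Longrightarrow> prob {\<omega>\<in>space M. \<bar>X \<omega>\<bar> \<le> \<eta>} \<le> C * \<eta>"
  shows "AE \<omega> in M. X \<omega> \<noteq> 0"
proof -
  have "prob {\<omega>\<in>space M. X \<omega> = 0} \<le> 0" using small[of 0] by simp
  hence "emeasure M {\<omega>\<in>space M. X \<omega> = 0} = 0" by (simp add: emeasure_eq_measure measure_le_0_iff)
  thus ?thesis by (intro AE_I[of _ _ "{\<omega>\<in>space M. X \<omega> = 0}"]) auto
qed


section \<open>Infinitesimal sign change probabilities\<close>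

definition osc :: "real \<Rightarrow> nat \<Rightarrow> complex" where
  "osc t k = cis (real k * t)"

definition osc' :: "real \<Rightarrow> nat \<Rightarrow> complex" where
  "osc' t k = \<i> * of_nat k * cis (real k * t)"

text \<open>Replacing \<open>f (t + h)\<close> by the difference quotient keeps the Gram determinant of the pair from
  degenerating as \<open>h\<close> tends to \<open>0\<close>; it only changes by the factor \<open>h\<^sup>2\<close>.\<close>

definition diffq :: "real \<Rightarrow> real \<Rightarrow> nat \<Rightarrow> complex" where
  "diffq h t k = (osc (t + h) k - osc t k) / of_real h"

text \<open>With \<open>V\<close>, \<open>B\<close>, \<open>C\<close> the entries of the covariance matrix of value and derivative at \<open>t\<close>, this is
  \<open>sqrt (V C - B\<^sup>2) / (\<pi> V)\<close>, that is, the conditional mean of \<open>\<bar>f' t\<bar>\<close> given \<open>f t = 0\<close> times the density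
  of \<open>f t\<close> at \<open>0\<close>.\<close>

definition kac_rice_density :: "(nat \<Rightarrow> real) \<Rightarrow> nat \<Rightarrow> real \<Rightarrow> real" where
  "kac_rice_density \<rho> n t =
     sqrt (coeff_form \<rho> n (osc t) (osc t) * coeff_form \<rho> n (osc' t) (osc' t) - (coeff_form \<rho> n (osc t) (osc' t))\<^sup>2)
       / (pi * coeff_form \<rho> n (osc t) (osc t))"

text \<open>The probability of \<open>f t * f (t + h) < 0\<close> for the Gaussian polynomial with covariance form
  \<open>coeff_form \<rho> n\<close>. Having it as a formula in \<open>\<rho>\<close> lets its limits be studied without any
  probability space.\<close>

definition sign_change_prob :: "(nat \<Rightarrow> real) \<Rightarrow> nat \<Rightarrow> real \<Rightarrow> real \<Rightarrow> real" where
  "sign_change_prob \<rho> n h t =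
     (let V = coeff_form \<rho> n (osc t) (osc t); W = coeff_form \<rho> n (osc (t + h)) (osc (t + h));
          K = coeff_form \<rho> n (osc t) (osc (t + h))
      in (pi / 2 - arctan (K / sqrt (V * W - K\<^sup>2))) / pi)"

lemma cmod_cis_minus_1_le: "cmod (cis x - 1) \<le> \<bar>x\<bar>"
  using iexp_approx1[of x 0] by (simp add: cis_conv_exp)

lemma cmod_cis_taylor: "cmod (cis x - 1 - \<i> * of_real x) \<le> x\<^sup>2 / 2"
  using iexp_approx1[of x 1] by (simp add: cis_conv_exp numeral_2_eq_2 algebra_simps)

lemma osc_add: "osc (t + h) k = osc t k * cis (real k * h)"
  by (simp add: osc_def cis_mult ring_distribs)

lemma osc_taylor: "cmod (osc s k - osc t k - of_real (s - t) * osc' t k) \<le> (real k)\<^sup>2 * (s - t)\<^sup>2 / 2"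
proof -
  have "osc s k - osc t k - of_real (s - t) * osc' t k = osc t k * (cis (real k * (s - t)) - 1 - \<i> * of_real (real k * (s - t)))"
    using osc_add[of t "s - t" k] by (simp add: osc'_def osc_def algebra_simps)
  hence "cmod (osc s k - osc t k - of_real (s - t) * osc' t k) = cmod (cis (real k * (s - t)) - 1 - \<i> * of_real (real k * (s - t)))"
    by (simp add: norm_mult osc_def)
  also have "\<dots> \<le> (real k * (s - t))\<^sup>2 / 2" by (rule cmod_cis_taylor)
  finally show ?thesis by (simp add: power_mult_distrib)
qed

lemma cmod_osc [simp]: "cmod (osc t k) = 1" by (simp add: osc_def)

lemma diffq_eq: "diffq h t k = osc t k * ((cis (real k * h) - 1) / of_real h)"
  unfolding diffq_def osc_add by (simp add: right_diff_distrib)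

lemma arctan_le_self:
  fixes y :: real
  assumes "y \<ge> 0"
  shows "arctan y \<le> y"
proof -
  have "0 - arctan 0 \<le> y - arctan y"
  proof (rule DERIV_nonneg_imp_nondecreasing[OF assms])
    fix x :: real
    have "((\<lambda>x. x - arctan x) has_real_derivative 1 - inverse (1 + x\<^sup>2)) (at x)"
      by (auto intro!: derivative_eq_intros simp: inverse_eq_divide)
    moreover have "1 - inverse (1 + x\<^sup>2) \<ge> 0" by (simp add: inverse_le_1_iff)
    ultimately show "\<exists>D. ((\<lambda>x. x - arctan x) has_real_derivative D) (at x) \<and> 0 \<le> D" by blast
  qed
  thus ?thesis by simp
qed

lemma cmod_diffq_le:
  assumes "h > 0"
  shows "cmod (diffq h t k) \<le> real k"
proof -
  have "cmod (diffq h t k) = cmod (cis (real k * h) - 1) / h"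
    using assms by (simp add: diffq_eq norm_mult norm_divide)
  also have "\<dots> \<le> \<bar>real k * h\<bar> / h" using assms by (intro divide_right_mono cmod_cis_minus_1_le) auto
  finally show ?thesis using assms by simp
qed

lemma tendsto_diffq: "((\<lambda>h. diffq h t k) \<longlongrightarrow> osc' t k) (at_right 0)"
proof (rule LIM_zero_cancel, rule Lim_null_comparison)
  show "\<forall>\<^sub>F h in at_right 0. cmod (diffq h t k - osc' t k) \<le> (real k)\<^sup>2 * h / 2"
    using eventually_at_right_less[of 0]
  proof eventually_elim
    case (elim h)
    have "diffq h t k - osc' t k = (osc (t + h) k - osc t k - of_real (t + h - t) * osc' t k) / of_real h"
      using elim by (simp add: diffq_def field_simps)
    hence "cmod (diffq h t k - osc' t k) = cmod (osc (t + h) k - osc t k - of_real (t + h - t) * osc' t k) / h"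
      using elim by (simp add: norm_divide)
    also have "\<dots> \<le> ((real k)\<^sup>2 * (t + h - t)\<^sup>2 / 2) / h"
      using elim by (intro divide_right_mono osc_taylor) auto
    also have "\<dots> = (real k)\<^sup>2 * h / 2" using elim by (simp add: power2_eq_square)
    finally show ?case .
  qed
  show "((\<lambda>h. (real k)\<^sup>2 * h / 2) \<longlongrightarrow> 0) (at_right 0)"
    by (auto intro!: tendsto_eq_intros)
qed

lemma osc_shift: "h \<noteq> 0 \<Longrightarrow> osc (t + h) = (\<lambda>k. of_real 1 * osc t k + of_real h * diffq h t k)"
  by (simp add: diffq_def fun_eq_iff)

lemma coeff_form_bound:
  assumes "\<And>k. k \<in> {1..n} \<Longrightarrow> cmod (z k) \<le> p" "\<And>k. k \<in> {1..n} \<Longrightarrow> cmod (w k) \<le> q" "p \<ge> 0"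
  shows "\<bar>coeff_form \<rho> n z w\<bar> \<le> (\<Sum>k=1..n. \<Sum>l=1..n. \<bar>\<rho> (nat \<bar>int k - int l\<bar>)\<bar>) * (p * q)"
proof -
  have "\<bar>coeff_form \<rho> n z w\<bar> \<le> (\<Sum>k=1..n. \<Sum>l=1..n. \<bar>\<rho> (nat \<bar>int k - int l\<bar>) * Re (z k * cnj (w l))\<bar>)"
    unfolding coeff_form_def by (rule order_trans[OF sum_abs] sum_mono sum_abs)+
  also have "\<dots> \<le> (\<Sum>k=1..n. \<Sum>l=1..n. \<bar>\<rho> (nat \<bar>int k - int l\<bar>)\<bar> * (p * q))"
  proof (intro sum_mono)
    fix k l assume kl: "k \<in> {1..n}" "l \<in> {1..n}"
    have "\<bar>Re (z k * cnj (w l))\<bar> \<le> cmod (z k * cnj (w l))" by (rule abs_Re_le_cmod)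
    also have "\<dots> \<le> p * q" unfolding norm_mult complex_mod_cnj using assms kl by (intro mult_mono) auto
    finally show "\<bar>\<rho> (nat \<bar>int k - int l\<bar>) * Re (z k * cnj (w l))\<bar> \<le> \<bar>\<rho> (nat \<bar>int k - int l\<bar>)\<bar> * (p * q)"
      unfolding abs_mult by (rule mult_left_mono) simp
  qed
  finally show ?thesis by (simp add: sum_distrib_right)
qed

lemma tendsto_coeff_form:
  assumes "\<And>k. ((\<lambda>h. z h k) \<longlongrightarrow> z0 k) F" "\<And>k. ((\<lambda>h. w h k) \<longlongrightarrow> w0 k) F"
  shows "((\<lambda>h. coeff_form \<rho> n (z h) (w h)) \<longlongrightarrow> coeff_form \<rho> n z0 w0) F"
  unfolding coeff_form_def by (intro tendsto_intros assms)

locale definite_correlation =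
  fixes \<rho> :: "nat \<Rightarrow> real" and n :: nat and \<gamma> :: real
  assumes n: "n \<ge> 1" and gamma: "\<gamma> > 0"
    and definite: "\<gamma> * (\<Sum>k=1..n. (cmod (z k))\<^sup>2) \<le> coeff_form \<rho> n z z"
begin

lemma coeff_form_ge: "\<gamma> * (cmod (z 1))\<^sup>2 \<le> coeff_form \<rho> n z z"
proof -
  have "(cmod (z 1))\<^sup>2 = (\<Sum>k\<in>{1}. (cmod (z k))\<^sup>2)" by simp
  also have "\<dots> \<le> (\<Sum>k=1..n. (cmod (z k))\<^sup>2)"
    by (rule sum_mono2) (use n in auto)
  finally have "\<gamma> * (cmod (z 1))\<^sup>2 \<le> \<gamma> * (\<Sum>k=1..n. (cmod (z k))\<^sup>2)" using gamma by (intro mult_left_mono) auto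
  thus ?thesis using definite[of z] by linarith
qed

lemma coeff_form_nonneg: "coeff_form \<rho> n z z \<ge> 0"
  by (rule order_trans[OF _ coeff_form_ge]) (use gamma in simp)

lemma variance_ge: "coeff_form \<rho> n (osc t) (osc t) \<ge> \<gamma>"
  using coeff_form_ge[of "osc t"] by simp

lemma variance_pos: "coeff_form \<rho> n (osc t) (osc t) > 0"
  using variance_ge[of t] gamma by linarith

text \<open>Projecting \<open>z\<close> off the direction of \<open>osc t\<close>: a Gram determinant is squared base times squared height.\<close>

lemma gram_eq:
  "coeff_form \<rho> n (osc t) (osc t) * coeff_form \<rho> n z z - (coeff_form \<rho> n (osc t) z)\<^sup>2
    = coeff_form \<rho> n (osc t) (osc t) *
      (let c = coeff_form \<rho> n (osc t) z / coeff_form \<rho> n (osc t) (osc t);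
           w = (\<lambda>k. of_real (- c) * osc t k + of_real 1 * z k)
       in coeff_form \<rho> n w w)"
  using variance_pos[of t] unfolding Let_def coeff_form_square by (simp add: field_simps power2_eq_square)

lemma gram_nonneg:
  "coeff_form \<rho> n (osc t) (osc t) * coeff_form \<rho> n z z - (coeff_form \<rho> n (osc t) z)\<^sup>2 \<ge> 0"
  unfolding gram_eq Let_def by (intro mult_nonneg_nonneg coeff_form_nonneg)

text \<open>Already in the first coefficient, \<open>osc (t + h)\<close> is not a real multiple of \<open>osc t\<close>, because
  \<open>cis h\<close> is not real for \<open>0 < h < \<pi>\<close>; hence the difference quotient is not one either.\<close>

lemma gram_pos:
  assumes h: "0 < h" "h < pi"
  shows "coeff_form \<rho> n (osc t) (osc t) * coeff_form \<rho> n (diffq h t) (diffq h t) - (coeff_form \<rho> n (osc t) (diffq h t))\<^sup>2 > 0"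
proof -
  let ?V = "coeff_form \<rho> n (osc t) (osc t)" and ?c1 = "coeff_form \<rho> n (osc t) (diffq h t)"
  define w where "w = (\<lambda>k. of_real (- (?c1 / ?V)) * osc t k + of_real 1 * diffq h t k)"
  have "w 1 = osc t 1 * (cis h - 1 - of_real (h * (?c1 / ?V))) / of_real h"
    using h by (simp add: w_def diffq_eq field_simps)
  moreover have "Im (cis h - 1 - of_real (h * (?c1 / ?V))) > 0"
    using h sin_gt_zero[of h] by simp
  hence "cis h - 1 - of_real (h * (?c1 / ?V)) \<noteq> 0" by (metis less_irrefl zero_complex.simps(2))
  moreover have "osc t 1 \<noteq> 0" using cmod_osc[of t 1] by (metis norm_zero zero_neq_one)
  ultimately have "w 1 \<noteq> 0" using h by simp
  hence "coeff_form \<rho> n w w > 0" 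
    using mult_pos_pos[OF gamma, of "(cmod (w 1))\<^sup>2"] coeff_form_ge[of w] by simp
  thus ?thesis unfolding gram_eq Let_def w_def[symmetric] using variance_pos[of t] by simp
qed

lemma coeff_form_shift:
  assumes "h \<noteq> 0"
  shows "coeff_form \<rho> n (osc t) (osc (t + h)) = coeff_form \<rho> n (osc t) (osc t) + h * coeff_form \<rho> n (osc t) (diffq h t)"
    and "coeff_form \<rho> n (osc (t + h)) (osc (t + h)) = coeff_form \<rho> n (osc t) (osc t) + 2 * h * coeff_form \<rho> n (osc t) (diffq h t) + h\<^sup>2 * coeff_form \<rho> n (diffq h t) (diffq h t)"
  unfolding osc_shift[OF assms] by (simp only: coeff_form_linear_right mult_1, simp only: coeff_form_square power_one mult_1 mult_1_right)

lemma gram_shift: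
  assumes "h \<noteq> 0"
  shows "coeff_form \<rho> n (osc t) (osc t) * coeff_form \<rho> n (osc (t + h)) (osc (t + h)) - (coeff_form \<rho> n (osc t) (osc (t + h)))\<^sup>2
    = h\<^sup>2 * (coeff_form \<rho> n (osc t) (osc t) * coeff_form \<rho> n (diffq h t) (diffq h t) - (coeff_form \<rho> n (osc t) (diffq h t))\<^sup>2)"
  unfolding coeff_form_shift[OF assms] by (simp add: algebra_simps power2_eq_square)

text \<open>A positive covariance, which holds for small \<open>h\<close>, allows the angle to be written as the arctangent of a
  quantity of order \<open>h\<close>, by the reflection formula of the arctangent.\<close>

lemma sign_change_prob_eq:
  assumes h: "0 < h" "h < pi" and K: "coeff_form \<rho> n (osc t) (osc (t + h)) > 0"
  shows "sign_change_prob \<rho> n h t =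
     arctan (h * sqrt (coeff_form \<rho> n (osc t) (osc t) * coeff_form \<rho> n (diffq h t) (diffq h t) - (coeff_form \<rho> n (osc t) (diffq h t))\<^sup>2) / coeff_form \<rho> n (osc t) (osc (t + h))) / pi"
proof -
  define K where "K = coeff_form \<rho> n (osc t) (osc (t + h))"
  define G where "G = coeff_form \<rho> n (osc t) (osc t) * coeff_form \<rho> n (diffq h t) (diffq h t) - (coeff_form \<rho> n (osc t) (diffq h t))\<^sup>2"
  have G: "G > 0" using gram_pos[OF h] by (simp add: G_def)
  define y where "y = h * sqrt G / K"
  have y: "y > 0" using G h K by (simp add: y_def K_def)
  have "sqrt (coeff_form \<rho> n (osc t) (osc t) * coeff_form \<rho> n (osc (t + h)) (osc (t + h)) - K\<^sup>2) = h * sqrt G"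
    using gram_shift[of h t] h by (simp add: K_def G_def real_sqrt_mult)
  hence "sign_change_prob \<rho> n h t = (pi / 2 - arctan (1 / y)) / pi"
    by (simp add: sign_change_prob_def Let_def K_def y_def)
  also have "arctan (1 / y) = pi / 2 - arctan y"
    using arctan_inverse[of y] y by (simp add: inverse_eq_divide)
  finally show ?thesis by (simp add: y_def G_def K_def)
qed

lemma tendsto_gram:
  "((\<lambda>h. coeff_form \<rho> n (osc t) (osc t) * coeff_form \<rho> n (diffq h t) (diffq h t) - (coeff_form \<rho> n (osc t) (diffq h t))\<^sup>2)
     \<longlongrightarrow> coeff_form \<rho> n (osc t) (osc t) * coeff_form \<rho> n (osc' t) (osc' t) - (coeff_form \<rho> n (osc t) (osc' t))\<^sup>2) (at_right 0)"
  by (intro tendsto_intros tendsto_coeff_form tendsto_diffq)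

lemma tendsto_covariance_shift:
  "((\<lambda>h. coeff_form \<rho> n (osc t) (osc (t + h))) \<longlongrightarrow> coeff_form \<rho> n (osc t) (osc t)) (at_right 0)"
  unfolding osc_def
  by (rule tendsto_coeff_form) (auto intro!: tendsto_eq_intros simp: cis_conv_exp)

text \<open>The arctangent is asymptotic to its argument, which is \<open>h\<close> times the square root of a convergent Gram
  determinant, divided by a covariance that tends to the variance.\<close>

lemma sign_change_prob_asymp:
  "((\<lambda>h. sign_change_prob \<rho> n h t / h) \<longlongrightarrow> kac_rice_density \<rho> n t) (at_right 0)"
proof -
  let ?V = "coeff_form \<rho> n (osc t) (osc t)"
  define K where "K h = coeff_form \<rho> n (osc t) (osc (t + h))" for h
  define G where "G h = ?V * coeff_form \<rho> n (diffq h t) (diffq h t) - (coeff_form \<rho> n (osc t) (diffq h t))\<^sup>2" for h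
  define G0 where "G0 = ?V * coeff_form \<rho> n (osc' t) (osc' t) - (coeff_form \<rho> n (osc t) (osc' t))\<^sup>2"
  define y where "y h = h * sqrt (G h) / K h" for h
  have Gl: "(G \<longlongrightarrow> G0) (at_right 0)" unfolding G_def G0_def by (rule tendsto_gram)
  have Kl: "(K \<longlongrightarrow> ?V) (at_right 0)" unfolding K_def by (rule tendsto_covariance_shift)
  have Kpos: "\<forall>\<^sub>F h in at_right 0. K h > 0" by (rule order_tendstoD(1)[OF Kl variance_pos])
  have hs: "\<forall>\<^sub>F h in at_right (0::real). 0 < h \<and> h < pi"
    by (auto simp: eventually_at_right_field intro!: exI[of _ pi])
  have slope: "((\<lambda>h. sqrt (G h) / K h) \<longlongrightarrow> sqrt G0 / ?V) (at_right 0)"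
    using variance_pos[of t] by (intro tendsto_intros Gl Kl) auto
  have "((\<lambda>h. h * (sqrt (G h) / K h)) \<longlongrightarrow> 0 * (sqrt G0 / ?V)) (at_right 0)"
    by (intro tendsto_mult slope tendsto_ident_at)
  hence y0: "(y \<longlongrightarrow> 0) (at_right 0)" by (simp add: y_def[abs_def])
  have ypos: "\<forall>\<^sub>F h in at_right 0. y h > 0"
    using Kpos hs by eventually_elim (use gram_pos in \<open>auto simp: y_def G_def\<close>)
  have yf: "filterlim y (at 0) (at_right 0)"
    using y0 ypos by (auto simp: filterlim_at elim: eventually_mono)
  have "((\<lambda>x. arctan x / x) \<longlongrightarrow> 1) (at 0)"
    using DERIV_arctan[of 0] by (simp add: has_field_derivative_iff)
  from filterlim_compose[OF this yf] have "((\<lambda>h. arctan (y h) / y h) \<longlongrightarrow> 1) (at_right 0)" .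
  hence "((\<lambda>h. (arctan (y h) / y h) * (sqrt (G h) / K h) / pi) \<longlongrightarrow> 1 * (sqrt G0 / ?V) / pi) (at_right 0)"
    by (intro tendsto_divide tendsto_mult slope tendsto_const) auto
  moreover have "\<forall>\<^sub>F h in at_right 0. (arctan (y h) / y h) * (sqrt (G h) / K h) / pi = sign_change_prob \<rho> n h t / h"
    using Kpos hs ypos
  proof eventually_elim
    case (elim h)
    have p: "sign_change_prob \<rho> n h t = arctan (y h) / pi"
      using sign_change_prob_eq[of h t] elim by (simp add: K_def G_def y_def)
    have q: "sqrt (G h) / K h = y h / h" using elim by (simp add: y_def)
    show ?case unfolding p q using elim by simp
  qed
  ultimately have "((\<lambda>h. sign_change_prob \<rho> n h t / h) \<longlongrightarrow> 1 * (sqrt G0 / ?V) / pi) (at_right 0)"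
    by (rule Lim_transform_eventually)
  thus ?thesis by (simp add: kac_rice_density_def G0_def mult.commute)
qed

text \<open>The majorant for dominated convergence. It is uniform in \<open>t\<close>: all covariances involved are bounded in
  terms of \<open>n\<close> and \<open>\<rho>\<close>, and the variance is bounded below by \<open>\<gamma>\<close>.\<close>

lemma sign_change_prob_bound:
  "\<exists>C. \<forall>\<^sub>F h in at_right 0. \<forall>t. 0 \<le> sign_change_prob \<rho> n h t \<and> sign_change_prob \<rho> n h t / h \<le> C"
proof -
  define R where "R = (\<Sum>k=1..n. \<Sum>l=1..n. \<bar>\<rho> (nat \<bar>int k - int l\<bar>)\<bar>)"
  have R: "R \<ge> 0" unfolding R_def by (intro sum_nonneg) auto
  \<comment> \<open>For \<open>h < e\<close> the covariance of \<open>f t\<close> and \<open>f (t + h)\<close> is still at least \<open>\<gamma> / 2\<close>.\<close>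
  define e where "e = min pi (\<gamma> / (2 * (R * real n) + 1))"
  have e: "e > 0" using gamma R by (auto simp: e_def intro!: divide_pos_pos add_nonneg_pos)
  have "0 \<le> sign_change_prob \<rho> n h t \<and> sign_change_prob \<rho> n h t / h \<le> R * real n / (\<gamma> / 2) / pi" if h: "0 < h" "h < e" for h t
  proof -
    let ?V = "coeff_form \<rho> n (osc t) (osc t)"
    define c1 where "c1 = coeff_form \<rho> n (osc t) (diffq h t)"
    define c2 where "c2 = coeff_form \<rho> n (diffq h t) (diffq h t)"
    define K where "K = coeff_form \<rho> n (osc t) (osc (t + h))"
    have hpi: "h < pi" using h by (simp add: e_def)
    have d: "cmod (diffq h t k) \<le> real n" if "k \<in> {1..n}" for k
      using cmod_diffq_le[OF h(1), of t k] that by (auto intro: order_trans)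
    have V: "?V \<le> R" using coeff_form_bound[of n "osc t" 1 "osc t" 1 \<rho>] by (simp add: R_def)
    have c1: "\<bar>c1\<bar> \<le> R * real n" using coeff_form_bound[of n "osc t" 1 "diffq h t" "real n" \<rho>] d by (simp add: c1_def R_def)
    have c2: "c2 \<le> R * (real n * real n)" using coeff_form_bound[of n "diffq h t" "real n" "diffq h t" "real n" \<rho>] d by (simp add: c2_def R_def)
    have "h * (R * real n) \<le> \<gamma> / 2"
    proof -
      have "h * (2 * (R * real n) + 1) \<le> \<gamma>"
        using h(2) R by (simp add: e_def pos_less_divide_eq add_nonneg_pos)
      thus ?thesis using h(1) by (simp add: algebra_simps)
    qed
    moreover have "h * c1 \<ge> - (h * (R * real n))" using c1 h(1)
      by (metis abs_le_D2 minus_le_iff mult_left_mono less_imp_le mult_minus_right)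
    ultimately have K: "K \<ge> \<gamma> / 2"
      using variance_ge[of t] coeff_form_shift(1)[of h t] h(1) by (simp add: K_def c1_def)
    have Kp: "K > 0" using K gamma by linarith
    have G: "?V * c2 - c1\<^sup>2 > 0" using gram_pos[OF h(1) hpi, of t] by (simp add: c1_def c2_def)
    have "sqrt (?V * c2 - c1\<^sup>2) \<le> sqrt ((R * real n)\<^sup>2)"
    proof (rule real_sqrt_le_mono)
      have "0 \<le> \<gamma> * (cmod (diffq h t 1))\<^sup>2" using gamma by simp
      also have "\<dots> \<le> c2" unfolding c2_def by (rule coeff_form_ge)
      finally have "c2 \<ge> 0" .
      hence "?V * c2 \<le> R * (R * (real n * real n))" using V c2 R by (intro mult_mono) auto
      also have "\<dots> = (R * real n)\<^sup>2" by (simp add: power2_eq_square mult_ac)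
      finally show "?V * c2 - c1\<^sup>2 \<le> (R * real n)\<^sup>2" using zero_le_power2[of c1] by linarith
    qed
    hence sG: "sqrt (?V * c2 - c1\<^sup>2) \<le> R * real n" using R by simp
    have p: "sign_change_prob \<rho> n h t = arctan (h * sqrt (?V * c2 - c1\<^sup>2) / K) / pi"
      using sign_change_prob_eq[OF h(1) hpi, of t] Kp by (simp add: K_def c1_def c2_def)
    have y: "h * sqrt (?V * c2 - c1\<^sup>2) / K \<ge> 0" using h G Kp by simp
    have "arctan (h * sqrt (?V * c2 - c1\<^sup>2) / K) \<le> h * sqrt (?V * c2 - c1\<^sup>2) / K"
      using y by (rule arctan_le_self)
    also have "\<dots> \<le> h * (R * real n) / (\<gamma> / 2)"
      using h(1) sG K gamma R G by (intro frac_le mult_left_mono) auto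
    finally have "sign_change_prob \<rho> n h t / h \<le> (h * (R * real n) / (\<gamma> / 2)) / pi / h"
      unfolding p using h(1) by (intro divide_right_mono) auto
    thus ?thesis using y h(1) unfolding p by simp
  qed
  thus ?thesis using e by (intro exI[of _ "R * real n / (\<gamma> / 2) / pi"]) (auto simp: eventually_at_right_field)
qed

end


section \<open>Expected measure of sign changes\<close>

lemma lin_comb_bound: "\<bar>lin_comb a b n z \<omega>\<bar> \<le> (\<Sum>k=1..n. cmod (z k) * (\<bar>a k \<omega>\<bar> + \<bar>b k \<omega>\<bar>))"
proof -
  have "\<bar>lin_comb a b n z \<omega>\<bar> \<le> (\<Sum>k=1..n. \<bar>Re (z k) * a k \<omega> + Im (z k) * b k \<omega>\<bar>)"
    unfolding lin_comb_def by (rule sum_abs)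
  also have "\<dots> \<le> (\<Sum>k=1..n. cmod (z k) * (\<bar>a k \<omega>\<bar> + \<bar>b k \<omega>\<bar>))"
  proof (rule sum_mono)
    fix k
    have "\<bar>Re (z k) * a k \<omega> + Im (z k) * b k \<omega>\<bar> \<le> \<bar>Re (z k)\<bar> * \<bar>a k \<omega>\<bar> + \<bar>Im (z k)\<bar> * \<bar>b k \<omega>\<bar>"
      unfolding abs_mult[symmetric] by (rule abs_triangle_ineq)
    also have "\<dots> \<le> cmod (z k) * \<bar>a k \<omega>\<bar> + cmod (z k) * \<bar>b k \<omega>\<bar>"
      by (intro add_mono mult_right_mono abs_Re_le_cmod abs_Im_le_cmod) auto
    finally show "\<bar>Re (z k) * a k \<omega> + Im (z k) * b k \<omega>\<bar> \<le> cmod (z k) * (\<bar>a k \<omega>\<bar> + \<bar>b k \<omega>\<bar>)"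
      by (simp add: distrib_left)
  qed
  finally show ?thesis .
qed

lemma trig_poly_eq_osc: "trig_poly a b n \<omega> t = lin_comb a b n (osc t) \<omega>"
  unfolding trig_poly_eq_lin_comb osc_def[abs_def] ..

lemma DERIV_trig_poly: "(trig_poly a b n \<omega> has_real_derivative lin_comb a b n (osc' t) \<omega>) (at t)"
  unfolding trig_poly_def[abs_def] lin_comb_def osc'_def
  by (auto intro!: derivative_eq_intros sum.cong simp: mult_ac)

lemma lin_comb_taylor:
  "\<bar>lin_comb a b n (osc s) \<omega> - lin_comb a b n (osc t) \<omega> - (s - t) * lin_comb a b n (osc' t) \<omega>\<bar>
     \<le> (\<Sum>k=1..n. (real k)\<^sup>2 / 2 * (\<bar>a k \<omega>\<bar> + \<bar>b k \<omega>\<bar>)) * (s - t)\<^sup>2"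
proof -
  have "lin_comb a b n (osc s) \<omega> - lin_comb a b n (osc t) \<omega> - (s - t) * lin_comb a b n (osc' t) \<omega>
     = lin_comb a b n (\<lambda>k. osc s k - osc t k - of_real (s - t) * osc' t k) \<omega>"
    by (simp add: lin_comb_def sum_distrib_left sum_subtractf[symmetric] algebra_simps)
  also have "\<bar>\<dots>\<bar> \<le> (\<Sum>k=1..n. cmod (osc s k - osc t k - of_real (s - t) * osc' t k) * (\<bar>a k \<omega>\<bar> + \<bar>b k \<omega>\<bar>))"
    by (rule lin_comb_bound)
  also have "\<dots> \<le> (\<Sum>k=1..n. ((real k)\<^sup>2 * (s - t)\<^sup>2 / 2) * (\<bar>a k \<omega>\<bar> + \<bar>b k \<omega>\<bar>))"
    by (intro sum_mono mult_right_mono osc_taylor) auto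
  also have "\<dots> = (\<Sum>k=1..n. (real k)\<^sup>2 / 2 * (\<bar>a k \<omega>\<bar> + \<bar>b k \<omega>\<bar>)) * (s - t)\<^sup>2"
    unfolding sum_distrib_right by (intro sum.cong refl) simp
  finally show ?thesis .
qed

lemma continuous_on_coeff_form:
  assumes "\<And>k. continuous_on S (\<lambda>t. z t k)" "\<And>k. continuous_on S (\<lambda>t. w t k)"
  shows "continuous_on S (\<lambda>t. coeff_form \<rho> n (z t) (w t))"
  unfolding coeff_form_def by (intro continuous_intros assms)

lemma continuous_on_osc [continuous_intros]: "continuous_on S (\<lambda>t. osc (t + h) k)" "continuous_on S (\<lambda>t. osc t k)" "continuous_on S (\<lambda>t. osc' t k)"
  unfolding osc_def osc'_def by (intro continuous_intros)+

lemma measurable_coeff_form_osc [measurable]: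
  "(\<lambda>t. coeff_form \<rho> n (osc t) (osc t)) \<in> borel_measurable borel"
  "(\<lambda>t. coeff_form \<rho> n (osc t) (osc' t)) \<in> borel_measurable borel"
  "(\<lambda>t. coeff_form \<rho> n (osc' t) (osc' t)) \<in> borel_measurable borel"
  "(\<lambda>t. coeff_form \<rho> n (osc t) (osc (t + h))) \<in> borel_measurable borel"
  "(\<lambda>t. coeff_form \<rho> n (osc (t + h)) (osc (t + h))) \<in> borel_measurable borel"
  by (intro borel_measurable_continuous_onI continuous_on_coeff_form continuous_intros)+

lemma measurable_sign_change_prob [measurable]: "sign_change_prob \<rho> n h \<in> borel_measurable borel"
  unfolding sign_change_prob_def[abs_def] Let_def by measurable

lemma measurable_kac_rice_density [measurable]: "kac_rice_density \<rho> n \<in> borel_measurable borel"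
  unfolding kac_rice_density_def[abs_def] by measurable

locale definite_gaussian_seq_pair = gaussian_seq_pair M a b \<rho> + definite_correlation \<rho> n \<gamma>
  for M :: "'a measure" and a b :: "nat \<Rightarrow> 'a \<Rightarrow> real" and \<rho> :: "nat \<Rightarrow> real" and n :: nat and \<gamma> :: real
begin

lemma prob_trig_poly_small:
  assumes "\<eta> \<ge> 0"
  shows "prob {\<omega>\<in>space M. \<bar>lin_comb a b n (osc t) \<omega>\<bar> \<le> \<eta>} \<le> (1 / sqrt \<gamma>) * \<eta>"
proof -
  have "prob {\<omega>\<in>space M. \<bar>lin_comb a b n (osc t) \<omega>\<bar> \<le> \<eta>} \<le> \<eta> / sqrt (coeff_form \<rho> n (osc t) (osc t))"
    by (rule prob_lin_comb_small[OF variance_pos assms])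
  also have "\<dots> \<le> \<eta> / sqrt \<gamma>"
    using assms gamma variance_ge[of t] by (intro divide_left_mono) (auto intro!: mult_pos_pos variance_pos)
  finally show ?thesis by simp
qed

text \<open>Zeros at the end points of the interval have to be excluded too: an interval of sign changes to the left
  of a zero at \<open>0\<close> would be lost.\<close>

lemma AE_simple_zeros:
  "AE \<omega> in M. \<forall>z\<in>{0..2*pi}. trig_poly a b n \<omega> z = 0 \<longrightarrow>
     0 < z \<and> z < 2*pi \<and> (\<exists>D. D \<noteq> 0 \<and> (trig_poly a b n \<omega> has_real_derivative D) (at z))"
proof -
  have K: "(\<lambda>\<omega>. \<Sum>k=1..n. (real k)\<^sup>2 / 2 * (\<bar>a k \<omega>\<bar> + \<bar>b k \<omega>\<bar>)) \<in> borel_measurable M"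
    using measurable_a measurable_b by (intro borel_measurable_sum borel_measurable_times borel_measurable_const borel_measurable_add borel_measurable_abs) auto
  have 1: "AE \<omega> in M. \<forall>t\<in>{0..2*pi}. lin_comb a b n (osc t) \<omega> = 0 \<longrightarrow> lin_comb a b n (osc' t) \<omega> \<noteq> 0"
    by (rule AE_no_double_zero[OF measurable_lin_comb K lin_comb_taylor prob_trig_poly_small]) auto
  have 2: "AE \<omega> in M. lin_comb a b n (osc t) \<omega> \<noteq> 0" for t
    by (rule AE_nonzero_of_small_ball[OF _ prob_trig_poly_small]) auto
  show ?thesis using 1 2[of 0] 2[of "2*pi"]
  proof eventually_elim
    case (elim \<omega>)
    show ?case
    proof (intro ballI impI)
      fix z assume z: "z \<in> {0..2*pi}" "trig_poly a b n \<omega> z = 0"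
      hence "z \<noteq> 0" "z \<noteq> 2*pi" using elim(2,3) by (auto simp: trig_poly_eq_osc)
      moreover have "lin_comb a b n (osc' z) \<omega> \<noteq> 0" using elim(1) z by (auto simp: trig_poly_eq_osc)
      ultimately show "0 < z \<and> z < 2*pi \<and> (\<exists>D. D \<noteq> 0 \<and> (trig_poly a b n \<omega> has_real_derivative D) (at z))"
        using z(1) DERIV_trig_poly[of a b n \<omega> z] by auto
    qed
  qed
qed

lemma continuous_trig_poly: "continuous_on UNIV (trig_poly a b n \<omega>)"
  by (rule DERIV_continuous_on) (rule DERIV_trig_poly)

lemma measurable_trig_poly [measurable]:
  "(\<lambda>(\<omega>, t). trig_poly a b n \<omega> t) \<in> borel_measurable (M \<Otimes>\<^sub>M lborel)"
  unfolding trig_poly_def split_beta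
proof (intro borel_measurable_sum borel_measurable_add borel_measurable_times)
  fix k assume "k \<in> {1..n}"
  hence [measurable]: "a k \<in> borel_measurable M" "b k \<in> borel_measurable M" using measurable_a measurable_b by auto
  show "(\<lambda>x. a k (fst x)) \<in> borel_measurable (M \<Otimes>\<^sub>M lborel)" "(\<lambda>x. b k (fst x)) \<in> borel_measurable (M \<Otimes>\<^sub>M lborel)"
    by measurable
qed measurable

lemma prob_trig_poly_sign_change:
  assumes h: "0 < h" "h < pi"
  shows "prob {\<omega>\<in>space M. trig_poly a b n \<omega> t * trig_poly a b n \<omega> (t + h) < 0} = sign_change_prob \<rho> n h t"
proof -
  have "coeff_form \<rho> n (osc t) (osc t) * coeff_form \<rho> n (osc (t + h)) (osc (t + h)) - (coeff_form \<rho> n (osc t) (osc (t + h)))\<^sup>2 > 0"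
    using gram_shift[of h t] gram_pos[OF h] h by (auto intro!: mult_pos_pos)
  from prob_lin_comb_sign_change[OF variance_pos this] show ?thesis
    by (simp add: trig_poly_eq_osc sign_change_prob_def Let_def)
qed

definition sign_change_measure :: "real \<Rightarrow> 'a \<Rightarrow> ennreal" where
  "sign_change_measure h \<omega> = emeasure lborel {t\<in>{0..2*pi-h}. trig_poly a b n \<omega> t * trig_poly a b n \<omega> (t + h) < 0}"

lemma measurable_sign_change_indicator:
  "(\<lambda>(\<omega>, t). indicator {t\<in>{0..2*pi-h}. trig_poly a b n \<omega> t * trig_poly a b n \<omega> (t + h) < 0} t :: ennreal) \<in> borel_measurable (M \<Otimes>\<^sub>M lborel)"
proof -
  have m2: "(\<lambda>(\<omega>, t). (\<omega>, t + h)) \<in> M \<Otimes>\<^sub>M lborel \<rightarrow>\<^sub>M M \<Otimes>\<^sub>M lborel" by measurable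
  have [measurable]: "(\<lambda>x. trig_poly a b n (fst x) (snd x + h)) \<in> borel_measurable (M \<Otimes>\<^sub>M lborel)"
    using measurable_compose[OF m2 measurable_trig_poly] by (simp add: split_beta)
  have [measurable]: "(\<lambda>x. trig_poly a b n (fst x) (snd x)) \<in> borel_measurable (M \<Otimes>\<^sub>M lborel)"
    using measurable_trig_poly by (simp add: split_beta)
  have eq: "(\<lambda>(\<omega>, t). indicator {t\<in>{0..2*pi-h}. trig_poly a b n \<omega> t * trig_poly a b n \<omega> (t + h) < 0} t :: ennreal)
    = (\<lambda>x. if 0 \<le> snd x \<and> snd x \<le> 2*pi-h \<and> trig_poly a b n (fst x) (snd x) * trig_poly a b n (fst x) (snd x + h) < 0 then 1 else 0)"
    by (auto simp: fun_eq_iff indicator_def)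
  show ?thesis unfolding eq by measurable
qed

lemma sign_change_measure_eq:
  "sign_change_measure h \<omega> = (\<integral>\<^sup>+t. indicator {t\<in>{0..2*pi-h}. trig_poly a b n \<omega> t * trig_poly a b n \<omega> (t + h) < 0} t \<partial>lborel)"
proof -
  have [measurable]: "trig_poly a b n \<omega> \<in> borel_measurable borel"
    by (rule borel_measurable_continuous_onI[OF continuous_trig_poly])
  have "{t\<in>{0..2*pi-h}. trig_poly a b n \<omega> t * trig_poly a b n \<omega> (t + h) < 0} \<in> sets lborel" by measurable
  thus ?thesis unfolding sign_change_measure_def by (rule nn_integral_indicator[symmetric])
qed

lemma measurable_sign_change_measure [measurable]: "sign_change_measure h \<in> borel_measurable M"
  unfolding sign_change_measure_eq[abs_def]
  by (rule lborel.borel_measurable_nn_integral[OF measurable_sign_change_indicator])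

lemma expectation_sign_change_measure:
  assumes h: "0 < h" "h < pi"
  shows "(\<integral>\<^sup>+\<omega>. sign_change_measure h \<omega> \<partial>M) = (\<integral>\<^sup>+t. indicator {0..2*pi-h} t * ennreal (sign_change_prob \<rho> n h t) \<partial>lborel)"
proof -
  interpret P: pair_sigma_finite M lborel by standard
  have "(\<integral>\<^sup>+\<omega>. sign_change_measure h \<omega> \<partial>M) = (\<integral>\<^sup>+t. (\<integral>\<^sup>+\<omega>. indicator {t\<in>{0..2*pi-h}. trig_poly a b n \<omega> t * trig_poly a b n \<omega> (t + h) < 0} t \<partial>M) \<partial>lborel)"
    unfolding sign_change_measure_eq by (rule P.Fubini'[symmetric]) (rule measurable_sign_change_indicator)
  also have "\<dots> = (\<integral>\<^sup>+t. indicator {0..2*pi-h} t * ennreal (sign_change_prob \<rho> n h t) \<partial>lborel)"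
  proof (rule nn_integral_cong)
    fix t
    have [measurable]: "trig_poly a b n \<omega> \<in> borel_measurable borel" for \<omega>
      by (rule borel_measurable_continuous_onI[OF continuous_trig_poly])
    have [measurable]: "(\<lambda>\<omega>. trig_poly a b n \<omega> s) \<in> borel_measurable M" for s
      unfolding trig_poly_eq_osc by measurable
    have "(\<integral>\<^sup>+\<omega>. indicator {t\<in>{0..2*pi-h}. trig_poly a b n \<omega> t * trig_poly a b n \<omega> (t + h) < 0} t \<partial>M)
       = (\<integral>\<^sup>+\<omega>. indicator {0..2*pi-h} t * indicator {\<omega>\<in>space M. trig_poly a b n \<omega> t * trig_poly a b n \<omega> (t + h) < 0} \<omega> \<partial>M)"
      by (rule nn_integral_cong) (auto simp: indicator_def)
    also have "\<dots> = indicator {0..2*pi-h} t * emeasure M {\<omega>\<in>space M. trig_poly a b n \<omega> t * trig_poly a b n \<omega> (t + h) < 0}"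
      by (subst nn_integral_cmult) auto
    finally show "(\<integral>\<^sup>+\<omega>. indicator {t\<in>{0..2*pi-h}. trig_poly a b n \<omega> t * trig_poly a b n \<omega> (t + h) < 0} t \<partial>M)
       = indicator {0..2*pi-h} t * ennreal (sign_change_prob \<rho> n h t)"
      by (simp add: emeasure_eq_measure prob_trig_poly_sign_change[OF h])
  qed
  finally show ?thesis .
qed

text \<open>The normalized measure of sign changes never exceeds the number of zeros, which bounds its mean, and
  almost surely its lower limit is at least that number, so Fatou's lemma gives the opposite bound.\<close>

lemma expectation_num_zeros_eq_lim:
  assumes h: "filterlim h (at_right 0) sequentially" and hpos: "\<And>m. 0 < h m"
    and lim: "(\<lambda>m. ennreal (1 / h m) * (\<integral>\<^sup>+\<omega>. sign_change_measure (h m) \<omega> \<partial>M)) \<longlonglongrightarrow> c"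
  shows "(\<integral>\<^sup>+\<omega>. num_zeros {0..2*pi} (trig_poly a b n \<omega>) \<partial>M) = c"
proof (rule antisym)
  have eq: "ennreal (1 / h m) * (\<integral>\<^sup>+\<omega>. sign_change_measure (h m) \<omega> \<partial>M) = (\<integral>\<^sup>+\<omega>. ennreal (1 / h m) * sign_change_measure (h m) \<omega> \<partial>M)" for m
    by (rule nn_integral_cmult[symmetric]) measurable
  have "(\<integral>\<^sup>+\<omega>. num_zeros {0..2*pi} (trig_poly a b n \<omega>) \<partial>M) \<le> (\<integral>\<^sup>+\<omega>. liminf (\<lambda>m. ennreal (1 / h m) * sign_change_measure (h m) \<omega>) \<partial>M)"
    unfolding sign_change_measure_def
    by (rule nn_integral_mono_AE, use AE_simple_zeros in eventually_elim, rule num_zeros_le_liminf_sign_change[OF continuous_trig_poly _ h]) blast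
  also have "\<dots> \<le> liminf (\<lambda>m. \<integral>\<^sup>+\<omega>. ennreal (1 / h m) * sign_change_measure (h m) \<omega> \<partial>M)"
    by (rule nn_integral_liminf) measurable
  also have "\<dots> = c" unfolding eq[symmetric] by (rule lim_imp_Liminf[OF _ lim]) simp
  finally show "(\<integral>\<^sup>+\<omega>. num_zeros {0..2*pi} (trig_poly a b n \<omega>) \<partial>M) \<le> c" .
  show "c \<le> (\<integral>\<^sup>+\<omega>. num_zeros {0..2*pi} (trig_poly a b n \<omega>) \<partial>M)"
  proof (rule LIMSEQ_le_const2[OF lim], intro exI allI impI)
    fix m :: nat
    have "ennreal (1 / h m) * sign_change_measure (h m) \<omega> \<le> num_zeros {0..2*pi} (trig_poly a b n \<omega>)" for \<omega>
    proof -
      have "ennreal (1 / h m) * sign_change_measure (h m) \<omega> \<le> ennreal (1 / h m) * (ennreal (h m) * num_zeros {0..2*pi} (trig_poly a b n \<omega>))"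
        unfolding sign_change_measure_def
        by (intro mult_left_mono emeasure_sign_change_le continuous_trig_poly hpos) simp
      also have "\<dots> = num_zeros {0..2*pi} (trig_poly a b n \<omega>)"
        using hpos[of m] by (simp add: mult.assoc[symmetric] ennreal_mult[symmetric])
      finally show ?thesis .
    qed
    thus "ennreal (1 / h m) * (\<integral>\<^sup>+\<omega>. sign_change_measure (h m) \<omega> \<partial>M) \<le> (\<integral>\<^sup>+\<omega>. num_zeros {0..2*pi} (trig_poly a b n \<omega>) \<partial>M)"
      unfolding eq by (intro nn_integral_mono)
  qed
qed

end


section \<open>Spectral representation of the covariance form\<close>

lemma cmod_sum_cis_le:
  fixes y :: real
  assumes "cis y \<noteq> 1"
  shows "cmod (\<Sum>k=j..n. cis (real k * y)) \<le> 2 / cmod (1 - cis y)"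
proof (cases "j \<le> n")
  case True
  have eq: "cis (real k * y) = cis y ^ k" for k by (rule Complex.DeMoivre[symmetric])
  have pos: "cmod (1 - cis y) > 0" using assms by simp
  have "(1 - cis y) * (\<Sum>k=j..n. cis (real k * y)) = cis y ^ j - cis y ^ Suc n"
    unfolding eq using sum_gp_multiplied[OF True, of "cis y"] by simp
  hence "cmod (1 - cis y) * cmod (\<Sum>k=j..n. cis (real k * y)) = cmod (cis y ^ j - cis y ^ Suc n)"
    by (metis norm_mult)
  also have "\<dots> \<le> cmod (cis y ^ j) + cmod (cis y ^ Suc n)" by (rule norm_triangle_ineq4)
  also have "\<dots> = 2" by (simp add: norm_power norm_mult)
  finally show ?thesis using pos by (simp add: field_simps)
qed simp

text \<open>Summation by parts, written as an interchange of sums.\<close>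

lemma cmod_sum_k_cis_le:
  fixes y :: real
  assumes "cis y \<noteq> 1"
  shows "cmod (\<Sum>k=1..n. of_nat k * cis (real k * y)) \<le> real n * (2 / cmod (1 - cis y))"
proof -
  have "(\<Sum>k=1..n. of_nat k * cis (real k * y)) = (\<Sum>k=1..n. \<Sum>j=1..k. cis (real k * y))"
    by simp
  also have "\<dots> = (\<Sum>j=1..n. \<Sum>k=j..n. cis (real k * y))"
    by (induction n) (simp_all add: sum.distrib)
  also have "cmod \<dots> \<le> (\<Sum>j=1..n. cmod (\<Sum>k=j..n. cis (real k * y)))" by (rule norm_sum)
  also have "\<dots> \<le> (\<Sum>j=1..n. 2 / cmod (1 - cis y))" by (intro sum_mono cmod_sum_cis_le assms)
  finally show ?thesis by simp
qed


text \<open>The open interval is used because neither the continuity of \<open>\<psi>\<close> nor its lower bound need extend to the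
  end points.\<close>

abbreviation circ :: "real measure" where
  "circ \<equiv> restrict_space lborel {0<..<2*pi}"

lemma space_circ: "space circ = {0<..<2*pi}" by (simp add: space_restrict_space)

lemma measure_circ: "measure circ (space circ) = 2 * pi"
  by (simp add: space_circ measure_restrict_space)

lemma finite_measure_circ: "finite_measure circ"
  by (rule finite_measureI) (simp add: space_circ emeasure_restrict_space)

lemma integral_circ_eq: "(LINT x|circ. f x) = (LINT x|lborel. indicator {0<..<2*pi} x *\<^sub>R f x)"
  for f :: "real \<Rightarrow> 'b :: {banach, second_countable_topology}"
  by (simp add: integral_restrict_space)

lemma integrable_circ_iff: "integrable circ f \<longleftrightarrow> set_integrable lborel {0<..<2*pi} f"
  for f :: "real \<Rightarrow> 'b :: {banach, second_countable_topology}"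
  by (simp add: integrable_restrict_space set_integrable_def)

lemma set_integral_eq_integral_circ:
  fixes f :: "real \<Rightarrow> 'b :: {banach, second_countable_topology}"
  assumes "set_integrable lborel {0..2*pi} f"
  shows "(LINT x:{0..2*pi}|lborel. f x) = (LINT x|circ. f x)"
proof -
  have m: "(\<lambda>x. indicator {0..2*pi} x *\<^sub>R f x) \<in> borel_measurable lborel"
    using assms by (auto simp: set_integrable_def)
  have eq: "indicator {0<..<2*pi} x *\<^sub>R f x = indicator {0<..<2*pi} x *\<^sub>R (indicator {0..2*pi} x *\<^sub>R f x)" for x
    by (auto simp: indicator_def)
  have m2: "(\<lambda>x. indicator {0<..<2*pi} x *\<^sub>R f x) \<in> borel_measurable lborel"
    unfolding eq by (intro borel_measurable_scaleR m) auto
  have "(LINT x|lborel. indicator {0..2*pi} x *\<^sub>R f x) = (LINT x|lborel. indicator {0<..<2*pi} x *\<^sub>R f x)"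
  proof (rule integral_cong_AE[OF m m2])
    show "AE x in lborel. indicator {0..2*pi} x *\<^sub>R f x = indicator {0<..<2*pi} x *\<^sub>R f x"
      using AE_lborel_singleton[of 0] AE_lborel_singleton[of "2*pi"]
      by eventually_elim (auto simp: indicator_def)
  qed
  thus ?thesis by (simp add: integral_circ_eq set_lebesgue_integral_def)
qed

lemma integrable_circ_mult:
  fixes g :: "real \<Rightarrow> 'b :: {banach, second_countable_topology}"
  assumes \<psi>: "integrable circ \<psi>" and g: "g \<in> borel_measurable borel" "\<And>x. norm (g x) \<le> C"
  shows "integrable circ (\<lambda>x. \<psi> x *\<^sub>R g x)"
proof (rule Bochner_Integration.integrable_bound)
  show "integrable circ (\<lambda>x. C * \<psi> x)" using \<psi> by simp
  have [measurable]: "\<psi> \<in> borel_measurable circ" using \<psi> by simp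
  have [measurable]: "g \<in> borel_measurable circ" using g(1) by (intro measurable_restrict_space1) simp
  show "(\<lambda>x. \<psi> x *\<^sub>R g x) \<in> borel_measurable circ" by measurable
  show "AE x in circ. norm (\<psi> x *\<^sub>R g x) \<le> norm (C * \<psi> x)"
  proof (rule AE_I2)
    fix x
    have "C \<ge> 0" using g(2)[of x] norm_ge_zero[of "g x"] by linarith
    thus "norm (\<psi> x *\<^sub>R g x) \<le> norm (C * \<psi> x)"
      using mult_right_mono[OF g(2)[of x] abs_ge_zero[of "\<psi> x"]] by (simp add: abs_mult mult.commute)
  qed
qed

lemma integrable_circ_bounded:
  fixes g :: "real \<Rightarrow> real"
  assumes "g \<in> borel_measurable borel" "\<And>x. \<bar>g x\<bar> \<le> C"
  shows "integrable circ g"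
  using integrable_circ_mult[OF finite_measure.integrable_const[OF finite_measure_circ, of 1], of g C] assms by simp

text \<open>The Fourier coefficient formula for \<open>\<psi>\<close>, split into real and imaginary parts.\<close>

definition fourier_pair :: "(nat \<Rightarrow> real) \<Rightarrow> (real \<Rightarrow> real) \<Rightarrow> bool" where
  "fourier_pair \<rho> \<psi> \<longleftrightarrow> integrable circ \<psi> \<and>
     (\<forall>j::int. (LINT x|circ. \<psi> x * cos (of_int j * x)) = 2 * pi * \<rho> (nat \<bar>j\<bar>)) \<and>
     (\<forall>j::int. (LINT x|circ. \<psi> x * sin (of_int j * x)) = 0)"

lemma fourier_pair_spectral_function:
  assumes sp: "is_spectral_function \<rho> \<psi>" and int: "set_integrable lborel {0..2*pi} \<psi>"
  shows "fourier_pair \<rho> \<psi>"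
proof -
  have I: "integrable circ \<psi>"
    unfolding integrable_circ_iff by (rule set_integrable_subset[OF int]) auto
  have eq: "complex_of_real (\<psi> x) * exp (- \<i> * of_int k * complex_of_real x) = \<psi> x *\<^sub>R cis (- (of_int k * x))" for k x
    by (simp add: cis_conv_exp scaleR_conv_of_real mult_ac)
  have SI: "set_integrable lborel {0..2*pi} (\<lambda>x. \<psi> x *\<^sub>R cis (- (of_int k * x)))" for k :: int
  proof (rule set_integrable_bound[OF int])
    have *: "(\<lambda>x. indicator {0..2*pi} x *\<^sub>R (\<psi> x *\<^sub>R cis (- (of_int k * x)))) = (\<lambda>x. (indicator {0..2*pi} x *\<^sub>R \<psi> x) *\<^sub>R cis (- (of_int k * x)))"
      by (auto simp: indicator_def)
    have "(\<lambda>x. cis (- (of_int k * x))) \<in> borel_measurable borel"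
      by (intro borel_measurable_continuous_onI continuous_intros)
    thus "set_borel_measurable lborel {0..2*pi} (\<lambda>x. \<psi> x *\<^sub>R cis (- (of_int k * x)))"
      using int unfolding set_borel_measurable_def * set_integrable_def
      by (intro borel_measurable_scaleR[OF borel_measurable_integrable]) auto
  qed (auto simp: norm_mult)
  have CI: "integrable circ (\<lambda>x. \<psi> x *\<^sub>R cis (- (of_int k * x)))" for k :: int
    unfolding integrable_circ_iff by (rule set_integrable_subset[OF SI]) auto
  have C: "(LINT x|circ. \<psi> x *\<^sub>R cis (- (of_int k * x))) = of_real (2 * pi * \<rho> (nat \<bar>k\<bar>))" for k :: int
  proof -
    have "complex_of_real (\<rho> (nat \<bar>k\<bar>)) = 1 / (2 * complex_of_real pi) * (LINT x:{0..2*pi}|lborel. \<psi> x *\<^sub>R cis (- (of_int k * x)))"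
      using sp unfolding is_spectral_function_def eq by blast
    thus ?thesis unfolding set_integral_eq_integral_circ[OF SI] by simp
  qed
  have "(LINT x|circ. \<psi> x * cos (of_int k * x)) = 2 * pi * \<rho> (nat \<bar>k\<bar>)" for k :: int
    using arg_cong[OF C[of k], of Re] integral_Re[OF CI[of k]] by simp
  moreover have "(LINT x|circ. \<psi> x * sin (of_int k * x)) = 0" for k :: int
    using arg_cong[OF C[of k], of Im] integral_Im[OF CI[of k]] by simp
  ultimately show ?thesis using I by (simp add: fourier_pair_def)
qed

lemma integral_circ_cos: "(LINT x|circ. cos (of_int j * x)) = (if j = 0 then 2 * pi else 0)" for j :: int
proof (cases "j = 0")
  case True thus ?thesis using measure_circ by simp
next
  case False
  have "(LINT x|lborel. cos (of_int j * x) * indicator {0..2*pi} x) = sin (of_int j * (2 * pi)) / of_int j - sin (of_int j * 0) / of_int j"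
    using False by (intro integral_FTC_Icc_real) (auto intro!: derivative_eq_intros continuous_intros)
  also have "\<dots> = 0" using sin_integer_2pi[of "of_int j"] by (simp add: mult_ac)
  finally have "(LINT x:{0..2*pi}|lborel. cos (of_int j * x)) = 0"
    by (simp add: set_lebesgue_integral_def mult.commute)
  moreover have "set_integrable lborel {0..2*pi} (\<lambda>x. cos (of_int j * x))"
    by (rule borel_integrable_atLeastAtMost') (intro continuous_intros)
  ultimately show ?thesis using False by (simp add: set_integral_eq_integral_circ)
qed

lemma integral_circ_sin: "(LINT x|circ. sin (of_int j * x)) = 0" for j :: int
proof (cases "j = 0")
  case False
  have "(LINT x|lborel. sin (of_int j * x) * indicator {0..2*pi} x) = - cos (of_int j * (2 * pi)) / of_int j - - cos (of_int j * 0) / of_int j"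
    using False by (intro integral_FTC_Icc_real) (auto intro!: derivative_eq_intros continuous_intros)
  also have "\<dots> = 0" using cos_integer_2pi[of "of_int j"] by (simp add: mult_ac)
  finally have "(LINT x:{0..2*pi}|lborel. sin (of_int j * x)) = 0"
    by (simp add: set_lebesgue_integral_def mult.commute)
  moreover have "set_integrable lborel {0..2*pi} (\<lambda>x. sin (of_int j * x))"
    by (rule borel_integrable_atLeastAtMost') (intro continuous_intros)
  ultimately show ?thesis by (simp add: set_integral_eq_integral_circ)
qed simp

text \<open>With this pair the spectral identity below becomes Parseval's identity for trigonometric polynomials,
  which yields the lower bound of the covariance form and the masses of the kernels.\<close>

lemma fourier_pair_white_noise: "fourier_pair (\<lambda>k. if k = 0 then 1 else 0) (\<lambda>_. 1)"
  using finite_measure.integrable_const[OF finite_measure_circ]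
  by (auto simp: fourier_pair_def integral_circ_cos integral_circ_sin)

lemma coeff_form_white_noise: "coeff_form (\<lambda>k. if k = 0 then 1 else 0) n z z = (\<Sum>k=1..n. (cmod (z k))\<^sup>2)"
proof -
  have "coeff_form (\<lambda>k. if k = 0 then 1 else 0) n z z = (\<Sum>k=1..n. \<Sum>l=1..n. if k = l then (cmod (z k))\<^sup>2 else 0)"
    unfolding coeff_form_def by (intro sum.cong refl) (auto simp: complex_mult_cnj cmod_power2[unfolded power2_eq_square] power2_eq_square)
  thus ?thesis by simp
qed

lemma cmod_sum_sq_expand:
  "(cmod (\<Sum>k=1..n. z k * cis (- (real k * x))))\<^sup>2
   = (\<Sum>k=1..n. \<Sum>l=1..n. Re (z k * cnj (z l)) * cos (of_int (int k - int l) * x) + Im (z k * cnj (z l)) * sin (of_int (int k - int l) * x))"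
proof -
  let ?S = "\<Sum>k=1..n. z k * cis (- (real k * x))"
  have "(cmod ?S)\<^sup>2 = Re (?S * cnj ?S)" by (simp only: complex_norm_square[symmetric] Re_complex_of_real)
  also have "?S * cnj ?S = (\<Sum>k=1..n. \<Sum>l=1..n. (z k * cnj (z l)) * cis (- (of_int (int k - int l) * x)))"
  proof -
    have "cis (- (of_int (int k - int l) * x)) = cis (- (real k * x)) * cnj (cis (- (real l * x)))" for k l
      by (simp add: cis_cnj cis_mult algebra_simps)
    thus ?thesis by (simp only: cnj_sum sum_product complex_cnj_mult mult_ac)
  qed
  also have "Re \<dots> = (\<Sum>k=1..n. \<Sum>l=1..n. Re (z k * cnj (z l)) * cos (of_int (int k - int l) * x) + Im (z k * cnj (z l)) * sin (of_int (int k - int l) * x))"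
    by (simp del: of_int_diff)
  finally show ?thesis .
qed

text \<open>Expanding the square leaves only integrals of \<open>\<psi>\<close> against \<open>cos\<close> and \<open>sin\<close> of \<open>(k - l) x\<close>, which are the
  Fourier coefficients.\<close>

lemma integral_spectral_form:
  assumes "fourier_pair \<rho> \<psi>"
  shows "(LINT x|circ. \<psi> x * (cmod (\<Sum>k=1..n. z k * cis (- (real k * x))))\<^sup>2) = 2 * pi * coeff_form \<rho> n z z"
proof -
  have \<psi>: "integrable circ \<psi>" using assms by (simp add: fourier_pair_def)
  have ic: "integrable circ (\<lambda>x. \<psi> x * cos (of_int j * x))" and int_sin: "integrable circ (\<lambda>x. \<psi> x * sin (of_int j * x))" for j :: int
    using integrable_circ_mult[OF \<psi>, of "\<lambda>x. cos (of_int j * x)" 1] integrable_circ_mult[OF \<psi>, of "\<lambda>x. sin (of_int j * x)" 1] by auto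
  have "(LINT x|circ. \<psi> x * (cmod (\<Sum>k=1..n. z k * cis (- (real k * x))))\<^sup>2)
     = (LINT x|circ. (\<Sum>k=1..n. \<Sum>l=1..n. Re (z k * cnj (z l)) * (\<psi> x * cos (of_int (int k - int l) * x)) + Im (z k * cnj (z l)) * (\<psi> x * sin (of_int (int k - int l) * x))))"
    unfolding cmod_sum_sq_expand sum_distrib_left distrib_left
    by (intro Bochner_Integration.integral_cong refl sum.cong arg_cong2[where f="(+)"]) (simp_all only: mult_ac)
  also have "\<dots> = (\<Sum>k=1..n. (LINT x|circ. (\<Sum>l=1..n. Re (z k * cnj (z l)) * (\<psi> x * cos (of_int (int k - int l) * x)) + Im (z k * cnj (z l)) * (\<psi> x * sin (of_int (int k - int l) * x)))))"
    by (rule Bochner_Integration.integral_sum) (intro Bochner_Integration.integrable_sum Bochner_Integration.integrable_add integrable_mult_right ic int_sin)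
  also have "\<dots> = (\<Sum>k=1..n. \<Sum>l=1..n. (LINT x|circ. Re (z k * cnj (z l)) * (\<psi> x * cos (of_int (int k - int l) * x)) + Im (z k * cnj (z l)) * (\<psi> x * sin (of_int (int k - int l) * x))))"
    by (intro sum.cong refl Bochner_Integration.integral_sum Bochner_Integration.integrable_add integrable_mult_right ic int_sin)
  also have "\<dots> = (\<Sum>k=1..n. \<Sum>l=1..n. Re (z k * cnj (z l)) * (LINT x|circ. \<psi> x * cos (of_int (int k - int l) * x)) + Im (z k * cnj (z l)) * (LINT x|circ. \<psi> x * sin (of_int (int k - int l) * x)))"
    using ic int_sin by (intro sum.cong refl, subst Bochner_Integration.integral_add) (auto simp del: of_int_diff)
  also have "\<dots> = (\<Sum>k=1..n. \<Sum>l=1..n. Re (z k * cnj (z l)) * (2 * pi * \<rho> (nat \<bar>int k - int l\<bar>)))"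
    using assms by (simp add: fourier_pair_def del: of_int_diff)
  also have "\<dots> = 2 * pi * coeff_form \<rho> n z z"
    unfolding coeff_form_def sum_distrib_left by (intro sum.cong refl) (simp only: mult_ac)
  finally show ?thesis .
qed

text \<open>Comparison of \<open>\<psi>\<close> with the constant \<open>\<gamma>\<close> in the spectral integral.\<close>

lemma coeff_form_lower_bound:
  assumes fp: "fourier_pair \<rho> \<psi>" and \<gamma>: "\<And>x. x \<in> {0<..<2*pi} \<Longrightarrow> \<gamma> \<le> \<psi> x"
  shows "\<gamma> * (\<Sum>k=1..n. (cmod (z k))\<^sup>2) \<le> coeff_form \<rho> n z z"
proof -
  have \<psi>: "integrable circ \<psi>" using fp by (simp add: fourier_pair_def)
  let ?q = "\<lambda>x. (cmod (\<Sum>k=1..n. z k * cis (- (real k * x))))\<^sup>2"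
  have q: "?q \<in> borel_measurable borel"
    by (intro borel_measurable_continuous_onI continuous_intros)
  have qb: "norm (?q x) \<le> (\<Sum>k=1..n. cmod (z k))\<^sup>2" for x
  proof -
    have "cmod (\<Sum>k=1..n. z k * cis (- (real k * x))) \<le> (\<Sum>k=1..n. cmod (z k))"
      by (rule order_trans[OF norm_sum]) (simp add: norm_mult)
    thus ?thesis by (simp add: power_mono)
  qed
  have "2 * pi * (\<gamma> * (\<Sum>k=1..n. (cmod (z k))\<^sup>2)) = \<gamma> * (LINT x|circ. 1 * ?q x)"
    unfolding integral_spectral_form[OF fourier_pair_white_noise] coeff_form_white_noise by simp
  also have "\<dots> = (LINT x|circ. \<gamma> * ?q x)" by simp
  also have "\<dots> \<le> (LINT x|circ. \<psi> x * ?q x)"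
  proof (rule integral_mono)
    show "integrable circ (\<lambda>x. \<gamma> * ?q x)" using integrable_circ_bounded[OF q, of "(\<Sum>k=1..n. cmod (z k))\<^sup>2"] qb by simp
    show "integrable circ (\<lambda>x. \<psi> x * ?q x)" using integrable_circ_mult[OF \<psi> q qb] by simp
  qed (use \<gamma> space_circ in \<open>auto intro: mult_right_mono\<close>)
  also have "\<dots> = 2 * pi * coeff_form \<rho> n z z" by (rule integral_spectral_form[OF fp])
  finally show ?thesis by simp
qed


section \<open>The Kac-Rice formula\<close>

context definite_gaussian_seq_pair
begin

text \<open>The Kac-Rice formula: Tonelli expresses the mean measure of sign changes through \<open>sign_change_prob\<close>, and
  dominated convergence gives its limit.\<close>

lemma expectation_num_zeros:
  "(\<integral>\<^sup>+\<omega>. num_zeros {0..2*pi} (trig_poly a b n \<omega>) \<partial>M) = ennreal (LINT t|circ. kac_rice_density \<rho> n t)"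
proof -
  obtain C where "\<forall>\<^sub>F h in at_right 0. \<forall>t. 0 \<le> sign_change_prob \<rho> n h t \<and> sign_change_prob \<rho> n h t / h \<le> C"
    using sign_change_prob_bound by blast
  then obtain e0 where e0: "e0 > 0" "\<And>h t. 0 < h \<Longrightarrow> h < e0 \<Longrightarrow> 0 \<le> sign_change_prob \<rho> n h t \<and> sign_change_prob \<rho> n h t / h \<le> C"
    by (auto simp: eventually_at_right_field)
  define e where "e = min e0 pi / 2"
  have e: "0 < e" "e < e0" "e < pi" using e0(1) by (auto simp: e_def min_def)
  define h where "h m = e / real (Suc m)" for m
  have h: "0 < h m" "h m < e0" "h m < pi" for m
  proof -
    have "h m \<le> e" using e(1) by (simp add: h_def field_simps)
    thus "0 < h m" "h m < e0" "h m < pi" using e by (auto simp: h_def)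
  qed
  have h0: "h \<longlonglongrightarrow> 0"
    using tendsto_mult[OF tendsto_const[of e] LIMSEQ_inverse_real_of_nat] by (simp add: h_def[abs_def] divide_inverse)
  have hl: "filterlim h (at_right 0) sequentially"
    unfolding filterlim_at using h0 h(1) by (auto simp: less_imp_neq[OF h(1), symmetric])
  define u where "u m t = indicator {0..2*pi-h m} t * (sign_change_prob \<rho> n (h m) t / h m)" for m t
  have [measurable]: "u m \<in> borel_measurable lborel" for m unfolding u_def by measurable
  have u0: "u m t \<ge> 0" for m t using e0(2)[OF h(1)[of m] h(2)[of m], of t] h(1)[of m] by (auto simp: u_def indicator_def)
  have uC: "u m t \<le> C * indicator {0..2*pi} t" for m t
  proof -
    have "0 \<le> C" using e0(2)[OF h(1)[of m] h(2)[of m], of 0] h(1)[of m]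
      by (meson divide_nonneg_pos order_trans)
    thus ?thesis using e0(2)[OF h(1)[of m] h(2)[of m], of t] h(1)[of m] by (auto simp: u_def indicator_def)
  qed
  have wint: "integrable lborel (\<lambda>t. C * indicator {0..2*pi} t :: real)" by simp
  have ui: "integrable lborel (u m)" for m
    by (rule Bochner_Integration.integrable_bound[OF wint]) (auto intro!: AE_I2 order_trans[OF uC abs_ge_self] simp: u0)
  have lim: "(\<lambda>m. LINT t|lborel. u m t) \<longlonglongrightarrow> (LINT t|lborel. indicator {0<..<2*pi} t *\<^sub>R kac_rice_density \<rho> n t)"
  proof (rule integral_dominated_convergence[OF _ _ wint])
    show "AE t in lborel. (\<lambda>m. u m t) \<longlonglongrightarrow> indicator {0<..<2*pi} t *\<^sub>R kac_rice_density \<rho> n t"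
      using AE_lborel_singleton[of 0] AE_lborel_singleton[of "2*pi"]
    proof eventually_elim
      case (elim t)
      show ?case
      proof (cases "t \<in> {0<..<2*pi}")
        case True
        have "(\<lambda>m. sign_change_prob \<rho> n (h m) t / h m) \<longlonglongrightarrow> kac_rice_density \<rho> n t"
          by (rule filterlim_compose[OF sign_change_prob_asymp hl])
        moreover have "\<forall>\<^sub>F m in sequentially. h m < 2*pi - t"
          using True by (intro order_tendstoD(2)[OF h0]) auto
        hence "\<forall>\<^sub>F m in sequentially. sign_change_prob \<rho> n (h m) t / h m = u m t"
          by eventually_elim (use True in \<open>auto simp: u_def\<close>)
        ultimately show ?thesis using True by (auto intro: Lim_transform_eventually)
      next
        case False
        hence "u m t = 0" for m using h(1)[of m] elim by (auto simp: u_def indicator_def)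
        thus ?thesis using False by simp
      qed
    qed
    show "AE t in lborel. norm (u m t) \<le> C * indicator {0..2*pi} t" for m
      using u0 uC by auto
  qed measurable
  have "ennreal (1 / h m) * (\<integral>\<^sup>+\<omega>. sign_change_measure (h m) \<omega> \<partial>M) = ennreal (LINT t|lborel. u m t)" for m
  proof -
    have "ennreal (1 / h m) * (\<integral>\<^sup>+\<omega>. sign_change_measure (h m) \<omega> \<partial>M)
       = (\<integral>\<^sup>+t. ennreal (1 / h m) * (indicator {0..2*pi-h m} t * ennreal (sign_change_prob \<rho> n (h m) t)) \<partial>lborel)"
      unfolding expectation_sign_change_measure[OF h(1,3)] by (rule nn_integral_cmult[symmetric]) measurable
    also have "\<dots> = (\<integral>\<^sup>+t. ennreal (u m t) \<partial>lborel)"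
      using h(1)[of m] by (intro nn_integral_cong) (auto simp: u_def indicator_def ennreal_mult'[symmetric])
    also have "\<dots> = ennreal (LINT t|lborel. u m t)"
      by (rule nn_integral_eq_integral[OF ui]) (use u0 in auto)
    finally show ?thesis .
  qed
  hence "(\<lambda>m. ennreal (1 / h m) * (\<integral>\<^sup>+\<omega>. sign_change_measure (h m) \<omega> \<partial>M)) \<longlonglongrightarrow> ennreal (LINT t|circ. kac_rice_density \<rho> n t)"
    unfolding integral_circ_eq by (simp only:) (intro tendsto_ennrealI lim)
  thus ?thesis by (rule expectation_num_zeros_eq_lim[OF hl h(1)])
qed

end


section \<open>Asymptotics of the Kac-Rice density\<close>

text \<open>Away from \<open>t\<close> the kernel is uniformly small, and \<open>\<psi>\<close> is integrable; near \<open>t\<close> the function \<open>\<psi>\<close> is almost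
  constant.\<close>

lemma approximate_identity:
  fixes \<kappa> :: "nat \<Rightarrow> real \<Rightarrow> real"
  assumes \<psi>: "integrable circ \<psi>" and cont: "isCont \<psi> t"
    and \<kappa>: "\<And>n. \<kappa> n \<in> borel_measurable borel" "\<And>n x. 0 \<le> \<kappa> n x" "\<And>n x. \<kappa> n x \<le> B n"
    and mass: "(\<lambda>n. LINT x|circ. \<kappa> n x) \<longlonglongrightarrow> m"
    and tail: "\<And>\<delta>. \<delta> > 0 \<Longrightarrow> \<exists>T. T \<longlonglongrightarrow> 0 \<and> (\<forall>n. \<forall>x\<in>{0<..<2*pi}. \<delta> \<le> \<bar>x - t\<bar> \<longrightarrow> \<kappa> n x \<le> T n)"
  shows "(\<lambda>n. LINT x|circ. \<psi> x * \<kappa> n x) \<longlonglongrightarrow> \<psi> t * m"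
proof -
  have ik: "integrable circ (\<kappa> n)" for n
    by (rule integrable_circ_bounded[OF \<kappa>(1), of n "B n"]) (use \<kappa> in auto)
  have ipk: "integrable circ (\<lambda>x. \<psi> x * \<kappa> n x)" for n
    using integrable_circ_mult[OF \<psi> \<kappa>(1), of n "B n"] \<kappa> by simp
  have ic: "integrable circ (\<lambda>x. c)" for c :: real
    by (rule finite_measure.integrable_const[OF finite_measure_circ])
  have id: "integrable circ (\<lambda>x. \<bar>\<psi> x - \<psi> t\<bar>)" using \<psi> ic by auto
  define Q where "Q = (LINT x|circ. \<bar>\<psi> x - \<psi> t\<bar>)"
  have "(\<lambda>n. (LINT x|circ. \<psi> x * \<kappa> n x) - \<psi> t * (LINT x|circ. \<kappa> n x)) \<longlonglongrightarrow> 0"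
  proof (rule LIMSEQ_I)
    fix r :: real assume r: "r > 0"
    have "m \<ge> 0"
      by (rule LIMSEQ_le_const[OF mass]) (auto intro!: exI[of _ 0] Bochner_Integration.integral_nonneg \<kappa>(2))
    define \<epsilon> where "\<epsilon> = r / (2 * (m + 1))"
    have \<epsilon>: "\<epsilon> > 0" using r \<open>m \<ge> 0\<close> by (simp add: \<epsilon>_def)
    obtain \<delta> where \<delta>: "\<delta> > 0" "\<And>x. \<bar>x - t\<bar> < \<delta> \<Longrightarrow> \<bar>\<psi> x - \<psi> t\<bar> < \<epsilon>"
      using cont \<epsilon> unfolding continuous_at_eps_delta by (auto simp: dist_real_def)
    obtain T where T: "T \<longlonglongrightarrow> 0" "\<And>n x. x \<in> {0<..<2*pi} \<Longrightarrow> \<delta> \<le> \<bar>x - t\<bar> \<Longrightarrow> \<kappa> n x \<le> T n"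
      using tail[OF \<delta>(1)] by blast
    have bound: "\<bar>(LINT x|circ. \<psi> x * \<kappa> n x) - \<psi> t * (LINT x|circ. \<kappa> n x)\<bar> \<le> \<epsilon> * (LINT x|circ. \<kappa> n x) + \<bar>T n\<bar> * Q" for n
    proof -
      have "(LINT x|circ. \<psi> x * \<kappa> n x) - \<psi> t * (LINT x|circ. \<kappa> n x) = (LINT x|circ. \<psi> x * \<kappa> n x - \<psi> t * \<kappa> n x)"
        using ipk ik by simp
      also have "\<bar>\<dots>\<bar> \<le> (LINT x|circ. \<bar>\<psi> x * \<kappa> n x - \<psi> t * \<kappa> n x\<bar>)" by (rule integral_abs_bound)
      also have "\<dots> \<le> (LINT x|circ. \<epsilon> * \<kappa> n x + \<bar>T n\<bar> * \<bar>\<psi> x - \<psi> t\<bar>)"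
      proof (rule integral_mono)
        fix x assume "x \<in> space circ"
        hence x: "x \<in> {0<..<2*pi}" by (simp add: space_circ)
        have "\<bar>\<psi> x * \<kappa> n x - \<psi> t * \<kappa> n x\<bar> = \<kappa> n x * \<bar>\<psi> x - \<psi> t\<bar>"
          using \<kappa>(2)[of n x] by (simp add: left_diff_distrib[symmetric] abs_mult mult.commute)
        also have "\<dots> \<le> \<epsilon> * \<kappa> n x + \<bar>T n\<bar> * \<bar>\<psi> x - \<psi> t\<bar>"
        proof (cases "\<bar>x - t\<bar> < \<delta>")
          case True
          hence "\<kappa> n x * \<bar>\<psi> x - \<psi> t\<bar> \<le> \<kappa> n x * \<epsilon>"
            using \<delta>(2) \<kappa>(2) by (intro mult_left_mono) (auto intro: less_imp_le)
          moreover have "\<kappa> n x * \<epsilon> = \<epsilon> * \<kappa> n x" by (rule mult.commute)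
          moreover have "0 \<le> \<bar>T n\<bar> * \<bar>\<psi> x - \<psi> t\<bar>" by simp
          ultimately show ?thesis by linarith
        next
          case False
          hence "\<kappa> n x \<le> \<bar>T n\<bar>" using T(2)[OF x, of n] by linarith
          hence "\<kappa> n x * \<bar>\<psi> x - \<psi> t\<bar> \<le> \<bar>T n\<bar> * \<bar>\<psi> x - \<psi> t\<bar>" by (intro mult_right_mono) auto
          moreover have "0 \<le> \<epsilon> * \<kappa> n x" using \<epsilon> \<kappa>(2) by simp
          ultimately show ?thesis by linarith
        qed
        finally show "\<bar>\<psi> x * \<kappa> n x - \<psi> t * \<kappa> n x\<bar> \<le> \<epsilon> * \<kappa> n x + \<bar>T n\<bar> * \<bar>\<psi> x - \<psi> t\<bar>" .
      qed (use ipk ik id in auto)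
      also have "\<dots> = \<epsilon> * (LINT x|circ. \<kappa> n x) + \<bar>T n\<bar> * Q"
        using ik id by (simp add: Q_def)
      finally show ?thesis .
    qed
    have "(\<lambda>n. \<epsilon> * (LINT x|circ. \<kappa> n x) + \<bar>T n\<bar> * Q) \<longlonglongrightarrow> \<epsilon> * m + \<bar>0\<bar> * Q"
      by (intro tendsto_intros mass T(1))
    moreover have "\<epsilon> * m + \<bar>0\<bar> * Q < r"
    proof -
      have "m / (2 * (m + 1)) < 1" using \<open>m \<ge> 0\<close> by simp
      from mult_strict_left_mono[OF this r] show ?thesis by (simp add: \<epsilon>_def)
    qed
    ultimately have "\<forall>\<^sub>F n in sequentially. \<epsilon> * (LINT x|circ. \<kappa> n x) + \<bar>T n\<bar> * Q < r"
      by (rule order_tendstoD(2))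
    then obtain N where "\<And>n. n \<ge> N \<Longrightarrow> \<epsilon> * (LINT x|circ. \<kappa> n x) + \<bar>T n\<bar> * Q < r"
      by (auto simp: eventually_sequentially)
    thus "\<exists>N. \<forall>n\<ge>N. norm ((LINT x|circ. \<psi> x * \<kappa> n x) - \<psi> t * (LINT x|circ. \<kappa> n x) - 0) < r"
      using bound by (auto intro!: exI[of _ N] intro: le_less_trans)
  qed
  from tendsto_add[OF this tendsto_mult[OF tendsto_const[of "\<psi> t"] mass]] show ?thesis by simp
qed

text \<open>By compactness of the closed interval: as \<open>t\<close> is interior, \<open>t - x\<close> never reaches \<open>\<plusminus>2\<pi>\<close>, so \<open>x = t\<close> is the
  only point with \<open>cis (t - x) = 1\<close>.\<close>

lemma cis_away_from_1:
  assumes t: "t \<in> {0<..<2*pi}" and \<delta>: "\<delta> > 0"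
  shows "\<exists>c>0. \<forall>x\<in>{0<..<2*pi}. \<delta> \<le> \<bar>x - t\<bar> \<longrightarrow> c \<le> cmod (1 - cis (t - x))"
proof -
  define S where "S = {0..2*pi} \<inter> {x. \<delta> \<le> \<bar>x - t\<bar>}"
  have "compact S"
    unfolding S_def by (intro compact_Int_closed closed_Collect_le continuous_intros) auto
  have nz: "cmod (1 - cis (t - x)) > 0" if x: "x \<in> S" for x
  proof -
    have "cis (t - x) \<noteq> 1"
    proof
      assume "cis (t - x) = 1"
      hence "cos (t - x) = 1" by (simp add: complex_eq_iff)
      then obtain j :: int where j: "t - x = of_int j * (2 * pi)" by (auto simp: cos_one_2pi_int)
      have "\<bar>t - x\<bar> < 2 * pi" using t x by (auto simp: S_def)
      hence "\<bar>real_of_int j\<bar> * (2 * pi) < 1 * (2 * pi)" unfolding j by (simp add: abs_mult)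
      hence "\<bar>real_of_int j\<bar> < 1" by (subst (asm) mult_less_cancel_right) auto
      hence "j = 0" by linarith
      thus False using j x \<delta> by (auto simp: S_def)
    qed
    thus ?thesis by simp
  qed
  show ?thesis
  proof (cases "S = {}")
    case True
    hence "\<not> \<delta> \<le> \<bar>x - t\<bar>" if "x \<in> {0<..<2*pi}" for x using that by (auto simp: S_def disjoint_iff)
    thus ?thesis by (intro exI[of _ 1]) auto
  next
    case False
    have "continuous_on S (\<lambda>x. cmod (1 - cis (t - x)))" by (intro continuous_intros)
    from continuous_attains_inf[OF \<open>compact S\<close> False this]
    obtain x0 where "x0 \<in> S" "\<And>x. x \<in> S \<Longrightarrow> cmod (1 - cis (t - x0)) \<le> cmod (1 - cis (t - x))" by blast
    thus ?thesis using nz by (intro exI[of _ "cmod (1 - cis (t - x0))"]) (auto simp: S_def)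
  qed
qed

lemma sum_squares_real: "(\<Sum>k=1..n. (real k)\<^sup>2) = real n * (real n + 1) * (2 * real n + 1) / 6"
  by (induction n) (simp_all add: field_simps power2_eq_square)

text \<open>The coefficients of \<open>\<alpha> f t + (\<beta> / n) f' t\<close>.\<close>

definition osc_mix :: "real \<Rightarrow> real \<Rightarrow> nat \<Rightarrow> real \<Rightarrow> nat \<Rightarrow> complex" where
  "osc_mix \<alpha> \<beta> n t k = of_real \<alpha> * osc t k + of_real (\<beta> / real n) * osc' t k"

lemma osc_mix_eq: "osc_mix \<alpha> \<beta> n t k = Complex \<alpha> (\<beta> * real k / real n) * cis (real k * t)"
  by (simp add: osc_mix_def osc_def osc'_def Complex_eq algebra_simps)

text \<open>The variance of \<open>\<alpha> f t + (\<beta> / n) f' t\<close> is an integral of \<open>\<psi>\<close> against an approximate identity. The factor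
  \<open>1 / 3\<close> is the limit of \<open>(1\<^sup>2 + \<dots> + n\<^sup>2) / n\<^sup>3\<close>.\<close>

lemma tendsto_coeff_form_osc_mix:
  assumes fp: "fourier_pair \<rho> \<psi>" and t: "t \<in> {0<..<2*pi}" and cont: "isCont \<psi> t"
  shows "(\<lambda>n. coeff_form \<rho> n (osc_mix \<alpha> \<beta> n t) (osc_mix \<alpha> \<beta> n t) / real n) \<longlonglongrightarrow> \<psi> t * (\<alpha>\<^sup>2 + \<beta>\<^sup>2 / 3)"
proof -
  have \<psi>: "integrable circ \<psi>" using fp by (simp add: fourier_pair_def)
  define \<kappa> where "\<kappa> n x = (cmod (\<Sum>k=1..n. osc_mix \<alpha> \<beta> n t k * cis (- (real k * x))))\<^sup>2 / real n" for n x
  have spec: "(LINT x|circ. f x * \<kappa> n x) = 2 * pi * (coeff_form r n (osc_mix \<alpha> \<beta> n t) (osc_mix \<alpha> \<beta> n t) / real n)"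
    if "fourier_pair r f" for r f n
    using integral_spectral_form[OF that, where n = n and z = "osc_mix \<alpha> \<beta> n t"] by (simp add: \<kappa>_def)
  have "(\<lambda>n. LINT x|circ. \<psi> x * \<kappa> n x) \<longlonglongrightarrow> \<psi> t * (2 * pi * (\<alpha>\<^sup>2 + \<beta>\<^sup>2 / 3))"
  proof (rule approximate_identity[OF \<psi> cont])
    show "\<kappa> n \<in> borel_measurable borel" for n
      unfolding \<kappa>_def by (intro borel_measurable_divide borel_measurable_const borel_measurable_continuous_onI continuous_intros)
    show "0 \<le> \<kappa> n x" for n x by (simp add: \<kappa>_def)
    show "\<kappa> n x \<le> (\<Sum>k=1..n. cmod (osc_mix \<alpha> \<beta> n t k))\<^sup>2 / real n" for n x
    proof -
      have "cmod (\<Sum>k=1..n. osc_mix \<alpha> \<beta> n t k * cis (- (real k * x))) \<le> (\<Sum>k=1..n. cmod (osc_mix \<alpha> \<beta> n t k))"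
        by (rule order_trans[OF norm_sum]) (simp add: norm_mult)
      thus ?thesis unfolding \<kappa>_def by (intro divide_right_mono power_mono) auto
    qed
    show "(\<lambda>n. LINT x|circ. \<kappa> n x) \<longlonglongrightarrow> 2 * pi * (\<alpha>\<^sup>2 + \<beta>\<^sup>2 / 3)"
    proof -
      have "(LINT x|circ. \<kappa> n x) = 2 * pi * (\<alpha>\<^sup>2 + \<beta>\<^sup>2 * ((real n + 1) * (2 * real n + 1) / (6 * (real n)\<^sup>2)))" if n: "n > 0" for n
      proof -
        have "(\<Sum>k=1..n. (cmod (osc_mix \<alpha> \<beta> n t k))\<^sup>2) = (\<Sum>k=1..n. \<alpha>\<^sup>2 + (\<beta> / real n)\<^sup>2 * (real k)\<^sup>2)"
          by (simp add: osc_mix_eq norm_mult cmod_power2 power_divide power_mult_distrib)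
        also have "\<dots> = real n * \<alpha>\<^sup>2 + (\<beta> / real n)\<^sup>2 * (real n * (real n + 1) * (2 * real n + 1) / 6)"
          by (simp only: sum.distrib sum_distrib_left[symmetric] sum_squares_real) simp
        finally have "(LINT x|circ. 1 * \<kappa> n x) = 2 * pi * ((real n * \<alpha>\<^sup>2 + (\<beta> / real n)\<^sup>2 * (real n * (real n + 1) * (2 * real n + 1) / 6)) / real n)"
          unfolding spec[OF fourier_pair_white_noise] coeff_form_white_noise by simp
        moreover have "(real n * \<alpha>\<^sup>2 + (\<beta> / real n)\<^sup>2 * (real n * (real n + 1) * (2 * real n + 1) / 6)) / real n
            = \<alpha>\<^sup>2 + \<beta>\<^sup>2 * ((real n + 1) * (2 * real n + 1) / (6 * (real n)\<^sup>2))"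
          using n by (simp add: field_simps power2_eq_square)
        ultimately show ?thesis by (simp only: mult_1)
      qed
      hence ev: "\<forall>\<^sub>F n in sequentially. 2 * pi * (\<alpha>\<^sup>2 + \<beta>\<^sup>2 * ((real n + 1) * (2 * real n + 1) / (6 * (real n)\<^sup>2))) = (LINT x|circ. \<kappa> n x)"
        by (intro eventually_sequentiallyI[of 1]) auto
      have third: "(\<lambda>n. (real n + 1) * (2 * real n + 1) / (6 * (real n)\<^sup>2)) \<longlonglongrightarrow> 1 / 3" by real_asymp
      have "(\<lambda>n. 2 * pi * (\<alpha>\<^sup>2 + \<beta>\<^sup>2 * ((real n + 1) * (2 * real n + 1) / (6 * (real n)\<^sup>2)))) \<longlonglongrightarrow> 2 * pi * (\<alpha>\<^sup>2 + \<beta>\<^sup>2 * (1 / 3))"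
        by (intro tendsto_mult tendsto_add tendsto_const third)
      from Lim_transform_eventually[OF this ev] show ?thesis by simp
    qed
    fix \<delta> :: real assume "\<delta> > 0"
    then obtain c where c: "c > 0" "\<And>x. x \<in> {0<..<2*pi} \<Longrightarrow> \<delta> \<le> \<bar>x - t\<bar> \<Longrightarrow> c \<le> cmod (1 - cis (t - x))"
      using cis_away_from_1[OF t] by blast
    define A where "A = (\<bar>\<alpha>\<bar> + \<bar>\<beta>\<bar>) * (2 / c)"
    show "\<exists>T. T \<longlonglongrightarrow> 0 \<and> (\<forall>n. \<forall>x\<in>{0<..<2*pi}. \<delta> \<le> \<bar>x - t\<bar> \<longrightarrow> \<kappa> n x \<le> T n)"
    proof (intro exI[of _ "\<lambda>n. A\<^sup>2 / real n"] conjI allI ballI impI)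
      show "(\<lambda>n. A\<^sup>2 / real n) \<longlonglongrightarrow> 0" by (rule lim_const_over_n)
      fix n x assume x: "x \<in> {0<..<2*pi}" "\<delta> \<le> \<bar>x - t\<bar>"
      define y where "y = t - x"
      have cy: "c \<le> cmod (1 - cis y)" using c(2)[OF x] by (simp add: y_def)
      hence y1: "cis y \<noteq> 1" using c(1) by auto
      have le: "2 / cmod (1 - cis y) \<le> 2 / c" using cy c(1) y1 by (intro divide_left_mono mult_pos_pos) auto
      have eq: "(\<Sum>k=1..n. osc_mix \<alpha> \<beta> n t k * cis (- (real k * x)))
          = of_real \<alpha> * (\<Sum>k=1..n. cis (real k * y)) + \<i> * of_real (\<beta> / real n) * (\<Sum>k=1..n. of_nat k * cis (real k * y))"
        unfolding sum_distrib_left sum.distrib[symmetric]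
      proof (intro sum.cong refl)
        fix k
        have "cis (real k * t) * cis (- (real k * x)) = cis (real k * y)" by (simp add: cis_mult y_def algebra_simps)
        thus "osc_mix \<alpha> \<beta> n t k * cis (- (real k * x)) = of_real \<alpha> * cis (real k * y) + \<i> * of_real (\<beta> / real n) * (of_nat k * cis (real k * y))"
          unfolding osc_mix_def osc_def osc'_def by (simp add: ring_distribs mult.assoc)
      qed
      have "cmod (\<Sum>k=1..n. osc_mix \<alpha> \<beta> n t k * cis (- (real k * x)))
         \<le> \<bar>\<alpha>\<bar> * cmod (\<Sum>k=1..n. cis (real k * y)) + \<bar>\<beta> / real n\<bar> * cmod (\<Sum>k=1..n. of_nat k * cis (real k * y))"
        unfolding eq by (rule order_trans[OF norm_triangle_ineq]) (simp add: norm_mult norm_divide)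
      also have "\<dots> \<le> \<bar>\<alpha>\<bar> * (2 / c) + \<bar>\<beta> / real n\<bar> * (real n * (2 / c))"
        by (intro add_mono mult_left_mono order_trans[OF cmod_sum_cis_le[OF y1] le]
            order_trans[OF cmod_sum_k_cis_le[OF y1] mult_left_mono[OF le]]) auto
      also have "\<dots> \<le> A" using c(1) by (cases "n = 0") (auto simp: A_def ring_distribs add_divide_distrib)
      finally show "\<kappa> n x \<le> A\<^sup>2 / real n"
        unfolding \<kappa>_def by (intro divide_right_mono power_mono) auto
    qed
  qed
  from tendsto_divide[OF this tendsto_const[of "2 * pi"]] show ?thesis
    unfolding spec[OF fp] by simp
qed

text \<open>The mixed covariance is recovered from the three variances by polarization, which avoids a separate
  treatment of its kernel, which changes sign.\<close>

lemma tendsto_kac_rice_density: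
  assumes fp: "fourier_pair \<rho> \<psi>" and t: "t \<in> {0<..<2*pi}" and cont: "isCont \<psi> t" and pos: "\<psi> t > 0"
  shows "(\<lambda>n. kac_rice_density \<rho> n t / real n) \<longlonglongrightarrow> 1 / (pi * sqrt 3)"
proof -
  define V where "V n = coeff_form \<rho> n (osc t) (osc t)" for n
  define B where "B n = coeff_form \<rho> n (osc t) (osc' t)" for n
  define C where "C n = coeff_form \<rho> n (osc' t) (osc' t)" for n
  have mix: "coeff_form \<rho> n (osc_mix \<alpha> \<beta> n t) (osc_mix \<alpha> \<beta> n t) = \<alpha>\<^sup>2 * V n + 2 * \<alpha> * (\<beta> / real n) * B n + (\<beta> / real n)\<^sup>2 * C n" for \<alpha> \<beta> n
    unfolding osc_mix_def[abs_def] coeff_form_square V_def B_def C_def ..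
  note L = tendsto_coeff_form_osc_mix[OF fp t cont, unfolded mix]
  have V: "(\<lambda>n. V n / real n) \<longlonglongrightarrow> \<psi> t" using L[of 1 0] by simp
  have C: "(\<lambda>n. (1 / real n)\<^sup>2 * C n / real n) \<longlonglongrightarrow> \<psi> t / 3" using L[of 0 1] by simp
  have B: "(\<lambda>n. (1 / real n) * B n / real n) \<longlonglongrightarrow> 0"
  proof -
    have "(\<lambda>n. (((V n + 2 * (1 / real n) * B n + (1 / real n)\<^sup>2 * C n) / real n - V n / real n) - (1 / real n)\<^sup>2 * C n / real n) / 2)
        \<longlonglongrightarrow> ((\<psi> t * (1 + 1 / 3) - \<psi> t) - \<psi> t / 3) / 2"
      using L[of 1 1] by (intro tendsto_intros V C) simp_all
    moreover have "(((V n + 2 * (1 / real n) * B n + (1 / real n)\<^sup>2 * C n) / real n - V n / real n) - (1 / real n)\<^sup>2 * C n / real n) / 2 = (1 / real n) * B n / real n" for n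
      by (simp add: add_divide_distrib)
    moreover have "((\<psi> t * (1 + 1 / 3) - \<psi> t) - \<psi> t / 3) / 2 = 0" by simp
    ultimately show ?thesis by (simp only:)
  qed
  have "(\<lambda>n. sqrt ((V n / real n) * ((1 / real n)\<^sup>2 * C n / real n) - ((1 / real n) * B n / real n)\<^sup>2) / (pi * (V n / real n)))
     \<longlonglongrightarrow> sqrt (\<psi> t * (\<psi> t / 3) - 0\<^sup>2) / (pi * \<psi> t)"
    using pos by (intro tendsto_intros V B C) auto
  also have "sqrt (\<psi> t * (\<psi> t / 3) - 0\<^sup>2) / (pi * \<psi> t) = 1 / (pi * sqrt 3)"
    using pos by (simp add: real_sqrt_divide)
  finally show ?thesis
  proof (rule Lim_transform_eventually)
    show "\<forall>\<^sub>F n in sequentially. sqrt ((V n / real n) * ((1 / real n)\<^sup>2 * C n / real n) - ((1 / real n) * B n / real n)\<^sup>2) / (pi * (V n / real n)) = kac_rice_density \<rho> n t / real n"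
    proof (rule eventually_sequentiallyI[of 1])
      fix n :: nat assume n: "1 \<le> n"
      have "(V n / real n) * ((1 / real n)\<^sup>2 * C n / real n) - ((1 / real n) * B n / real n)\<^sup>2 = (V n * C n - (B n)\<^sup>2) / ((real n)\<^sup>2)\<^sup>2"
        using n by (simp add: field_simps power2_eq_square)
      hence "sqrt ((V n / real n) * ((1 / real n)\<^sup>2 * C n / real n) - ((1 / real n) * B n / real n)\<^sup>2) = sqrt (V n * C n - (B n)\<^sup>2) / (real n)\<^sup>2"
        by (simp only: real_sqrt_divide real_sqrt_abs) simp
      thus "sqrt ((V n / real n) * ((1 / real n)\<^sup>2 * C n / real n) - ((1 / real n) * B n / real n)\<^sup>2) / (pi * (V n / real n)) = kac_rice_density \<rho> n t / real n"
        using n by (simp add: kac_rice_density_def V_def B_def C_def power2_eq_square)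
    qed
  qed
qed


section \<open>Integrating the asymptotics\<close>

text \<open>A special case of Vitali's convergence theorem: truncating at level \<open>L\<close> changes the integral by at most
  \<open>K / L\<close>, and the truncated functions converge by dominated convergence.\<close>

lemma (in finite_measure) tendsto_integral_of_square_bound:
  fixes g :: "nat \<Rightarrow> 'a \<Rightarrow> real"
  assumes [measurable]: "\<And>n. g n \<in> borel_measurable M" and g0: "\<And>n x. x \<in> space M \<Longrightarrow> 0 \<le> g n x"
    and sq: "\<And>n. integrable M (\<lambda>x. (g n x)\<^sup>2)" "\<And>n. n \<ge> n0 \<Longrightarrow> (LINT x|M. (g n x)\<^sup>2) \<le> K"
    and lim: "AE x in M. (\<lambda>n. g n x) \<longlonglongrightarrow> c"
  shows "(\<lambda>n. LINT x|M. g n x) \<longlonglongrightarrow> c * measure M (space M)"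
proof (rule LIMSEQ_I)
  fix r :: real assume r: "r > 0"
  have gi: "integrable M (g n)" for n
  proof (rule Bochner_Integration.integrable_bound)
    show "integrable M (\<lambda>x. 1 + (g n x)\<^sup>2)" using sq(1) by simp
    have "\<bar>y\<bar> \<le> 1 + y\<^sup>2" for y :: real
      using sum_squares_bound[of "\<bar>y\<bar>" 1] by simp
    thus "AE x in M. norm (g n x) \<le> norm (1 + (g n x)\<^sup>2)"
      unfolding real_norm_def by (intro AE_I2 order_trans[OF _ abs_ge_self])
  qed simp
  \<comment> \<open>\<open>L \<ge> c\<close> leaves the limit untouched, and \<open>L > 2 K / r\<close> makes the truncation error less than \<open>r / 2\<close>.\<close>
  define L where "L = max 1 (max c (2 * \<bar>K\<bar> / r + 1))"
  have L: "L \<ge> 1" "L \<ge> c" "L > 2 * \<bar>K\<bar> / r" by (auto simp: L_def max_def)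
  have KL: "\<bar>K\<bar> / L < r / 2"
    using L r by (simp add: field_simps)
  have "(\<lambda>n. LINT x|M. min (g n x) L) \<longlonglongrightarrow> (LINT x|M. c)"
  proof (rule integral_dominated_convergence[where w="\<lambda>_. L"])
    show "AE x in M. (\<lambda>n. min (g n x) L) \<longlonglongrightarrow> c" using lim
    proof eventually_elim
      case (elim x)
      from tendsto_min[OF this tendsto_const[of L]] show ?case using L(2) by simp
    qed
    show "AE x in M. norm (min (g n x) L) \<le> L" for n
      using g0[of _ n] L(1) by (intro AE_I2) (auto simp: min_def)
  qed auto
  hence "(\<lambda>n. LINT x|M. min (g n x) L) \<longlonglongrightarrow> c * measure M (space M)" by (simp add: mult.commute)
  then obtain N where N: "\<And>n. n \<ge> N \<Longrightarrow> \<bar>(LINT x|M. min (g n x) L) - c * measure M (space M)\<bar> < r / 2"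
    using LIMSEQ_D[of _ _ "r / 2"] r by (metis half_gt_zero real_norm_def)
  have trunc: "\<bar>(LINT x|M. g n x) - (LINT x|M. min (g n x) L)\<bar> \<le> \<bar>K\<bar> / L" if n: "n \<ge> n0" for n
  proof -
    have mi: "integrable M (\<lambda>x. min (g n x) L)"
      by (rule integrable_const_bound[where B=L]) (use g0[of _ n] L(1) in \<open>auto simp: min_def\<close>)
    have "(LINT x|M. g n x) - (LINT x|M. min (g n x) L) = (LINT x|M. g n x - min (g n x) L)"
      using gi mi by simp
    also have "\<bar>\<dots>\<bar> \<le> (LINT x|M. \<bar>g n x - min (g n x) L\<bar>)" by (rule integral_abs_bound)
    also have "\<dots> \<le> (LINT x|M. (g n x)\<^sup>2 / L)"
    proof (rule integral_mono)
      fix x assume x: "x \<in> space M"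
      show "\<bar>g n x - min (g n x) L\<bar> \<le> (g n x)\<^sup>2 / L"
      proof (cases "g n x \<le> L")
        case True thus ?thesis using L(1) by (simp add: min_def)
      next
        case False
        hence "g n x * L \<le> g n x * g n x" using L(1) by (intro mult_left_mono) auto
        hence "g n x \<le> (g n x)\<^sup>2 / L" using L(1) by (simp add: field_simps power2_eq_square)
        thus ?thesis using False L(1) by (simp add: min_def)
      qed
    qed (use gi mi sq(1) in auto)
    also have "\<dots> \<le> \<bar>K\<bar> / L" using sq(2)[OF n] L(1) by (simp add: divide_right_mono)
    finally show ?thesis .
  qed
  show "\<exists>no. \<forall>n\<ge>no. norm ((LINT x|M. g n x) - c * measure M (space M)) < r"
  proof (intro exI allI impI)
    fix n assume "n \<ge> max N n0"
    hence "\<bar>(LINT x|M. min (g n x) L) - c * measure M (space M)\<bar> < r / 2" "\<bar>(LINT x|M. g n x) - (LINT x|M. min (g n x) L)\<bar> \<le> \<bar>K\<bar> / L"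
      using N trunc by auto
    thus "norm ((LINT x|M. g n x) - c * measure M (space M)) < r" using KL unfolding real_norm_def by linarith
  qed
qed

text \<open>Only the diagonal terms survive the integration over \<open>t\<close>, so \<open>\<rho> 0\<close> is the only correlation left.\<close>

lemma integral_derivative_variance:
  "(LINT t|circ. coeff_form \<rho> n (osc' t) (osc' t)) = 2 * pi * \<rho> 0 * (\<Sum>k=1..n. (real k)\<^sup>2)"
proof -
  have Re: "Re (osc' t k * cnj (osc' t l)) = real k * real l * cos (of_int (int k - int l) * t)" for k l t
  proof -
    have "of_int (int k - int l) * t = real k * t - real l * t" by (simp add: algebra_simps)
    thus ?thesis by (simp only: cos_diff) (simp add: osc'_def algebra_simps)
  qed
  have ic: "integrable circ (\<lambda>t. cos (of_int j * t))" for j :: int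
    by (rule integrable_circ_bounded[where C=1]) auto
  have "(LINT t|circ. coeff_form \<rho> n (osc' t) (osc' t))
     = (\<Sum>k=1..n. \<Sum>l=1..n. (LINT t|circ. \<rho> (nat \<bar>int k - int l\<bar>) * (real k * real l * cos (of_int (int k - int l) * t))))"
    unfolding coeff_form_def Re
    by (subst Bochner_Integration.integral_sum; (intro Bochner_Integration.integrable_sum integrable_mult_right ic)?)
       (intro sum.cong refl Bochner_Integration.integral_sum integrable_mult_right ic)
  also have "\<dots> = (\<Sum>k=1..n. \<Sum>l=1..n. if k = l then 2 * pi * \<rho> 0 * (real k)\<^sup>2 else 0)"
    by (intro sum.cong refl) (simp add: integral_circ_cos power2_eq_square del: of_int_diff)
  finally show ?thesis by (simp add: sum_distrib_left)
qed

context definite_correlation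
begin

lemma kac_rice_density_nonneg: "kac_rice_density \<rho> n t \<ge> 0"
  unfolding kac_rice_density_def using gram_nonneg[of t "osc' t"] variance_pos[of t] by simp

text \<open>Dropping \<open>B\<^sup>2\<close> and using \<open>V \<ge> \<gamma> n\<close>. The right-hand side has a bounded integral over \<open>t\<close>.\<close>

lemma kac_rice_density_square_le:
  "(kac_rice_density \<rho> n t / real n)\<^sup>2 \<le> coeff_form \<rho> n (osc' t) (osc' t) / (\<gamma> * real n ^ 3)"
proof -
  define V where "V = coeff_form \<rho> n (osc t) (osc t)"
  define C where "C = coeff_form \<rho> n (osc' t) (osc' t)"
  define B where "B = coeff_form \<rho> n (osc t) (osc' t)"
  have V: "V \<ge> \<gamma> * real n" using definite[of "osc t"] by (simp add: V_def)
  have np: "real n > 0" using n by simp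
  hence gn: "\<gamma> * real n > 0" using gamma by simp
  hence Vp: "V > 0" using V by linarith
  have C: "C \<ge> 0" unfolding C_def by (rule coeff_form_nonneg)
  have "(kac_rice_density \<rho> n t / real n)\<^sup>2 = (V * C - B\<^sup>2) / (pi * V * real n)\<^sup>2"
    using gram_nonneg[of t "osc' t"] by (simp add: kac_rice_density_def V_def C_def B_def power_divide power_mult_distrib)
  also have "\<dots> \<le> (V * C) / (V * real n)\<^sup>2"
  proof (rule frac_le)
    have "1 * (V * real n) \<le> pi * (V * real n)" using Vp np pi_ge_two by (intro mult_right_mono) auto
    thus "(V * real n)\<^sup>2 \<le> (pi * V * real n)\<^sup>2" using Vp np by (intro power_mono) (auto simp: mult.assoc)
  qed (use Vp np C in auto)
  also have "\<dots> = C / (V * (real n)\<^sup>2)" using Vp np by (simp add: power2_eq_square field_simps)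
  also have "\<dots> \<le> C / (\<gamma> * real n * (real n)\<^sup>2)"
    using V gn np C by (intro divide_left_mono mult_right_mono mult_pos_pos) (auto simp: Vp gamma)
  also have "\<dots> = C / (\<gamma> * real n ^ 3)" by (simp add: power2_eq_square power3_eq_cube mult_ac)
  finally show ?thesis by (simp add: C_def)
qed

end

theorem theorem1:
  fixes M :: "'a measure" and a b :: "nat \<Rightarrow> 'a \<Rightarrow> real"
    and \<rho> :: "nat \<Rightarrow> real" and \<psi> :: "real \<Rightarrow> real"
  assumes "prob_space M"
    and "stationary_gaussian_seq M \<rho> a"
    and "stationary_gaussian_seq M \<rho> b"
    and "\<rho> 0 = 1"
    and "prob_space.indep_var M
           (Pi\<^sub>M {1..} (\<lambda>_. borel)) (\<lambda>\<omega>. \<lambda>k\<in>{1..}. a k \<omega>)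
           (Pi\<^sub>M {1..} (\<lambda>_. borel)) (\<lambda>\<omega>. \<lambda>k\<in>{1..}. b k \<omega>)"
    and "\<forall>k\<ge>1. \<forall>l\<ge>1. (LINT \<omega>|M. a k \<omega> * b l \<omega>) = 0"
    and "is_spectral_function \<rho> \<psi>"
    and "set_integrable lborel {0..2*pi} \<psi>"
    and "continuous_on {0<..<2*pi} \<psi>"
    and "(INF t\<in>{0<..<2*pi}. ereal (\<psi> t)) > 0"
  shows "(\<lambda>n. enn2real (\<integral>\<^sup>+\<omega>. num_zeros {0..2*pi} (trig_poly a b n \<omega>) \<partial>M))
           \<sim>[at_top] (\<lambda>n. 2 * real n / sqrt 3)"
proof -
  obtain \<gamma> where "0 < ereal \<gamma>" and \<gamma>_INF: "ereal \<gamma> < (INF t\<in>{0<..<2*pi}. ereal (\<psi> t))"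
    using ereal_dense2[OF assms(10)] by auto
  hence \<gamma>: "\<gamma> > 0" by simp
  have \<psi>_ge: "\<gamma> \<le> \<psi> t" if "t \<in> {0<..<2*pi}" for t
    using less_le_trans[OF \<gamma>_INF INF_lower[OF that]] by simp
  have fp: "fourier_pair \<rho> \<psi>" by (rule fourier_pair_spectral_function[OF assms(7,8)])
  have corr: "definite_correlation \<rho> n \<gamma>" if "n \<ge> 1" for n
    by (rule definite_correlation.intro[OF that \<gamma> coeff_form_lower_bound[OF fp \<psi>_ge]])
  have seq: "gaussian_seq_pair M a b \<rho>"
    by (intro gaussian_seq_pair.intro gaussian_seq_pair_axioms.intro assms(1-5))
  \<comment> \<open>For \<open>n = 0\<close> the form is not definite, so the value there is set by hand.\<close>
  define g where "g n t = (if n = 0 then 0 else kac_rice_density \<rho> n t / real n)" for n t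
  have g_le: "0 \<le> g n t \<and> (g n t)\<^sup>2 \<le> coeff_form \<rho> n (osc' t) (osc' t) / (\<gamma> * real n ^ 3)" for n t
    using definite_correlation.kac_rice_density_nonneg[OF corr, of n t]
      definite_correlation.kac_rice_density_square_le[OF corr, of n t]
    by (cases "n = 0") (auto simp: g_def)
  have [measurable]: "g n \<in> borel_measurable borel" for n
    unfolding g_def by (cases "n = 0") (simp_all, measurable)
  have Ci: "integrable circ (\<lambda>t. coeff_form \<rho> n (osc' t) (osc' t) / (\<gamma> * real n ^ 3))" for n
  proof (rule integrable_divide, rule integrable_circ_bounded)
    show "\<bar>coeff_form \<rho> n (osc' t) (osc' t)\<bar> \<le> (\<Sum>k=1..n. \<Sum>l=1..n. \<bar>\<rho> (nat \<bar>int k - int l\<bar>)\<bar>) * (real n * real n)" for t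
      by (rule coeff_form_bound) (auto simp: osc'_def norm_mult)
  qed measurable
  have sqi: "integrable circ (\<lambda>t. (g n t)\<^sup>2)" for n
  proof (rule Bochner_Integration.integrable_bound[OF Ci])
    show "(\<lambda>t. (g n t)\<^sup>2) \<in> borel_measurable circ"
      by (rule measurable_restrict_space1) measurable
    show "AE t in circ. norm ((g n t)\<^sup>2) \<le> norm (coeff_form \<rho> n (osc' t) (osc' t) / (\<gamma> * real n ^ 3))"
    proof (rule AE_I2)
      fix t
      have "norm ((g n t)\<^sup>2) = (g n t)\<^sup>2" by simp
      also have "\<dots> \<le> coeff_form \<rho> n (osc' t) (osc' t) / (\<gamma> * real n ^ 3)" using g_le by blast
      also have "\<dots> \<le> norm \<dots>" unfolding real_norm_def by (rule abs_ge_self)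
      finally show "norm ((g n t)\<^sup>2) \<le> norm (coeff_form \<rho> n (osc' t) (osc' t) / (\<gamma> * real n ^ 3))" .
    qed
  qed
  have sqle: "(LINT t|circ. (g n t)\<^sup>2) \<le> 2 * pi / \<gamma>" if n: "n \<ge> 1" for n
  proof -
    have "(LINT t|circ. (g n t)\<^sup>2) \<le> (LINT t|circ. coeff_form \<rho> n (osc' t) (osc' t) / (\<gamma> * real n ^ 3))"
      by (rule integral_mono[OF sqi Ci]) (use g_le in auto)
    also have "\<dots> = 2 * pi * (\<Sum>k=1..n. (real k)\<^sup>2) / (\<gamma> * real n ^ 3)"
      by (simp add: integral_derivative_variance assms(4))
    also have "(\<Sum>k=1..n. (real k)\<^sup>2) \<le> (\<Sum>k=1..n. (real n)\<^sup>2)"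
      by (intro sum_mono power_mono) auto
    hence "2 * pi * (\<Sum>k=1..n. (real k)\<^sup>2) / (\<gamma> * real n ^ 3) \<le> 2 * pi * (\<Sum>k=1..n. (real n)\<^sup>2) / (\<gamma> * real n ^ 3)"
      using \<gamma> by (intro divide_right_mono mult_left_mono) auto
    also have "\<dots> = 2 * pi / \<gamma>" using n \<gamma> by (simp add: power2_eq_square power3_eq_cube)
    finally show ?thesis .
  qed
  have lim: "(\<lambda>n. g n t) \<longlonglongrightarrow> 1 / (pi * sqrt 3)" if t: "t \<in> {0<..<2*pi}" for t
  proof -
    have "isCont \<psi> t" using assms(9) t by (simp add: continuous_on_eq_continuous_at)
    moreover have "\<psi> t > 0" using \<psi>_ge[OF t] \<gamma> by linarith
    ultimately have "(\<lambda>n. kac_rice_density \<rho> n t / real n) \<longlonglongrightarrow> 1 / (pi * sqrt 3)"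
      by (rule tendsto_kac_rice_density[OF fp t])
    thus ?thesis
      by (rule Lim_transform_eventually) (auto intro!: eventually_sequentiallyI[of 1] simp: g_def)
  qed
  have "(\<lambda>n. LINT t|circ. g n t) \<longlonglongrightarrow> 1 / (pi * sqrt 3) * measure circ (space circ)"
  proof (rule finite_measure.tendsto_integral_of_square_bound[OF finite_measure_circ _ _ sqi sqle])
    show "g n \<in> borel_measurable circ" for n by (rule measurable_restrict_space1) measurable
    show "AE t in circ. (\<lambda>n. g n t) \<longlonglongrightarrow> 1 / (pi * sqrt 3)" using lim by (intro AE_I2) (simp add: space_circ)
  qed (use g_le in auto)
  also have "1 / (pi * sqrt 3) * measure circ (space circ) = 2 / sqrt 3" unfolding measure_circ by simp
  finally have "(\<lambda>n. (LINT t|circ. g n t) / (2 / sqrt 3)) \<longlonglongrightarrow> (2 / sqrt 3) / (2 / sqrt 3)"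
    by (intro tendsto_intros) auto
  hence "(\<lambda>n. (LINT t|circ. g n t) / (2 / sqrt 3)) \<longlonglongrightarrow> 1" by simp
  moreover have "\<forall>\<^sub>F n in sequentially. (LINT t|circ. g n t) / (2 / sqrt 3)
      = enn2real (\<integral>\<^sup>+\<omega>. num_zeros {0..2*pi} (trig_poly a b n \<omega>) \<partial>M) / (2 * real n / sqrt 3)"
  proof (rule eventually_sequentiallyI[of 1])
    fix n :: nat assume n: "1 \<le> n"
    interpret definite_gaussian_seq_pair M a b \<rho> n \<gamma>
      by (intro definite_gaussian_seq_pair.intro seq corr n)
    have "enn2real (\<integral>\<^sup>+\<omega>. num_zeros {0..2*pi} (trig_poly a b n \<omega>) \<partial>M) = (LINT t|circ. kac_rice_density \<rho> n t)"
      unfolding expectation_num_zeros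
      by (intro enn2real_ennreal Bochner_Integration.integral_nonneg kac_rice_density_nonneg)
    moreover have "(LINT t|circ. g n t) = (LINT t|circ. kac_rice_density \<rho> n t) / real n"
      using n by (simp add: g_def)
    ultimately show "(LINT t|circ. g n t) / (2 / sqrt 3)
      = enn2real (\<integral>\<^sup>+\<omega>. num_zeros {0..2*pi} (trig_poly a b n \<omega>) \<partial>M) / (2 * real n / sqrt 3)"
      by (simp add: mult.commute)
  qed
  ultimately have "(\<lambda>n. enn2real (\<integral>\<^sup>+\<omega>. num_zeros {0..2*pi} (trig_poly a b n \<omega>) \<partial>M) / (2 * real n / sqrt 3)) \<longlonglongrightarrow> 1"
    by (rule Lim_transform_eventually)
  thus ?thesis by (rule asymp_equivI')
qed

end
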